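(* Let $Q(x,y)=ax^2+bxy+cy^2$ with $a,b,c\in\mathbb{Z}$, $\gcd(a,b,c)=1$, be a positive definite binary quadratic form, and let $\ell\ge5$ be a prime. Then there exist integers $x,y$ such that every prime $p$ dividing $Q(x,y)$ satisfies $p\not\equiv0\pmod\ell$ and $p\not\equiv-1\pmod\ell$. *)

theory Defs
  imports Complex_Main "HOL-Computational_Algebra.Primes" "HOL-Number_Theory.Cong"
begin

definition binary_qf :: "'a::comm_ring_1 \<Rightarrow> 'a \<Rightarrow> 'a \<Rightarrow> 'a \<Rightarrow> 'a \<Rightarrow> 'a" where
  "binary_qf a b c x y = a * x\<^sup>2 + b * x * y + c * y\<^sup>2"

text \<open>Positive definiteness of an integral form is that of the real quadratic form it induces.\<close>

definition positive_definite_qf :: "int \<Rightarrow> int \<Rightarrow> int \<Rightarrow> bool" where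
  "positive_definite_qf a b c \<longleftrightarrow>
     (\<forall>x y :: real. (x, y) \<noteq> (0, 0) \<longrightarrow> binary_qf (of_int a) (of_int b) (of_int c) x y > 0)"

end

theory Submission
  imports "HOL-Analysis.Analysis" "HOL-Number_Theory.Number_Theory" "HOL-Algebra.Coset" Defs
begin

text \<open>
  Passing to a sublattice, one may take the form to be \<open>n x\<^sup>2 + 2 h x y + k y\<^sup>2\<close> with \<open>D = n k - h\<^sup>2\<close> divisible by \<open>6 l\<close> and \<open>n\<close>
  coprime to \<open>D\<close>. It belongs to the lattice spanned by \<open>1\<close> and \<open>(h + \<delta>) / n\<close> with \<open>\<delta>\<^sup>2 = -D\<close>, and such lattices up to homothety
  form a finite abelian group. The lattices representing a number without prime factors \<open>p \<equiv> 0, -1 (mod l)\<close> form a subgroup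
  containing the classes above all other primes that split. If it is proper, some nontrivial class group character \<open>ch\<close> is trivial on it.
  The Dirichlet series of \<open>ch\<close>, and that of its twist by a faithful character \<open>\<psi>\<close> modulo \<open>l\<close>, stay bounded as \<open>s \<rightarrow> 1\<close>,
  because their leading terms cancel in the sum over lattice points. Comparing with Euler products, the primes that split but are not
  congruent to \<open>-1\<close> modulo \<open>l\<close> are sparse, which contradicts the pole of the series of the trivial character. Apart from
  one explicit character modulo 5, only upper bounds for the nontrivial series are used, not their nonvanishing at \<open>s = 1\<close>.
\<close>

section \<open>Sums over the values of a positive definite form\<close>

text \<open>The obstacle is the residue class of -1 modulo \<open>l\<close>: nothing is known about
  \<open>ch\<close> at the split primes in it. Adding the logarithms of the series of
  \<open>ch\<close> and \<open>ch \<psi>\<close> gives the weight \<open>1 + Re \<psi>\<close>,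
  which is nonnegative and vanishes only there, so two upper bounds suffice to make the other split
  primes sparse. Almost all split primes would then lie in the class of -1, where
  \<open>\<psi>^2\<close> is 1, and the series of \<open>\<psi>^2\<close> would inherit the pole of
  the trivial one. Its leading term cancels only if \<open>\<psi>^4\<close> is nontrivial, which
  fails for \<open>l = 5\<close>; there one counts at most two roots per prime times density 1/4,
  which is below 1. The divisor \<open>6 l\<close> of \<open>D\<close> has three purposes. The
  factor \<open>l\<close> makes \<open>\<psi>\<close> a character modulo \<open>D\<close>, where the
  form is a square up to a constant. The factor 2 makes every index prime to \<open>D\<close> also
  prime to \<open>2 h\<close>, so the lattices in use are invertible. Dropping the primes 2 and 3
  keeps all Euler factors within 1/2 of 1 by crude estimates. All error terms are uniform in
  \<open>1 < s \<le> 2\<close>, so no analytic continuation enters.\<close>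

definition qv :: "int \<Rightarrow> int \<Rightarrow> int \<Rightarrow> int \<times> int \<Rightarrow> int" where
  "qv n h k v = n * (fst v)\<^sup>2 + 2 * h * fst v * snd v + k * (snd v)\<^sup>2"

text \<open>A shifted 1-norm: of the order of the length of a nonzero \<open>v\<close>, yet at least
  1 at the origin too, so that negative powers need no case distinction.\<close>

definition wt :: "int \<times> int \<Rightarrow> real" where
  "wt v = 1 + \<bar>of_int (fst v)\<bar> + \<bar>of_int (snd v)\<bar>"

lemma wt_ge_1: "wt v \<ge> 1"
  by (simp add: wt_def)

lemma summable_on_int_powr:
  assumes "t > (1::real)"
  shows "(\<lambda>x::int. (1 + \<bar>of_int x\<bar>) powr (-t)) summable_on UNIV"
proof -
  let ?f = "\<lambda>x::int. (1 + \<bar>of_int x\<bar>) powr (-t)"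
  have "summable (\<lambda>i::nat. of_nat i powr (-t))"
    using assms by (subst summable_real_powr_iff) auto
  then have "summable (\<lambda>i::nat. of_nat (Suc i) powr (-t))"
    by (subst summable_Suc_iff)
  then have nat: "(\<lambda>i::nat. of_nat (Suc i) powr (-t)) summable_on UNIV"
    by (intro norm_summable_imp_summable_on) simp
  have "?f summable_on range int"
    by (subst summable_on_reindex) (use nat in \<open>auto simp: o_def inj_on_def\<close>)
  moreover have "?f summable_on range (\<lambda>i. - int i)"
    by (subst summable_on_reindex) (use nat in \<open>auto simp: o_def inj_on_def\<close>)
  ultimately have "?f summable_on (range int \<union> range (\<lambda>i. - int i))"
    by (rule summable_on_union)
  moreover have "range int \<union> range (\<lambda>i. - int i) = UNIV"
    by (auto simp: image_iff) (metis int_cases2)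
  ultimately show ?thesis by simp
qed

text \<open>Since \<open>(1 + |x|) (1 + |y|) \<le> (wt v)^2\<close>, the sum is dominated by a
  product of two one-dimensional sums.\<close>

lemma summable_on_wt:
  assumes "s > (1::real)"
  shows "(\<lambda>v. wt v powr (- 2 * s)) summable_on UNIV"
proof (rule summable_on_comparison_test)
  let ?g = "\<lambda>x::int. (1 + \<bar>of_int x\<bar>) powr (-s)"
  have g: "?g summable_on UNIV" by (rule summable_on_int_powr) fact
  have "(\<lambda>(x,y). ?g x * ?g y) summable_on UNIV \<times> UNIV"
    by (intro summable_on_SigmaI[where g = "\<lambda>x. ?g x * infsum ?g UNIV"])
       (auto intro!: has_sum_cmult_right g summable_on_cmult_left has_sum_infsum)
  then show "(\<lambda>v. ?g (fst v) * ?g (snd v)) summable_on UNIV"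
    by (simp add: case_prod_unfold)
  show "wt v powr (- 2 * s) \<le> ?g (fst v) * ?g (snd v)" for v
  proof -
    let ?a = "1 + \<bar>real_of_int (fst v)\<bar>" and ?b = "1 + \<bar>real_of_int (snd v)\<bar>"
    have "?a * ?b \<le> (wt v)\<^sup>2"
      by (simp add: wt_def algebra_simps power2_eq_square)
    then have "((wt v)\<^sup>2) powr (-s) \<le> (?a * ?b) powr (-s)"
      using assms by (intro powr_mono2') (auto simp: add_pos_nonneg)
    moreover have "((wt v)\<^sup>2) powr (-s) = wt v powr (- 2 * s)"
      using wt_ge_1[of v] by (simp flip: powr_numeral add: powr_powr)
    ultimately show ?thesis by (simp add: powr_mult)
  qed
qed auto

text \<open>Mean value theorem; weakening the exponent \<open>-s - 1\<close> to \<open>-2\<close>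
  makes the bound uniform in \<open>s\<close>, and the bounded error terms below rest on
  this.\<close>

lemma powr_diff_bound:
  fixes A B s :: real
  assumes "A \<ge> 1" "B \<ge> 1" "m > 0" "A \<ge> m" "B \<ge> m" "1 < s" "s \<le> 2"
  shows "\<bar>A powr (-s) - B powr (-s)\<bar> \<le> 2 * \<bar>A - B\<bar> / m\<^sup>2"
proof -
  have *: "\<bar>A powr (-s) - B powr (-s)\<bar> \<le> 2 * \<bar>A - B\<bar> / m\<^sup>2" 
    if "A < B" "A \<ge> 1" "A \<ge> m" for A B :: real
  proof -
    have "\<exists>z>A. z < B \<and> B powr (-s) - A powr (-s) = (B - A) * (- s * z powr (-s - 1))"
      using that by (intro MVT2) (auto intro!: derivative_eq_intros simp: field_simps)
    then obtain z where z: "z > A" "z < B" "B powr (-s) - A powr (-s) = (B - A) * (- s * z powr (-s - 1))"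
      by blast
    have "z powr (-s - 1) \<le> z powr (-2)"
      using z that assms by (intro powr_mono) auto
    also have "\<dots> \<le> m powr (-2)"
      using z that assms by (intro powr_mono2') auto
    also have "\<dots> = 1 / m\<^sup>2" using assms by (simp add: powr_minus field_simps)
    finally have "s * z powr (-s - 1) \<le> 2 * (1 / m\<^sup>2)"
      using assms by (intro mult_mono) auto
    then have "(B - A) * (s * z powr (-s - 1)) \<le> (B - A) * (2 * (1 / m\<^sup>2))"
      using that by (intro mult_left_mono) auto
    moreover have "(B - A) * (s * z powr (-s - 1)) \<ge> 0"
      using that assms by (intro mult_nonneg_nonneg) auto
    then have "\<bar>A powr (-s) - B powr (-s)\<bar> = (B - A) * (s * z powr (-s - 1))"
      using z(3) by simp
    ultimately show ?thesis using that by (simp add: field_simps)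
  qed
  show ?thesis
    using *[of A B] *[of B A] assms by (cases A B rule: linorder_cases) (auto simp: abs_minus_commute)
qed

lemma infsum_sublattice:
  fixes g :: "int \<times> int \<Rightarrow> complex"
  assumes "inj \<phi>" 
  shows "(\<Sum>\<^sub>\<infinity>v. of_bool (v \<in> range \<phi>) * g v) = (\<Sum>\<^sub>\<infinity>u. g (\<phi> u))"
proof -
  have "(\<Sum>\<^sub>\<infinity>v. of_bool (v \<in> range \<phi>) * g v) = (\<Sum>\<^sub>\<infinity>v\<in>range \<phi>. g v)"
    by (rule infsum_cong_neutral) auto
  also have "\<dots> = (\<Sum>\<^sub>\<infinity>u. g (\<phi> u))"
    using assms by (simp add: infsum_reindex o_def)
  finally show ?thesis .
qed

section \<open>Growth of one positive definite form and its Dirichlet series near s = 1\<close>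

locale pos_form =
  fixes n h k :: int
  assumes n_pos: "n > 0" and disc_pos: "h\<^sup>2 < n * k"
begin

abbreviation q :: "int \<times> int \<Rightarrow> int" where "q \<equiv> qv n h k"

\<comment> \<open>The origin contributes nothing, because \<open>0 powr (-s) = 0\<close>.\<close>
definition qt :: "real \<Rightarrow> int \<times> int \<Rightarrow> real" where
  "qt s v = of_int (q v) powr (-s)"

lemma k_pos: "k > 0"
proof (rule ccontr)
  assume "\<not> k > 0"
  then have "n * k \<le> 0" using n_pos by (simp add: mult_le_0_iff)
  then show False using disc_pos zero_le_power2[of h] by linarith
qed

text \<open>Cayley-Hamilton for the Gram matrix \<open>Q\<close> of the form:
  \<open>Q^2 = tr Q * Q - det Q * I\<close>, so the difference of the two sides is the squared
  length of \<open>Q v\<close>.\<close>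

lemma q_lower_sq: "(n * k - h\<^sup>2) * ((fst v)\<^sup>2 + (snd v)\<^sup>2) \<le> (n + k) * q v"
proof -
  have "(n + k) * q v - (n * k - h\<^sup>2) * ((fst v)\<^sup>2 + (snd v)\<^sup>2)
      = (n * fst v + h * snd v)\<^sup>2 + (h * fst v + k * snd v)\<^sup>2"
    by (simp add: qv_def power2_eq_square algebra_simps)
  then show ?thesis by (smt (verit) zero_le_power2)
qed

lemma q_pos: assumes "v \<noteq> 0" shows "q v \<ge> 1"
proof -
  have "(fst v)\<^sup>2 + (snd v)\<^sup>2 > 0"
    using assms by (cases v) (auto simp: zero_prod_def sum_power2_gt_zero_iff)
  then have "(n * k - h\<^sup>2) * ((fst v)\<^sup>2 + (snd v)\<^sup>2) > 0"
    using disc_pos by simp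
  then have "(n + k) * q v > 0" using q_lower_sq[of v] by linarith
  then show ?thesis using n_pos k_pos by (simp add: zero_less_mult_iff)
qed

lemma q_0 [simp]: "q 0 = 0"
  by (simp add: qv_def)

lemma q_lower: 
  obtains c where "c > 0" "\<And>v. v \<noteq> 0 \<Longrightarrow> real_of_int (q v) \<ge> c * (wt v)\<^sup>2"
proof
  let ?D = "real_of_int (n * k - h\<^sup>2)" and ?t = "real_of_int (n + k)"
  have D: "?D > 0" using disc_pos by linarith
  have t: "?t > 0" using n_pos k_pos by linarith
  \<comment> \<open>The estimates \<open>wt v \<le> 2 (x + y)\<close> and
    \<open>(x + y)^2 \<le> 2 (x^2 + y^2)\<close> together lose the factor 8; the rest is determinant
    over trace.\<close>
  show "?D / (8 * ?t) > 0" using D t by simp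
  fix v :: "int \<times> int" assume v: "v \<noteq> 0"
  define x y where "x = \<bar>real_of_int (fst v)\<bar>" and "y = \<bar>real_of_int (snd v)\<bar>"
  have nn: "x \<ge> 0" "y \<ge> 0" by (auto simp: x_def y_def)
  have "x + y \<ge> 1" using v by (cases v) (auto simp: zero_prod_def x_def y_def)
  then have "wt v \<le> 2 * (x + y)" by (simp add: wt_def x_def y_def)
  then have "(wt v)\<^sup>2 \<le> (2 * (x + y))\<^sup>2" using wt_ge_1[of v] by (intro power_mono) auto
  also have "\<dots> \<le> 8 * (x\<^sup>2 + y\<^sup>2)"
    using sum_squares_bound[of x y] by (simp add: power2_eq_square algebra_simps)
  finally have "?D * (wt v)\<^sup>2 \<le> ?D * (8 * (x\<^sup>2 + y\<^sup>2))" using D by (intro mult_left_mono) auto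
  also have "\<dots> = 8 * real_of_int ((n * k - h\<^sup>2) * ((fst v)\<^sup>2 + (snd v)\<^sup>2))"
    by (simp add: x_def y_def)
  also have "\<dots> \<le> 8 * real_of_int ((n + k) * q v)"
    using q_lower_sq[of v] by (intro mult_left_mono) (auto simp only: of_int_le_iff)
  finally show "?D / (8 * ?t) * (wt v)\<^sup>2 \<le> q v"
    using t by (simp add: field_simps)
qed

lemma qt_nonneg: "qt s v \<ge> 0" by (simp add: qt_def)

lemma qt_0 [simp]: "qt s 0 = 0" by (simp add: qt_def)

lemma qt_le_1: assumes "s \<ge> 0" shows "qt s v \<le> 1"
proof (cases "v = 0")
  case False
  then have "real_of_int (q v) \<ge> 1" using q_pos by fastforce
  then show ?thesis using assms by (auto simp: qt_def powr_le_one_le powr_minus ge_one_powr_ge_zero inverse_le_1_iff)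
qed auto

lemma qt_summable: assumes "s > 1" shows "qt s summable_on UNIV"
proof -
  obtain c where c: "c > 0" "\<And>v. v \<noteq> 0 \<Longrightarrow> real_of_int (q v) \<ge> c * (wt v)\<^sup>2"
    using q_lower by blast
  show ?thesis
  proof (rule summable_on_comparison_test)
    show "(\<lambda>v. c powr (-s) * wt v powr (- 2 * s)) summable_on UNIV"
      by (intro summable_on_cmult_right summable_on_wt assms)
    fix v :: "int \<times> int"
    show "qt s v \<le> c powr (-s) * wt v powr (- 2 * s)"
    proof (cases "v = 0")
      case False
      have "qt s v \<le> (c * (wt v)\<^sup>2) powr (-s)"
        unfolding qt_def using c False assms wt_ge_1[of v] 
        by (intro powr_mono2') (auto intro!: mult_pos_pos)
      also have "\<dots> = c powr (-s) * ((wt v)\<^sup>2) powr (-s)"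
        by (simp add: powr_mult)
      also have "((wt v)\<^sup>2) powr (-s) = wt v powr (- 2 * s)"
        using wt_ge_1[of v] by (simp flip: powr_numeral add: powr_powr)
      finally show ?thesis .
    qed auto
  qed (auto simp: qt_nonneg)
qed

text \<open>Shifting by a residue changes the form by \<open>O(wt u)\<close>, while both values are
  at least of order \<open>(wt u)^2\<close>. Then \<open>powr_diff_bound\<close> gives
  \<open>wt u / (wt u)^4\<close>, a decay that is summable over the plane.\<close>

lemma qt_shift_bound:
  fixes m :: int
  assumes m: "m > 0"
  obtains C where "\<And>s u r. 1 < s \<Longrightarrow> s \<le> 2 \<Longrightarrow> r \<in> {0..<m} \<times> {0..<m} \<Longrightarrow> 
    \<bar>qt s (m * fst u + fst r, m * snd u + snd r) - qt s (m * fst u, m * snd u)\<bar> \<le> C * wt u powr (-3)"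
proof -
  obtain c where c: "c > 0" "\<And>v. v \<noteq> 0 \<Longrightarrow> real_of_int (q v) \<ge> c * (wt v)\<^sup>2"
    using q_lower by blast
  \<comment> \<open>Each of the three monomials changes by at most \<open>3 m^2 wt u\<close>: two
    cross terms and one product of shifts. The factor \<open>2 m^2 + m^2\<close> records
    this.\<close>
  define B where "B = real_of_int (n * (2 * m\<^sup>2 + m\<^sup>2) + 2 * \<bar>h\<bar> * (2 * m\<^sup>2 + m\<^sup>2) + k * (2 * m\<^sup>2 + m\<^sup>2))"
  have B0: "B \<ge> 0" unfolding B_def using n_pos k_pos by (intro of_int_nonneg) auto
  \<comment> \<open>The 1 in the maximum serves \<open>u = 0\<close>, where the subtracted term is 0
    and the other one at most 1.\<close>
  define C where "C = max 1 (2 * B / c\<^sup>2)"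
  have C1: "C \<ge> 1" by (simp add: C_def)
  show ?thesis
  proof
    fix s :: real and u r :: "int \<times> int"
    assume s: "1 < s" "s \<le> 2" and r: "r \<in> {0..<m} \<times> {0..<m}"
    let ?a = "(m * fst u + fst r, m * snd u + snd r)" and ?b = "(m * fst u, m * snd u)"
    show "\<bar>qt s ?a - qt s ?b\<bar> \<le> C * wt u powr (-3)"
    proof (cases "u = 0")
      case True
      have b0: "?b = 0" using True by (simp add: zero_prod_def)
      have "\<bar>qt s ?a - qt s ?b\<bar> \<le> 1" unfolding b0 using qt_le_1[of s ?a] qt_nonneg[of s ?a] s by auto
      then show ?thesis using C1 True by (simp add: wt_def)
    next
      case False
      \<comment> \<open>A shift by \<open>t\<close> in the range from 0 to \<open>m - 1\<close>
        never brings \<open>m x + t\<close> closer to 0 than \<open>x\<close>, so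
        \<open>wt u\<close> is a lower bound for the weights of both points.\<close>
      have comp: "\<bar>x\<bar> \<le> \<bar>m * x + t\<bar>" if "0 \<le> t" "t < m" for x t :: int
      proof (cases "x \<ge> 0")
        case True
        then have "x \<le> m * x" using m by (simp add: mult_le_cancel_right1)
        then show ?thesis using True that by simp
      next
        case neg: False
        have "(m - 1) * (- x - 1) \<ge> 0" using m neg by (intro mult_nonneg_nonneg) auto
        then have "- (m * x + t) \<ge> - x" using that by (simp add: algebra_simps)
        then show ?thesis using neg by linarith
      qed
      have r': "0 \<le> fst r" "fst r < m" "0 \<le> snd r" "snd r < m" using r by (simp_all add: mem_Times_iff)
      have cf: "\<bar>fst u\<bar> \<le> \<bar>m * fst u + fst r\<bar>" "\<bar>snd u\<bar> \<le> \<bar>m * snd u + snd r\<bar>"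
          "\<bar>fst u\<bar> \<le> \<bar>m * fst u\<bar>" "\<bar>snd u\<bar> \<le> \<bar>m * snd u\<bar>"
        using comp[OF r'(1,2)] comp[OF r'(3,4)] comp[of 0] m by simp_all
      have u0: "fst u \<noteq> 0 \<or> snd u \<noteq> 0" using False by (simp add: prod_eq_iff)
      have a0: "?a \<noteq> 0"
      proof
        assume "?a = 0"
        then have "m * fst u + fst r = 0" "m * snd u + snd r = 0" by (simp_all add: prod_eq_iff)
        then show False using cf(1,2) u0 by simp
      qed
      have b0: "?b \<noteq> 0" using u0 m by (simp add: prod_eq_iff)
      have "real_of_int \<bar>fst u\<bar> \<le> real_of_int \<bar>m * fst u + fst r\<bar>" 
           "real_of_int \<bar>snd u\<bar> \<le> real_of_int \<bar>m * snd u + snd r\<bar>"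
           "real_of_int \<bar>fst u\<bar> \<le> real_of_int \<bar>m * fst u\<bar>"
           "real_of_int \<bar>snd u\<bar> \<le> real_of_int \<bar>m * snd u\<bar>"
        using cf by (simp_all only: of_int_le_iff)
      then have wab: "wt u \<le> wt ?a" "wt u \<le> wt ?b" by (auto simp: wt_def)
      have qab: "c * (wt u)\<^sup>2 \<le> q ?a" "c * (wt u)\<^sup>2 \<le> q ?b"
        using c(2)[OF a0] c(2)[OF b0] wab wt_ge_1[of u] c(1)
        by (smt (verit) mult_left_mono power_mono)+
      have "real_of_int (q ?a) \<ge> 1" "real_of_int (q ?b) \<ge> 1"
        using q_pos[OF a0] q_pos[OF b0] by (simp_all only: of_int_1_le_iff)
      then have 1: "\<bar>qt s ?a - qt s ?b\<bar> \<le> 2 * \<bar>q ?a - q ?b\<bar> / (c * (wt u)\<^sup>2)\<^sup>2"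
        unfolding qt_def using powr_diff_bound[of "q ?a" "q ?b" "c * (wt u)\<^sup>2" s] qab s c wt_ge_1[of u]
        by auto
      define X Y x y where "X = real_of_int (fst u)" and "Y = real_of_int (snd u)" 
        and "x = real_of_int (fst r)" and "y = real_of_int (snd r)"
      have bxy: "0 \<le> x" "x \<le> m" "0 \<le> y" "y \<le> m" using r by (auto simp: x_def y_def)
      have aX: "\<bar>X\<bar> \<le> wt u" "\<bar>Y\<bar> \<le> wt u" by (auto simp: X_def Y_def wt_def)
      have m2: "x * x \<le> m * m" "y * y \<le> m * m" "x * y \<le> m * m"
        using bxy m by (auto intro!: mult_mono)
      have mw: "real_of_int m * m \<le> m * m * wt u" using wt_ge_1[of u] m by (simp add: mult_le_cancel_left1)
      have p: "\<bar>Z * z\<bar> \<le> m * wt u" if "\<bar>Z\<bar> \<le> wt u" "0 \<le> z" "z \<le> m" for Z z :: real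
      proof -
        have "\<bar>Z\<bar> * z \<le> wt u * m" using that wt_ge_1[of u] by (intro mult_mono) auto
        then show ?thesis using that by (simp add: abs_mult mult.commute)
      qed
      define b where "b = m * m * wt u"
      have pm: "\<bar>real_of_int m * (Z * z)\<bar> \<le> b" if "\<bar>Z\<bar> \<le> wt u" "0 \<le> z" "z \<le> m" for Z z :: real
        using p[OF that] m by (simp add: abs_mult b_def mult.assoc) 
      have bb: "b \<ge> 0" using m wt_ge_1[of u] by (simp add: b_def)
      have prods: "0 \<le> x * x" "0 \<le> y * y" "0 \<le> x * y" "x * x \<le> b" "y * y \<le> b" "x * y \<le> b"
        using m2 mw bxy by (auto simp: b_def)
      have t1: "\<bar>2 * (m * (X * x)) + x * x\<bar> \<le> 3 * b"
        using pm[OF aX(1) bxy(1,2)] prods by linarith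
      have t2: "\<bar>m * (X * y) + m * (Y * x) + x * y\<bar> \<le> 3 * b"
        using pm[OF aX(1) bxy(3,4)] pm[OF aX(2) bxy(1,2)] prods by linarith
      have t3: "\<bar>2 * (m * (Y * y)) + y * y\<bar> \<le> 3 * b"
        using pm[OF aX(2) bxy(3,4)] prods by linarith
      have e: "\<bar>real_of_int z * A\<bar> \<le> \<bar>z\<bar> * (3 * b)" if "\<bar>A\<bar> \<le> 3 * b" for z :: int and A :: real
        unfolding abs_mult using that by (simp add: mult_left_mono)
      have "real_of_int (q ?a - q ?b) = n * (2 * (m * (X * x)) + x * x)
            + 2 * h * (m * (X * y) + m * (Y * x) + x * y) + k * (2 * (m * (Y * y)) + y * y)"
        by (simp add: qv_def X_def Y_def x_def y_def power2_eq_square algebra_simps)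
      also have "\<bar>\<dots>\<bar> \<le> n * (3 * b) + \<bar>2 * h\<bar> * (3 * b) + k * (3 * b)"
        using e[OF t1, of n] e[OF t2, of "2 * h"] e[OF t3, of k] n_pos k_pos by simp
      also have "\<dots> = B * wt u"
        by (simp add: B_def b_def power2_eq_square algebra_simps abs_mult)
      finally have "\<bar>real_of_int (q ?a - q ?b)\<bar> \<le> B * wt u" .
      then have "2 * \<bar>q ?a - q ?b\<bar> / (c * (wt u)\<^sup>2)\<^sup>2 \<le> 2 * (B * wt u) / (c * (wt u)\<^sup>2)\<^sup>2"
        by (intro divide_right_mono) auto
      also have "\<dots> = (2 * B / c\<^sup>2) * (1 / wt u ^ 3)"
        using wt_ge_1[of u] c(1) by (simp add: field_simps power2_eq_square power3_eq_cube)
      also have "\<dots> \<le> C * (1 / wt u ^ 3)" using wt_ge_1[of u] by (intro mult_right_mono) (auto simp: C_def)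
      also have "1 / wt u ^ 3 = wt u powr (-3)" using wt_ge_1[of u] by (simp add: powr_minus divide_inverse)
      finally show ?thesis using 1 by linarith
    qed
  qed
qed


abbreviation U :: "real \<Rightarrow> real" where "U s \<equiv> (\<Sum>\<^sub>\<infinity>v. qt s v)"

lemma complex_U:
  assumes "s > 1"
  shows "(\<Sum>\<^sub>\<infinity>v. complex_of_real (qt s v)) = of_real (U s)"
  by (intro infsumI has_sum_of_real has_sum_infsum qt_summable assms)

lemma weighted_abs_summable:
  fixes c :: "int \<times> int \<Rightarrow> complex"
  assumes "\<And>v. norm (c v) \<le> B" "s > 1"
  shows "(\<lambda>v. norm (c v * of_real (qt s v))) summable_on UNIV"
proof (rule summable_on_comparison_test)
  show "(\<lambda>v. B * qt s v) summable_on UNIV"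
    using assms by (intro summable_on_cmult_right qt_summable)
  show "norm (c v * of_real (qt s v)) \<le> B * qt s v" for v
    using assms(1)[of v] qt_nonneg[of s v] by (simp add: norm_mult mult_right_mono)
qed auto

lemma periodic_bounded:
  fixes c :: "int \<times> int \<Rightarrow> complex"
  assumes "m > 0" "\<And>x y. c (x, y) = c (x mod m, y mod m)"
  shows "norm (c v) \<le> (\<Sum>r\<in>{0..<m} \<times> {0..<m}. norm (c r))"
proof -
  have "norm (c v) = norm (c (fst v mod m, snd v mod m))" using assms(2)[of "fst v" "snd v"] by simp
  also have "\<dots> \<le> (\<Sum>r\<in>{0..<m} \<times> {0..<m}. norm (c r))"
    by (rule member_le_sum) (use assms(1) in auto)
  finally show ?thesis .
qed

\<comment> \<open>Write \<open>v = m u + r\<close>: since the weights sum to zero over \<open>r\<close>, one may subtract from each term its value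
  at \<open>m u\<close>, and the differences are of size \<open>O(1 / \<bar>u\<bar>^3)\<close>, uniformly in \<open>s\<close>.\<close>
lemma qsum_mean_zero:
  fixes c :: "int \<times> int \<Rightarrow> complex"
  assumes m: "m > 0" and per: "\<And>x y. c (x, y) = c (x mod m, y mod m)"
    and zero: "(\<Sum>r\<in>{0..<m} \<times> {0..<m}. c r) = 0"
  obtains C where "\<And>s. 1 < s \<Longrightarrow> s \<le> 2 \<Longrightarrow> norm (\<Sum>\<^sub>\<infinity>v. c v * of_real (qt s v)) \<le> C"
proof -
  define R where "R = {0..<m} \<times> {0..<m}"
  have finR: "finite R" by (simp add: R_def)
  define B where "B = (\<Sum>r\<in>R. norm (c r))"
  obtain K where K: "\<And>s u r. 1 < s \<Longrightarrow> s \<le> 2 \<Longrightarrow> r \<in> R \<Longrightarrow> 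
    \<bar>qt s (m * fst u + fst r, m * snd u + snd r) - qt s (m * fst u, m * snd u)\<bar> \<le> K * wt u powr (-3)"
    using qt_shift_bound[OF m] unfolding R_def by blast
  define W where "W = (\<Sum>\<^sub>\<infinity>u. B * K * wt u powr (-3))"
  have Wsum: "(\<lambda>u. B * K * wt u powr (-3)) summable_on UNIV"
    using summable_on_wt[of "3/2"] by (intro summable_on_cmult_right) simp
  define \<phi> where "\<phi> = (\<lambda>(u :: int \<times> int, r :: int \<times> int). (m * fst u + fst r, m * snd u + snd r))"
  have bij: "bij_betw \<phi> (UNIV \<times> R) UNIV"
  proof (rule bij_betwI[where g = "\<lambda>v. ((fst v div m, snd v div m), (fst v mod m, snd v mod m))"])
    show "(\<lambda>v. ((fst v div m, snd v div m), (fst v mod m, snd v mod m))) \<in> UNIV \<rightarrow> UNIV \<times> R"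
      using m by (auto simp: R_def)
  qed (use m in \<open>auto simp: \<phi>_def R_def div_pos_pos_trivial\<close>)
  show ?thesis
  proof (rule that)
    fix s :: real assume s: "1 < s" "s \<le> 2"
    let ?g = "\<lambda>v. c v * of_real (qt s v)"
    have "(\<lambda>v. norm (?g v)) summable_on UNIV"
      by (rule weighted_abs_summable[OF periodic_bounded[OF m per] s(1)])
    then have sm: "?g summable_on UNIV" by (rule abs_summable_summable)
    then have sm2: "(\<lambda>p. ?g (\<phi> p)) summable_on (UNIV \<times> R)"
      using summable_on_reindex_bij_betw[OF bij, of ?g] by simp
    have cr: "c (\<phi> (u, r)) = c r" if "r \<in> R" for u r
      using that per[of "m * fst u + fst r" "m * snd u + snd r"] by (auto simp: R_def \<phi>_def)
    have "(\<Sum>\<^sub>\<infinity>v. ?g v) = (\<Sum>\<^sub>\<infinity>p\<in>UNIV \<times> R. ?g (\<phi> p))"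
      by (rule infsum_reindex_bij_betw[OF bij, symmetric])
    also have "\<dots> = (\<Sum>\<^sub>\<infinity>u. \<Sum>\<^sub>\<infinity>r\<in>R. ?g (\<phi> (u, r)))"
      using sm2 by (subst infsum_Sigma'_banach) (auto simp: case_prod_unfold)
    also have "\<dots> = (\<Sum>\<^sub>\<infinity>u. \<Sum>r\<in>R. c r * of_real (qt s (\<phi> (u, r))))"
      using finR cr by (intro infsum_cong) (simp cong: sum.cong)
    also have "\<dots> = (\<Sum>\<^sub>\<infinity>u. \<Sum>r\<in>R. c r * of_real (qt s (\<phi> (u, r)) - qt s (m * fst u, m * snd u)))"
      (is "_ = infsum ?d UNIV")
    proof (rule infsum_cong)
      fix u :: "int \<times> int"
      have "(\<Sum>r\<in>R. c r * of_real (qt s (m * fst u, m * snd u))) = 0"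
        using zero by (simp add: R_def flip: sum_distrib_right)
      then show "(\<Sum>r\<in>R. c r * of_real (qt s (\<phi> (u, r)))) = ?d u"
        by (simp add: right_diff_distrib sum_subtractf)
    qed
    finally have eq: "(\<Sum>\<^sub>\<infinity>v. ?g v) = infsum ?d UNIV" .
    have dle: "norm (?d u) \<le> B * K * wt u powr (-3)" for u
    proof -
      have "norm (?d u) \<le> (\<Sum>r\<in>R. norm (c r) * (K * wt u powr (-3)))"
        using K[OF s] by (intro sum_norm_le) (simp add: norm_mult \<phi>_def case_prod_unfold mult_left_mono flip: of_real_diff)
      then show ?thesis by (simp add: B_def sum_distrib_right mult.assoc)
    qed
    have "(\<lambda>v. norm (?d v)) summable_on UNIV"
      by (rule summable_on_comparison_test[OF Wsum]) (use dle in auto)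
    then have "(?d has_sum infsum ?d UNIV) UNIV"
      by (intro has_sum_infsum) (rule abs_summable_summable)
    then have "norm (infsum ?d UNIV) \<le> W" unfolding W_def
      by (rule norm_infsum_le[OF _ has_sum_infsum[OF Wsum]]) (use dle in auto)
    then show "norm (\<Sum>\<^sub>\<infinity>v. ?g v) \<le> W" using eq by simp
  qed
qed

text \<open>Subtracting the average from the weights leaves weights of mean zero.\<close>

lemma qsum_mean:
  fixes c :: "int \<times> int \<Rightarrow> complex"
  assumes m: "m > 0" and per: "\<And>x y. c (x, y) = c (x mod m, y mod m)"
  obtains C where "\<And>s. 1 < s \<Longrightarrow> s \<le> 2 \<Longrightarrow>
    norm ((\<Sum>\<^sub>\<infinity>v. c v * of_real (qt s v)) - (\<Sum>r\<in>{0..<m} \<times> {0..<m}. c r) / of_int (m\<^sup>2) * of_real (U s)) \<le> C"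
proof -
  define \<mu> where "\<mu> = (\<Sum>r\<in>{0..<m} \<times> {0..<m}. c r) / of_int (m\<^sup>2)"
  define c' where "c' = (\<lambda>v. c v - \<mu>)"
  have "(\<Sum>r\<in>{0..<m} \<times> {0..<m}. c' r) = 0"
    using m by (simp add: sum_subtractf \<mu>_def c'_def power2_eq_square)
  moreover have "c' (x, y) = c' (x mod m, y mod m)" for x y using per[of x y] by (simp add: c'_def)
  ultimately obtain C where C: "\<And>s. 1 < s \<Longrightarrow> s \<le> 2 \<Longrightarrow> norm (\<Sum>\<^sub>\<infinity>v. c' v * of_real (qt s v)) \<le> C"
    using qsum_mean_zero[OF m, of c'] by blast
  show ?thesis
  proof (rule that)
    fix s :: real assume s: "1 < s" "s \<le> 2"
    have 1: "(\<lambda>v. c v * of_real (qt s v)) summable_on UNIV"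
      by (rule abs_summable_summable, rule weighted_abs_summable[OF periodic_bounded[OF m per] s(1)])
    have 2: "(\<lambda>v. complex_of_real (qt s v)) summable_on UNIV"
      by (intro summable_on_of_real qt_summable s)
    have "(\<Sum>\<^sub>\<infinity>v. c' v * of_real (qt s v)) = (\<Sum>\<^sub>\<infinity>v. c v * of_real (qt s v) + (- \<mu>) * of_real (qt s v))"
      by (simp add: c'_def left_diff_distrib)
    also have "\<dots> = (\<Sum>\<^sub>\<infinity>v. c v * of_real (qt s v)) + (\<Sum>\<^sub>\<infinity>v. (- \<mu>) * of_real (qt s v))"
      by (intro infsum_add 1 summable_on_cmult_right 2)
    also have "(\<Sum>\<^sub>\<infinity>v. (- \<mu>) * complex_of_real (qt s v)) = (- \<mu>) * of_real (U s)"
      by (simp only: infsum_cmult_right' complex_U[OF s(1)])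
    finally show "norm ((\<Sum>\<^sub>\<infinity>v. c v * of_real (qt s v)) - (\<Sum>r\<in>{0..<m} \<times> {0..<m}. c r) / of_int (m\<^sup>2) * of_real (U s)) \<le> C"
      using C[OF s] by (simp add: \<mu>_def)
  qed
qed

\<comment> \<open>The even vectors contribute exactly \<open>4 powr (-s) * U s\<close> and, by equidistribution, \<open>U s / 4 + O(1)\<close>.\<close>
lemma U_upper:
  obtains C where "C > 0" "\<And>s. 1 < s \<Longrightarrow> s \<le> 2 \<Longrightarrow> U s \<le> C / (s - 1)"
proof -
  define \<phi> :: "int \<times> int \<Rightarrow> int \<times> int" where "\<phi> = (\<lambda>v. (2 * fst v, 2 * snd v))"
  have inj: "inj \<phi>" by (auto simp: \<phi>_def inj_def prod_eq_iff)
  have rng: "v \<in> range \<phi> \<longleftrightarrow> even (fst v) \<and> even (snd v)" for v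
    by (auto simp: \<phi>_def image_iff elim!: evenE) (metis prod.collapse)
  define c :: "int \<times> int \<Rightarrow> complex" where "c = (\<lambda>v. 4 * of_bool (v \<in> range \<phi>) - 1)"
  have "c (x, y) = c (x mod 2, y mod 2)" for x y by (simp add: c_def rng)
  moreover have "{0..<2::int} = {0,1}" by auto
  then have "(\<Sum>r\<in>{0..<2} \<times> {0..<2}. c r) = 0"
    by (simp add: c_def rng sum.cartesian_product[symmetric])
  ultimately obtain C where C: "\<And>s. 1 < s \<Longrightarrow> s \<le> 2 \<Longrightarrow> norm (\<Sum>\<^sub>\<infinity>v. c v * of_real (qt s v)) \<le> C"
    using qsum_mean_zero[of 2 c] by auto
  show ?thesis
  proof (rule that)
    fix s :: real assume s: "1 < s" "s \<le> 2"
    let ?q = "\<lambda>v. complex_of_real (qt s v)"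
    have sq: "?q summable_on UNIV" by (intro summable_on_of_real qt_summable s)
    have seq: "(\<lambda>v. of_bool (v \<in> range \<phi>) * ?q v) summable_on UNIV"
      by (rule abs_summable_summable, rule weighted_abs_summable[of _ 1]) (use s in auto)
    have "q (\<phi> v) = 4 * q v" for v by (simp add: qv_def \<phi>_def power2_eq_square algebra_simps)
    then have qe: "qt s (\<phi> v) = 4 powr (-s) * qt s v" for v 
      by (simp add: qt_def powr_mult)
    have "(\<Sum>\<^sub>\<infinity>v. c v * ?q v) = (\<Sum>\<^sub>\<infinity>v. 4 * (of_bool (v \<in> range \<phi>) * ?q v) + (-1) * ?q v)"
      by (simp add: c_def left_diff_distrib mult.assoc)
    also have "\<dots> = (\<Sum>\<^sub>\<infinity>v. 4 * (of_bool (v \<in> range \<phi>) * ?q v)) + (\<Sum>\<^sub>\<infinity>v. (-1) * ?q v)"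
      by (intro infsum_add summable_on_cmult_right sq seq)
    also have "\<dots> = 4 * (\<Sum>\<^sub>\<infinity>v. ?q (\<phi> v)) - (\<Sum>\<^sub>\<infinity>v. ?q v)"
      by (simp only: infsum_cmult_right' infsum_sublattice[OF inj]) simp
    also have "(\<Sum>\<^sub>\<infinity>v. ?q (\<phi> v)) = of_real (4 powr (-s)) * (\<Sum>\<^sub>\<infinity>v. ?q v)"
      by (simp add: qe infsum_cmult_right')
    also have "(\<Sum>\<^sub>\<infinity>v. ?q v) = of_real (U s)"
      by (rule complex_U[OF s(1)])
    finally have "(\<Sum>\<^sub>\<infinity>v. c v * ?q v) = of_real (4 * 4 powr (-s) * U s - U s)" by simp
    then have "\<bar>4 * 4 powr (-s) * U s - U s\<bar> \<le> C" using C[OF s] by (simp only: norm_of_real)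
    then have "U s * (1 - 4 powr (1 - s)) \<le> C" by (simp add: powr_diff powr_minus field_simps)
    \<comment> \<open>The factor vanishes only to first order at \<open>s = 1\<close>, because
      \<open>ln 4 \<ge> 1\<close>; dividing by it costs exactly a simple pole.\<close>
    moreover have "1 - 4 powr (1 - s) \<ge> (s - 1) / 2"
    proof -
      have l4: "ln 4 \<ge> (1::real)" using ln_ge_iff[of 4 1] exp_le by auto
      then have "(4::real) powr (1 - s) \<le> exp (1 - s)" using s by (simp add: powr_def)
      also have "\<dots> = 1 / exp (s - 1)" by (simp add: exp_diff)
      also have "\<dots> \<le> 1 / s" using exp_ge_add_one_self[of "s - 1"] s by (intro divide_left_mono) auto
      finally have "1 - 4 powr (1 - s) \<ge> (s - 1) / s" using s by (simp add: field_simps)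
      moreover have "(s - 1) / s \<ge> (s - 1) / 2" using s by (intro divide_left_mono) auto
      ultimately show ?thesis by linarith
    qed
    moreover have "U s \<ge> 0" by (intro infsum_nonneg) (auto simp: qt_nonneg)
    ultimately have "U s * ((s - 1) / 2) \<le> C" by (meson mult_left_mono order_trans)
    then have "U s * (s - 1) \<le> 2 * \<bar>C\<bar> + 1" by (simp add: field_simps)
    then show "U s \<le> (2 * \<bar>C\<bar> + 1) / (s - 1)" using s by (simp add: field_simps)
  qed simp
qed


text \<open>Only the wedge \<open>0 \<le> y < x\<close> is kept. There the form is at most
  \<open>B x^2\<close>, and the \<open>x\<close> points of each column turn
  \<open>x powr (-2 * s)\<close> into \<open>x powr (1 - 2 * s)\<close>, whose sum is compared with
  an integral by telescoping.\<close>

lemma U_lower: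
  obtains c where "c > 0" "\<And>s. 1 < s \<Longrightarrow> s \<le> 2 \<Longrightarrow> c / (s - 1) \<le> U s"
proof
  define B where "B = real_of_int (n + 2 * \<bar>h\<bar> + k)"
  have B1: "B \<ge> 1" using n_pos k_pos by (simp add: B_def)
  show "B powr (-2) / 2 > 0" using B1 by simp
  fix s :: real assume s: "1 < s" "s \<le> 2"
  define \<phi> :: "nat \<times> nat \<Rightarrow> int \<times> int" where "\<phi> = (\<lambda>(i, j). (int (Suc i), int j))"
  have inj: "inj \<phi>" by (auto simp: \<phi>_def inj_def)
  have qle: "B powr (-s) * real (Suc i) powr (-2 * s) \<le> qt s (\<phi> (i, j))" if "j \<le> i" for i j
  proof -
    let ?x = "int (Suc i)" and ?y = "int j"
    have xy: "0 \<le> ?y" "?y \<le> ?x" using that by auto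
    have 1: "?y * ?y \<le> ?x * ?x" "?x * ?y \<le> ?x * ?x" using xy by (auto intro!: mult_mono)
    have "2 * h * ?x * ?y \<le> 2 * \<bar>h\<bar> * (?x * ?y)"
      using xy by (simp add: mult.assoc mult_right_mono)
    also have "\<dots> \<le> 2 * \<bar>h\<bar> * (?x * ?x)" using 1 by (intro mult_left_mono) auto
    finally have "q (\<phi> (i, j)) \<le> (n + 2 * \<bar>h\<bar> + k) * ?x\<^sup>2"
      using mult_left_mono[OF 1(1), of k] k_pos by (simp add: qv_def \<phi>_def power2_eq_square algebra_simps)
    then have "real_of_int (q (\<phi> (i, j))) \<le> real_of_int ((n + 2 * \<bar>h\<bar> + k) * ?x\<^sup>2)"
      by (simp only: of_int_le_iff)
    also have "\<dots> = B * (real (Suc i))\<^sup>2" by (simp add: B_def)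
    finally have "real_of_int (q (\<phi> (i, j))) \<le> B * (real (Suc i))\<^sup>2" .
    moreover have "\<phi> (i, j) \<noteq> 0" by (auto simp: \<phi>_def prod_eq_iff)
    then have "q (\<phi> (i, j)) > 0" using q_pos[of "\<phi> (i, j)"] by simp
    ultimately have "(B * (real (Suc i))\<^sup>2) powr (-s) \<le> qt s (\<phi> (i, j))"
      unfolding qt_def using s by (intro powr_mono2') auto
    moreover have "(B * (real (Suc i))\<^sup>2) powr (-s) = B powr (-s) * real (Suc i) powr (-2 * s)"
      by (simp add: powr_mult powr_powr flip: powr_numeral)
    ultimately show ?thesis by simp
  qed
  have part: "(\<Sum>i<N. B powr (-s) * real (Suc i) powr (1 - 2 * s)) \<le> U s" for N
  proof -
    have "(\<Sum>i<N. B powr (-s) * real (Suc i) powr (1 - 2 * s))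
        = (\<Sum>i<N. \<Sum>j\<le>i. B powr (-s) * real (Suc i) powr (-2 * s))"
      by (simp add: powr_diff powr_minus field_simps powr_add)
    also have "\<dots> \<le> (\<Sum>i<N. \<Sum>j\<le>i. qt s (\<phi> (i, j)))"
      using qle by (intro sum_mono) auto
    also have "\<dots> = (\<Sum>p\<in>Sigma {..<N} (\<lambda>i. {..i}). qt s (\<phi> p))"
      by (simp add: sum.Sigma)
    also have "\<dots> = (\<Sum>v\<in>\<phi> ` Sigma {..<N} (\<lambda>i. {..i}). qt s v)"
      using inj by (subst sum.reindex) (auto intro: inj_on_subset)
    also have "\<dots> \<le> U s"
      using qt_summable[OF s(1)] by (intro finite_sum_le_infsum) (auto simp: qt_nonneg)
    finally show ?thesis .
  qed
  have low: "(real (Suc i) powr (2 - 2 * s) - real (Suc (Suc i)) powr (2 - 2 * s)) / (2 * s - 2)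
      \<le> real (Suc i) powr (1 - 2 * s)" for i
  proof -
    have "\<exists>z>real (Suc i). z < real (Suc (Suc i)) \<and> 
      real (Suc (Suc i)) powr (2 - 2 * s) - real (Suc i) powr (2 - 2 * s) 
      = (real (Suc (Suc i)) - real (Suc i)) * ((2 - 2 * s) * z powr (1 - 2 * s))"
      by (intro MVT2) (auto intro!: derivative_eq_intros simp: field_simps)
    then obtain z where z: "z > real (Suc i)" "real (Suc (Suc i)) powr (2 - 2 * s) - real (Suc i) powr (2 - 2 * s) 
      = (2 - 2 * s) * z powr (1 - 2 * s)" by auto
    have "z powr (1 - 2 * s) \<le> real (Suc i) powr (1 - 2 * s)"
      using z s by (intro powr_mono2') auto
    moreover have "(real (Suc i) powr (2 - 2 * s) - real (Suc (Suc i)) powr (2 - 2 * s)) = z powr (1 - 2 * s) * (2 * s - 2)"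
      using z(2) by (simp add: algebra_simps)
    ultimately show ?thesis using s by (simp only: pos_divide_le_eq) (simp add: mult_right_mono)
  qed
  have "(1 - real (Suc N) powr (2 - 2 * s)) / (2 * s - 2) \<le> U s / B powr (-s)" for N
  proof -
    have "(1 - real (Suc N) powr (2 - 2 * s)) / (2 * s - 2)
        = (\<Sum>i<N. (real (Suc i) powr (2 - 2 * s) - real (Suc (Suc i)) powr (2 - 2 * s)) / (2 * s - 2))"
      unfolding sum_divide_distrib[symmetric] by (subst sum_lessThan_telescope') simp
    also have "\<dots> \<le> (\<Sum>i<N. real (Suc i) powr (1 - 2 * s))"
      by (intro sum_mono low)
    also have "\<dots> \<le> U s / B powr (-s)"
      using part[of N, folded sum_distrib_left] B1 by (simp add: pos_le_divide_eq mult.commute)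
    finally show ?thesis .
  qed
  moreover have "(\<lambda>N. (1 - real (Suc N) powr (2 - 2 * s)) / (2 * s - 2)) \<longlonglongrightarrow> (1 - 0) / (2 * s - 2)"
    using s by (intro tendsto_intros tendsto_neg_powr filterlim_compose[OF filterlim_real_sequentially filterlim_Suc]) auto
  ultimately have "1 / (2 * s - 2) \<le> U s / B powr (-s)"
    by (intro LIMSEQ_le_const2) auto
  then have "B powr (-s) * (1 / (2 * s - 2)) \<le> U s" using B1 by (simp add: field_simps)
  moreover have "B powr (-2) * (1 / (2 * s - 2)) \<le> B powr (-s) * (1 / (2 * s - 2))"
    using B1 s by (intro mult_right_mono powr_mono) auto
  moreover have "B powr (-2) * (1 / (2 * s - 2)) = B powr (-2) / 2 / (s - 1)"
    using s by (simp add: field_simps)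
  ultimately show "B powr (-2) / 2 / (s - 1) \<le> U s" by linarith
qed

end

text \<open>The first-order vanishing at \<open>s = 1\<close> is what absorbs the pole of
  \<open>U\<close> in \<open>U_compare\<close>.\<close>

lemma powr_sub_bound:
  fixes a s :: real
  assumes "a \<ge> 1" "1 < s" "s \<le> 2"
  shows "\<bar>a powr s - a\<bar> \<le> a\<^sup>2 * ln a * (s - 1)"
proof -
  have "\<exists>z>1. z < s \<and> a powr s - a powr 1 = (s - 1) * (a powr z * ln a)"
    using assms by (intro MVT2) (auto intro!: derivative_eq_intros)
  then obtain z where z: "z > 1" "z < s" "a powr s - a = (s - 1) * (a powr z * ln a)"
    using assms by auto
  have "a powr z \<le> a powr 2" using z assms by (intro powr_mono) auto
  then have "a powr z * ln a \<le> a\<^sup>2 * ln a" using assms by (intro mult_right_mono) auto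
  then show ?thesis using z assms by (simp add: abs_mult mult.commute mult_left_mono)
qed

\<comment> \<open>Here \<open>n0 * q1 (x, y) = q2 (n0 * x, y)\<close>: up to scaling, the first form is the second one on a sublattice of index \<open>n0\<close>.\<close>
lemma U_compare:
  fixes n h k n0 :: int
  assumes "pos_form (n * n0) h k" "pos_form n h (k * n0)" "n0 > 0"
  obtains C where "\<And>s. 1 < s \<Longrightarrow> s \<le> 2 \<Longrightarrow>
    \<bar>(\<Sum>\<^sub>\<infinity>v. pos_form.qt (n * n0) h k s v) - (\<Sum>\<^sub>\<infinity>v. pos_form.qt n h (k * n0) s v)\<bar> \<le> C"
proof -
  interpret A: pos_form "n * n0" h k by fact
  interpret B: pos_form n h "k * n0" by fact
  define \<phi> :: "int \<times> int \<Rightarrow> int \<times> int" where "\<phi> = (\<lambda>v. (n0 * fst v, snd v))"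
  have inj: "inj \<phi>" using assms(3) by (auto simp: \<phi>_def inj_def prod_eq_iff)
  have rng: "v \<in> range \<phi> \<longleftrightarrow> n0 dvd fst v" for v
    by (auto simp: \<phi>_def image_iff elim!: dvdE) (metis prod.collapse)
  define c :: "int \<times> int \<Rightarrow> complex" where "c = (\<lambda>v. of_bool (v \<in> range \<phi>))"
  have "c (x, y) = c (x mod n0, y mod n0)" for x y by (simp add: c_def rng dvd_mod_iff)
  then obtain C where C: "\<And>s. 1 < s \<Longrightarrow> s \<le> 2 \<Longrightarrow>
    norm ((\<Sum>\<^sub>\<infinity>v. c v * of_real (B.qt s v)) - (\<Sum>r\<in>{0..<n0} \<times> {0..<n0}. c r) / of_int (n0\<^sup>2) * of_real (B.U s)) \<le> C"
    using B.qsum_mean[OF assms(3), of c] by blast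
  have "(\<Sum>r\<in>{0..<n0} \<times> {0..<n0}. c r) = (\<Sum>r\<in>{0} \<times> {0..<n0}. c r)"
    using assms(3) by (intro sum.mono_neutral_right) (auto simp: c_def rng dest: zdvd_imp_le)
  also have "\<dots> = (\<Sum>r\<in>{0::int} \<times> {0..<n0}. 1)" by (intro sum.cong) (auto simp: c_def rng)
  also have "\<dots> = of_int n0" using assms(3) by (simp add: card_cartesian_product)
  finally have mean: "(\<Sum>r\<in>{0..<n0} \<times> {0..<n0}. c r) / of_int (n0\<^sup>2) = 1 / of_int n0"
    by (simp add: power2_eq_square)
  obtain K where K: "K > 0" "\<And>s. 1 < s \<Longrightarrow> s \<le> 2 \<Longrightarrow> B.U s \<le> K / (s - 1)"
    using B.U_upper by blast
  define a where "a = real_of_int n0"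
  have a1: "a \<ge> 1" using assms(3) by (simp add: a_def)
  show ?thesis
  proof (rule that)
    fix s :: real assume s: "1 < s" "s \<le> 2"
    have "n0 * qv (n * n0) h k v = qv n h (k * n0) (\<phi> v)" for v
      by (simp add: qv_def \<phi>_def power2_eq_square algebra_simps)
    then have "a * real_of_int (qv (n * n0) h k v) = real_of_int (qv n h (k * n0) (\<phi> v))" for v
      unfolding a_def by (metis of_int_mult)
    then have qe: "B.qt s (\<phi> v) = a powr (-s) * A.qt s v" for v
      unfolding A.qt_def B.qt_def by (metis powr_mult)
    have "(\<Sum>\<^sub>\<infinity>v. c v * complex_of_real (B.qt s v)) = (\<Sum>\<^sub>\<infinity>v. complex_of_real (B.qt s (\<phi> v)))"
      unfolding c_def by (rule infsum_sublattice[OF inj])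
    also have "\<dots> = of_real (a powr (-s) * A.U s)"
      by (simp add: qe infsum_cmult_right' A.complex_U s)
    finally have "norm (complex_of_real (a powr (-s) * A.U s - B.U s / a)) \<le> C"
      using C[OF s] unfolding mean by (simp add: a_def)
    then have 1: "\<bar>a powr (-s) * A.U s - B.U s / a\<bar> \<le> C" by (simp only: norm_of_real)
    have "\<bar>A.U s - a powr s / a * B.U s\<bar> = a powr s * \<bar>a powr (-s) * A.U s - B.U s / a\<bar>"
      using a1 by (simp add: abs_mult[symmetric] powr_minus field_simps)
    also have "\<dots> \<le> a powr 2 * C" using a1 s 1
      by (intro mult_mono powr_mono) auto
    finally have 2: "\<bar>A.U s - a powr s / a * B.U s\<bar> \<le> a\<^sup>2 * C" using a1 by simp
    have U0: "B.U s \<ge> 0" by (intro infsum_nonneg) (auto simp: B.qt_nonneg)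
    have "a powr s / a * B.U s - B.U s = (a powr s - a) / a * B.U s"
      using a1 by (simp add: field_simps)
    then have "\<bar>a powr s / a * B.U s - B.U s\<bar> = \<bar>a powr s - a\<bar> / a * B.U s"
      using a1 U0 by (simp add: abs_mult abs_divide)
    also have "\<dots> \<le> a\<^sup>2 * ln a * (s - 1) / 1 * (K / (s - 1))"
      using powr_sub_bound[OF a1 s] K(2)[OF s] a1 U0 s
      by (intro mult_mono frac_le) auto
    also have "\<dots> = a\<^sup>2 * ln a * K" using s by simp
    finally show "\<bar>A.U s - B.U s\<bar> \<le> a\<^sup>2 * C + a\<^sup>2 * ln a * K" using 2 by linarith
  qed
qed

section \<open>Euler products\<close>

lemma ln_norm_bound:
  fixes z :: complex
  assumes "norm z \<le> 1/2"
  shows "\<bar>ln (norm (1 + z)) - Re z\<bar> \<le> 2 * (norm z)\<^sup>2"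
proof -
  have z1: "1 + z \<noteq> 0"
  proof
    assume "1 + z = 0"
    then have "z = -1" by (simp add: add_eq_0_iff)
    then show False using assms by simp
  qed
  have "\<bar>ln (norm (1 + z)) - Re z\<bar> = \<bar>Re (Ln (1 + z) - z)\<bar>"
    using z1 by simp
  also have "\<dots> \<le> norm (Ln (1 + z) - z)" by (rule abs_Re_le_cmod)
  also have "\<dots> \<le> (norm z)\<^sup>2 / (1 - norm z)"
    using assms by (intro Ln_approx_linear) auto
  also have "\<dots> \<le> (norm z)\<^sup>2 / (1 / 2)"
    using assms by (intro divide_left_mono) auto
  finally show ?thesis by simp
qed

text \<open>Multiplicativity is demanded for coprime arguments only, since the class series counts
  square roots modulo \<open>n\<close> and is not completely multiplicative. Vanishing at powers of
  2 and 3, together with the bound 2 at prime powers, confines every Euler factor to a disc around 1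
  that avoids 0.\<close>

locale mult_dirichlet =
  fixes f :: "nat \<Rightarrow> complex"
  assumes f_0: "f 0 = 0" and f_1: "f 1 = 1"
    and f_mult: "\<And>a b. coprime a b \<Longrightarrow> f (a * b) = f a * f b"
    and f_bound: "\<And>p e. prime p \<Longrightarrow> norm (f (p ^ e)) \<le> 2"
    and f_small: "\<And>p e. prime p \<Longrightarrow> p < 5 \<Longrightarrow> e > 0 \<Longrightarrow> f (p ^ e) = 0"
    and f_summable: "\<And>s. s > 1 \<Longrightarrow> (\<lambda>n. norm (f n) * real n powr (-s)) summable_on UNIV"
begin

definition g :: "real \<Rightarrow> nat \<Rightarrow> complex" where "g s n = f n * of_real (real n powr (-s))"

definition L :: "real \<Rightarrow> complex" where "L s = (\<Sum>\<^sub>\<infinity>n. g s n)"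

definition P :: "real \<Rightarrow> real" where "P s = (\<Sum>\<^sub>\<infinity>p\<in>{p. prime p}. Re (f p) * real p powr (-s))"

definition smooth :: "nat set \<Rightarrow> nat set" where
  "smooth A = {n. n > 0 \<and> (\<forall>p. prime p \<longrightarrow> p dvd n \<longrightarrow> p \<in> A)}"

lemma g_mult: "coprime a b \<Longrightarrow> g s (a * b) = g s a * g s b"
  by (simp add: g_def f_mult powr_mult)

lemma g_0: "g s 0 = 0" by (simp add: g_def f_0)

lemma g_1: "g s 1 = 1" using f_1 by (simp add: g_def)

lemma g_norm_summable: "s > 1 \<Longrightarrow> (\<lambda>n. norm (g s n)) summable_on A"
  using summable_on_subset[OF f_summable, of s A] by (simp add: g_def norm_mult)

lemma g_summable: "s > 1 \<Longrightarrow> g s summable_on A"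
  by (rule abs_summable_summable) (rule g_norm_summable)

lemma smooth_insert:
  assumes "prime p" "p \<notin> A"
  shows "bij_betw (\<lambda>(e, n). p ^ e * n) (UNIV \<times> smooth A) (smooth (insert p A))"
proof (rule bij_betw_imageI)
  have ndvd: "\<not> p dvd n" if "n \<in> smooth A" for n
    using that assms by (auto simp: smooth_def)
  have mult: "multiplicity p (p ^ e * n) = e" if "n \<in> smooth A" for e n
    using ndvd[OF that] assms(1) by (simp add: multiplicity_prime_elem_times_other multiplicity_eqI)
  show "inj_on (\<lambda>(e, n). p ^ e * n) (UNIV \<times> smooth A)"
  proof (rule inj_onI, clarify)
    fix e n e' n' assume n: "n \<in> smooth A" "n' \<in> smooth A" and eq: "p ^ e * n = p ^ e' * n'"
    then have "e = e'" using mult by metis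
    then show "e = e' \<and> n = n'" using eq assms(1) prime_gt_0_nat[of p] by auto
  qed
  show "(\<lambda>(e, n). p ^ e * n) ` (UNIV \<times> smooth A) = smooth (insert p A)"
  proof (intro equalityI subsetI)
    fix x assume "x \<in> (\<lambda>(e, n). p ^ e * n) ` (UNIV \<times> smooth A)"
    then obtain e n where x: "x = p ^ e * n" "n \<in> smooth A" by auto
    show "x \<in> smooth (insert p A)"
      using x assms(1) prime_gt_0_nat[of p]
      by (auto simp: smooth_def prime_dvd_mult_iff) (meson prime_dvd_power primes_dvd_imp_eq)
  next
    fix x assume x: "x \<in> smooth (insert p A)"
    then have "x \<noteq> 0" by (auto simp: smooth_def)
    then obtain n where n: "x = p ^ multiplicity p x * n" "\<not> p dvd n"
      using multiplicity_decompose'[of x p] assms(1) by (metis not_prime_unit)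
    have "n \<in> smooth A"
    proof -
      have "n > 0" using n by (auto intro: Nat.gr0I)
      moreover have "q \<in> A" if "prime q" "q dvd n" for q
      proof -
        have "q dvd x" using that n(1) by (metis dvd_mult)
        then have "q \<in> insert p A" using x that by (auto simp: smooth_def)
        then show ?thesis using that n(2) by auto
      qed
      ultimately show ?thesis by (auto simp: smooth_def)
    qed
    then show "x \<in> (\<lambda>(e, n). p ^ e * n) ` (UNIV \<times> smooth A)" using n(1) by force
  qed
qed

definition E :: "real \<Rightarrow> nat \<Rightarrow> complex" where "E s p = (\<Sum>\<^sub>\<infinity>e. g s (p ^ e))"

lemma finite_euler_product:
  assumes "s > 1" "finite A" "\<And>p. p \<in> A \<Longrightarrow> prime p"
  shows "(\<Prod>p\<in>A. E s p) = (\<Sum>\<^sub>\<infinity>n\<in>smooth A. g s n)"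
  using assms(2,3)
proof (induction A rule: finite_induct)
  case empty
  have "smooth {} = {1}"
  proof -
    have "n = 1" if "n > 0" "\<forall>p. prime p \<longrightarrow> \<not> p dvd n" for n :: nat
      using that prime_factor_nat[of n] by auto
    then show ?thesis by (auto simp: smooth_def)
  qed
  then show ?case using g_1 by simp
next
  case (insert p A)
  then have p: "prime p" by simp
  have cop: "coprime (p ^ e) n" if "n \<in> smooth A" for e n
    using that insert.hyps p by (auto simp: smooth_def intro: prime_imp_coprime)
  note bij = smooth_insert[OF p insert.hyps(2)]
  have sm: "(\<lambda>x. g s (case x of (e, n) \<Rightarrow> p ^ e * n)) summable_on UNIV \<times> smooth A"
    using summable_on_reindex_bij_betw[OF bij, of "g s"] g_summable[OF assms(1)] by simp
  have "(\<Sum>\<^sub>\<infinity>n\<in>smooth (insert p A). g s n) = (\<Sum>\<^sub>\<infinity>x\<in>UNIV \<times> smooth A. g s (case x of (e, n) \<Rightarrow> p ^ e * n))"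
    by (rule infsum_reindex_bij_betw[OF bij, symmetric])
  also have "\<dots> = (\<Sum>\<^sub>\<infinity>e. \<Sum>\<^sub>\<infinity>n\<in>smooth A. g s (p ^ e * n))"
    using sm by (subst infsum_Sigma'_banach) (auto simp: case_prod_unfold)
  also have "\<dots> = (\<Sum>\<^sub>\<infinity>e. \<Sum>\<^sub>\<infinity>n\<in>smooth A. g s (p ^ e) * g s n)"
    using cop by (intro infsum_cong) (simp add: g_mult)
  also have "\<dots> = E s p * (\<Sum>\<^sub>\<infinity>n\<in>smooth A. g s n)"
    by (simp add: infsum_cmult_right' infsum_cmult_left' E_def)
  finally show ?case using insert by simp
qed

text \<open>For \<open>p \<ge> 5\<close> and \<open>t = 1 / p\<close> the linear term is at most
  \<open>2 t\<close> and the tail at most \<open>5/2 t^2 \<le> t / 2\<close>, so the factor is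
  \<open>1 + z\<close> with \<open>|z| \<le> 5/2 t \<le> 1/2\<close>. The constant is
  \<open>15 = 2 (5/2)^2 + 5/2\<close>, logarithm error plus tail. For \<open>p < 5\<close> the
  factor is 1.\<close>

lemma euler_factor:
  assumes s: "1 < s" "s \<le> 2" and p: "prime p"
  shows "E s p \<noteq> 0" "\<bar>ln (norm (E s p)) - Re (f p) * real p powr (-s)\<bar> \<le> 15 / (real p)\<^sup>2"
proof -
  have inj: "inj (\<lambda>e. p ^ e)" using prime_gt_1_nat[OF p] by (auto simp: inj_def)
  have sumE: "(\<lambda>e. g s (p ^ e)) summable_on UNIV"
    using summable_on_reindex[OF inj, of "g s"] g_summable[OF s(1)] by (simp add: o_def)
  define x where "x = real p powr (-s)"
  have "E s p \<noteq> 0 \<and> \<bar>ln (norm (E s p)) - Re (f p) * x\<bar> \<le> 15 / (real p)\<^sup>2"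
  proof (cases "p < 5")
    case True
    have "(\<lambda>e. g s (p ^ e)) = (\<lambda>e. if e = 0 then 1 else 0)"
      using f_small[OF p True] g_1[of s] by (auto simp: g_def fun_eq_iff)
    moreover have "(\<Sum>\<^sub>\<infinity>e::nat. if e = 0 then 1 else 0 :: complex) = (\<Sum>\<^sub>\<infinity>e\<in>{0::nat}. 1)"
      by (rule infsum_cong_neutral) auto
    ultimately have "E s p = 1" by (simp add: E_def)
    moreover have "f p = 0" using f_small[OF p True, of 1] by simp
    ultimately show ?thesis by simp
  next
    case False
    define t where "t = 1 / real p"
    have t: "0 < t" "t \<le> 1/5" using False by (auto simp: t_def field_simps)
    have x: "0 \<le> x" "x \<le> t"
    proof -
      have "x \<le> real p powr (-1)" unfolding x_def using s False by (intro powr_mono) auto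
      then show "x \<le> t" using False by (simp add: t_def powr_minus divide_inverse)
    qed (simp add: x_def)
    have gp: "norm (g s (p ^ e)) \<le> 2 * t ^ e" for e
    proof -
      have "real (p ^ e) powr (-s) = x ^ e"
        using False by (simp add: x_def powr_realpow[symmetric] powr_powr mult.commute)
      moreover have "x ^ e \<le> t ^ e" using x by (intro power_mono) auto
      moreover have "norm (g s (p ^ e)) = norm (f (p ^ e)) * real (p ^ e) powr (-s)"
        unfolding g_def norm_mult norm_of_real by simp
      ultimately show ?thesis using f_bound[OF p, of e] x t
        by (simp only:) (intro mult_mono, auto)
    qed
    have sE: "(\<lambda>e. g s (p ^ e)) sums E s p"
      unfolding E_def using sumE by (intro has_sum_imp_sums has_sum_infsum)
    have "(\<lambda>e. g s (p ^ (e + 2))) sums (E s p - (\<Sum>i<2. g s (p ^ i)))"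
      by (rule sums_split_initial_segment[OF sE])
    moreover have "(\<Sum>i<2. g s (p ^ i)) = 1 + f p * x"
      using g_1[of s] by (simp add: numeral_2_eq_2 g_def x_def)
    ultimately have rs: "(\<lambda>e. g s (p ^ (e + 2))) sums (E s p - (1 + f p * x))" by simp
    define r where "r = E s p - (1 + f p * x)"
    have ts: "(\<lambda>e. 2 * t\<^sup>2 * t ^ e) sums (2 * t\<^sup>2 * (1 / (1 - t)))"
      using t by (intro sums_mult geometric_sums) auto
    have "norm r \<le> 2 * t\<^sup>2 * (1 / (1 - t))"
    proof -
      have "norm (g s (p ^ (e + 2))) \<le> 2 * t\<^sup>2 * t ^ e" for e
        using gp[of "e + 2"] by (simp add: power_add power2_eq_square mult_ac)
      then have "norm (suminf (\<lambda>e. g s (p ^ (e + 2)))) \<le> suminf (\<lambda>e. 2 * t\<^sup>2 * t ^ e)"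
        using ts by (intro norm_suminf_le) (auto simp: sums_iff)
      then show ?thesis using rs ts by (simp add: sums_iff r_def)
    qed
    also have "\<dots> \<le> 2 * t\<^sup>2 * (5 / 4)"
      using t by (intro mult_left_mono) (auto simp: field_simps)
    finally have r: "norm r \<le> 5 / 2 * t\<^sup>2" by simp
    define z where "z = f p * x + r"
    have "norm (f p * x) \<le> 2 * t"
      using f_bound[OF p, of 1] x by (simp add: norm_mult mult_mono)
    then have "norm z \<le> 2 * t + 5 / 2 * t\<^sup>2"
      using r norm_triangle_ineq[of "f p * x" r] unfolding z_def by linarith
    also have "5 / 2 * t\<^sup>2 \<le> t / 2"
      using t mult_left_mono[of t "1/5" t] by (simp add: power2_eq_square)
    finally have z: "norm z \<le> 5 / 2 * t" by simp
    have Ez: "E s p = 1 + z" by (simp add: z_def r_def)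
    have zh: "norm z \<le> 1 / 2" using z t by simp
    have "E s p \<noteq> 0"
    proof
      assume "E s p = 0"
      then have "z = -1" using Ez by (simp add: add_eq_0_iff)
      then show False using zh by simp
    qed
    moreover have "\<bar>ln (norm (E s p)) - Re (f p) * x\<bar> \<le> 15 * t\<^sup>2"
    proof -
      have "\<bar>ln (norm (E s p)) - Re z\<bar> \<le> 2 * (norm z)\<^sup>2"
        unfolding Ez by (rule ln_norm_bound[OF zh])
      also have "\<dots> \<le> 2 * (5 / 2 * t)\<^sup>2" using z by (intro mult_left_mono power_mono) auto
      finally have "\<bar>ln (norm (E s p)) - Re z\<bar> \<le> 25 / 2 * t\<^sup>2" by (simp add: power2_eq_square)
      moreover have "Re z = Re (f p) * x + Re r" by (simp add: z_def)
      moreover have "\<bar>Re r\<bar> \<le> 5 / 2 * t\<^sup>2" using r abs_Re_le_cmod[of r] by linarith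
      ultimately show ?thesis by linarith
    qed
    ultimately show ?thesis by (simp add: t_def power_divide)
  qed
  then show "E s p \<noteq> 0" "\<bar>ln (norm (E s p)) - Re (f p) * real p powr (-s)\<bar> \<le> 15 / (real p)\<^sup>2"
    by (auto simp: x_def)
qed

text \<open>A finite set carries almost all of the absolute series. Once \<open>A\<close> contains
  every prime dividing one of its positive elements, the complement of \<open>smooth A\<close>
  contributes only a tail. The number 0 is never in \<open>smooth A\<close>, but its term
  vanishes.\<close>

lemma smooth_tendsto:
  assumes "s > 1"
  shows "((\<lambda>A. \<Sum>\<^sub>\<infinity>n\<in>smooth A. g s n) \<longlongrightarrow> L s) (finite_subsets_at_top {p. prime p})"
proof (rule tendstoI)
  fix e :: real assume e: "e > 0"
  have ns: "(\<lambda>n. norm (g s n)) summable_on A" for A by (rule g_norm_summable) fact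
  obtain F where F: "finite F" "dist (sum (\<lambda>n. norm (g s n)) F) (\<Sum>\<^sub>\<infinity>n. norm (g s n)) \<le> e / 2"
    using infsum_finite_approximation[OF ns, of "e/2" UNIV] e by auto
  define A0 where "A0 = {p. prime p \<and> (\<exists>n\<in>F. n > 0 \<and> p dvd n)}"
  have "A0 \<subseteq> (\<Union>n\<in>F - {0}. {p. p dvd n})" by (auto simp: A0_def)
  moreover have "finite (\<Union>n\<in>F - {0}. {p. p dvd n})" using F(1) by auto
  ultimately have "finite A0" by (rule finite_subset)
  moreover have "A0 \<subseteq> {p. prime p}" by (auto simp: A0_def)
  moreover have "dist (\<Sum>\<^sub>\<infinity>n\<in>smooth A. g s n) (L s) < e" if A: "A0 \<subseteq> A" for A
  proof -
    have FA: "F - {0} \<subseteq> smooth A" using A by (auto simp: A0_def smooth_def)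
    have "L s = (\<Sum>\<^sub>\<infinity>n\<in>smooth A. g s n) + (\<Sum>\<^sub>\<infinity>n\<in>- smooth A. g s n)"
      using infsum_Un_disjoint[OF g_summable[OF assms] g_summable[OF assms], of "smooth A" "- smooth A"]
      by (simp add: L_def)
    then have "dist (\<Sum>\<^sub>\<infinity>n\<in>smooth A. g s n) (L s) = norm (\<Sum>\<^sub>\<infinity>n\<in>- smooth A. g s n)"
      by (simp add: dist_norm norm_minus_commute)
    also have "\<dots> \<le> (\<Sum>\<^sub>\<infinity>n\<in>- smooth A. norm (g s n))"
      by (rule norm_infsum_bound) (rule ns)
    also have "\<dots> \<le> (\<Sum>\<^sub>\<infinity>n\<in>- F. norm (g s n))"
      by (rule infsum_mono_neutral[OF ns ns]) (use FA g_0 in auto)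
    also have "\<dots> = (\<Sum>\<^sub>\<infinity>n. norm (g s n)) - sum (\<lambda>n. norm (g s n)) F"
      using infsum_Un_disjoint[OF ns ns, of F "- F"] F(1) by simp
    also have "\<dots> \<le> e / 2" using F(2) by (simp add: dist_real_def abs_if split: if_splits)
    finally show ?thesis using e by simp
  qed
  ultimately show "\<forall>\<^sub>F A in finite_subsets_at_top {p. prime p}. dist (\<Sum>\<^sub>\<infinity>n\<in>smooth A. g s n) (L s) < e"
    unfolding eventually_finite_subsets_at_top by blast
qed

lemma P_summable:
  assumes "s > 1"
  shows "(\<lambda>p. Re (f p) * real p powr (-s)) summable_on {p. prime p}"
proof -
  have "(\<lambda>p. norm (Re (f p) * real p powr (-s))) summable_on {p. prime p}"
    by (rule summable_on_comparison_test[OF summable_on_subset[OF f_summable[OF assms]]])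
       (auto simp: abs_mult abs_Re_le_cmod mult_right_mono)
  then show ?thesis by (rule abs_summable_summable)
qed

text \<open>Depends on neither the coefficients nor \<open>s\<close>, so one constant serves all the
  series compared later.\<close>

definition K :: real where "K = (\<Sum>\<^sub>\<infinity>p\<in>{p. prime p}. 15 / (real p)\<^sup>2)"

lemma sum_K:
  assumes "finite A" "A \<subseteq> {p. prime p}"
  shows "(\<Sum>p\<in>A. 15 / (real p)\<^sup>2) \<le> K"
proof -
  have "summable (\<lambda>n. real n powr (-2))" by (subst summable_real_powr_iff) auto
  then have "(\<lambda>n. real n powr (-2)) summable_on UNIV" by (intro norm_summable_imp_summable_on) simp
  then have "(\<lambda>n. 15 * real n powr (-2)) summable_on {p. prime p}"
    by (intro summable_on_cmult_right) (rule summable_on_subset, auto)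
  moreover have "15 * real n powr (-2) = 15 / (real n)\<^sup>2" for n
    by (cases "n = 0") (auto simp: powr_minus divide_inverse)
  ultimately show ?thesis unfolding K_def using assms
    by (intro finite_sum_le_infsum) auto
qed

lemma finite_euler_bound:
  assumes s: "1 < s" "s \<le> 2" and A: "finite A" "A \<subseteq> {p. prime p}"
  shows "\<bar>ln (norm (\<Prod>p\<in>A. E s p)) - (\<Sum>p\<in>A. Re (f p) * real p powr (-s))\<bar> \<le> K" 
    "norm (\<Prod>p\<in>A. E s p) > 0"
proof -
  have "(\<Prod>p\<in>A. E s p) \<noteq> 0" using A euler_factor(1)[OF s] by (auto simp: prod_zero_iff)
  then show "norm (\<Prod>p\<in>A. E s p) > 0" by simp
  have "ln (norm (\<Prod>p\<in>A. E s p)) = (\<Sum>p\<in>A. ln (norm (E s p)))"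
    unfolding prod_norm[symmetric] using A euler_factor(1)[OF s] by (intro ln_prod) auto
  then have "\<bar>ln (norm (\<Prod>p\<in>A. E s p)) - (\<Sum>p\<in>A. Re (f p) * real p powr (-s))\<bar> 
      = \<bar>\<Sum>p\<in>A. ln (norm (E s p)) - Re (f p) * real p powr (-s)\<bar>"
    by (simp add: sum_subtractf)
  also have "\<dots> \<le> (\<Sum>p\<in>A. \<bar>ln (norm (E s p)) - Re (f p) * real p powr (-s)\<bar>)" by (rule sum_abs)
  also have "\<dots> \<le> (\<Sum>p\<in>A. 15 / (real p)\<^sup>2)" using A euler_factor(2)[OF s] by (intro sum_mono) auto
  also have "\<dots> \<le> K" by (rule sum_K[OF A])
  finally show "\<bar>ln (norm (\<Prod>p\<in>A. E s p)) - (\<Sum>p\<in>A. Re (f p) * real p powr (-s))\<bar> \<le> K" .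
qed

text \<open>Stated with exponentials because \<open>L s \<noteq> 0\<close> is not known beforehand;
  it follows from the second inequality. The bounds hold for finite Euler products and pass to the
  limit.\<close>

theorem euler_bound:
  assumes s: "1 < s" "s \<le> 2"
  shows "norm (L s) \<le> exp (P s + K)" "exp (P s - K) \<le> norm (L s)"
proof -
  let ?F = "finite_subsets_at_top {p::nat. prime p}" and ?S = "\<lambda>A. \<Sum>p\<in>A. Re (f p) * real p powr (-s)"
  have ev: "\<forall>\<^sub>F A in ?F. finite A \<and> A \<subseteq> {p. prime p}"
    by (rule eventually_finite_subsets_at_top_weakI) auto
  have lim1: "((\<lambda>A. norm (\<Sum>\<^sub>\<infinity>n\<in>smooth A. g s n)) \<longlongrightarrow> norm (L s)) ?F"
    by (intro tendsto_norm smooth_tendsto s)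
  have "(?S \<longlongrightarrow> P s) ?F"
    using has_sum_infsum[OF P_summable[OF s(1)]] unfolding has_sum_def P_def .
  then have lim2: "((\<lambda>A. exp (?S A + c)) \<longlongrightarrow> exp (P s + c)) ?F" for c
    by (intro tendsto_intros)
  have bnds: "norm (\<Sum>\<^sub>\<infinity>n\<in>smooth A. g s n) \<le> exp (?S A + K) \<and> exp (?S A - K) \<le> norm (\<Sum>\<^sub>\<infinity>n\<in>smooth A. g s n)"
    if A: "finite A \<and> A \<subseteq> {p. prime p}" for A
  proof -
    have eq: "(\<Prod>p\<in>A. E s p) = (\<Sum>\<^sub>\<infinity>n\<in>smooth A. g s n)"
      using A by (intro finite_euler_product s) auto
    have A': "finite A" "A \<subseteq> {p. prime p}" using A by auto
    define N where "N = norm (\<Sum>\<^sub>\<infinity>n\<in>smooth A. g s n)"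
    have N: "N > 0" "\<bar>ln N - ?S A\<bar> \<le> K"
      using finite_euler_bound[OF s A'] unfolding eq N_def by auto
    have "ln N \<le> ?S A + K" "?S A - K \<le> ln N" using N(2) by linarith+
    then have "exp (ln N) \<le> exp (?S A + K)" "exp (?S A - K) \<le> exp (ln N)"
      by (simp_all only: exp_le_cancel_iff)
    then have "N \<le> exp (?S A + K) \<and> exp (?S A - K) \<le> N" by (simp only: exp_ln[OF N(1)] simp_thms)
    then show ?thesis unfolding N_def .
  qed
  show "norm (L s) \<le> exp (P s + K)"
    by (rule tendsto_le[OF _ lim2[of K] lim1]) (use bnds in \<open>auto intro!: eventually_mono[OF ev]\<close>)
  show "exp (P s - K) \<le> norm (L s)"
    using tendsto_le[OF _ lim1 lim2[of "- K"]] bnds by (auto intro!: eventually_mono[OF ev])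
qed

end

section \<open>Characters of abelian groups\<close>

lemma (in comm_group) mult_mult_swap:
  assumes "a \<in> carrier G" "b \<in> carrier G" "c \<in> carrier G" "d \<in> carrier G"
  shows "(a \<otimes> b) \<otimes> (c \<otimes> d) = (a \<otimes> c) \<otimes> (b \<otimes> d)"
  using assms by (simp add: m_ac)

text \<open>Modulo \<open>K\<close> the group is cyclic of order \<open>m\<close> with generator
  \<open>g\<close>, so \<open>g [^] i \<otimes> k\<close> can be sent to the \<open>i\<close>-th
  power of a primitive \<open>m\<close>-th root of unity: \<open>g [^] i\<close> lies in
  \<open>K\<close> only if \<open>m\<close> divides \<open>i\<close>.\<close>

lemma (in comm_group) character_extension:
  assumes K: "subgroup K G" and g: "g \<in> carrier G" and m: "m > 0" "g [^] (m::nat) \<in> K"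
    and least: "\<And>i::nat. 0 < i \<Longrightarrow> i < m \<Longrightarrow> g [^] i \<notin> K" 
    and gen: "\<And>x. x \<in> carrier G \<Longrightarrow> \<exists>i::nat. \<exists>k\<in>K. x = g [^] i \<otimes> k"
  obtains ch :: "'a \<Rightarrow> complex" where "\<And>x y. x \<in> carrier G \<Longrightarrow> y \<in> carrier G \<Longrightarrow> ch (x \<otimes> y) = ch x * ch y"
    "\<And>x. x \<in> carrier G \<Longrightarrow> norm (ch x) = 1" "\<And>x. x \<in> K \<Longrightarrow> ch x = 1" "ch g = cis (2 * pi / m)"
proof -
  have Kc: "K \<subseteq> carrier G" using K by (rule subgroup.subset)
  define z where "z = cis (2 * pi / m)"
  have "z ^ m = cis (real m * (2 * pi / real m))" unfolding z_def by (rule Complex.DeMoivre)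
  then have zm: "z ^ m = 1" using m(1) by simp
  have pow_mod: "z ^ i = z ^ (i mod m)" for i
    by (metis mod_mult_div_eq power_add power_mult zm power_one mult.right_neutral)
  have gm: "g [^] (m * i) \<in> K" for i :: nat
    using m(2) g subgroup.m_closed[OF K] subgroup.one_closed[OF K]
    by (induction i) (auto simp: nat_pow_mult[symmetric] nat_pow_pow[symmetric])
  have dvd: "m dvd i" if "g [^] i \<in> K" for i :: nat
  proof (rule ccontr)
    assume "\<not> m dvd i"
    then have r: "0 < i mod m" "i mod m < m" using m(1) by (auto simp: mod_greater_zero_iff_not_dvd)
    have "g [^] i = g [^] (m * (i div m)) \<otimes> g [^] (i mod m)" using g by (simp add: nat_pow_mult)
    then have "inv (g [^] (m * (i div m))) \<otimes> g [^] i = g [^] (i mod m)"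
      using g by (metis inv_solve_left' nat_pow_closed)
    then have "g [^] (i mod m) \<in> K" using that gm subgroup.m_closed[OF K] subgroup.m_inv_closed[OF K] by metis
    then show False using least[OF r] by simp
  qed
  have wd: "z ^ i = z ^ j" if "k \<in> K" "l \<in> K" "g [^] i \<otimes> k = g [^] j \<otimes> l" for i j :: nat and k l
  proof -
    have *: "z ^ i = z ^ j" if "k \<in> K" "l \<in> K" "g [^] i \<otimes> k = g [^] j \<otimes> l" "i \<le> j" for i j :: nat and k l
    proof -
      have c: "k \<in> carrier G" "l \<in> carrier G" using that Kc by auto
      have "g [^] i \<otimes> k = g [^] i \<otimes> (g [^] (j - i) \<otimes> l)"
        using that(3,4) g c by (simp add: nat_pow_mult m_assoc[symmetric])
      then have "k = g [^] (j - i) \<otimes> l" using g c by simp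
      then have "g [^] (j - i) = k \<otimes> inv l" using g c by (metis inv_solve_right nat_pow_closed)
      then have "g [^] (j - i) \<in> K" using that subgroup.m_closed[OF K] subgroup.m_inv_closed[OF K] by metis
      then have "m dvd j - i" by (rule dvd)
      then have "z ^ (j - i) = 1" by (metis dvdE power_mult zm power_one)
      then show ?thesis using that(4) by (metis le_add_diff_inverse mult.right_neutral power_add)
    qed
    show ?thesis
    proof (cases "i \<le> j")
      case True
      with that show ?thesis by (rule *)
    next
      case False
      then have "z ^ j = z ^ i" using that by (intro *[of l k]) auto
      then show ?thesis ..
    qed
  qed
  \<comment> \<open>Any exponent in such a representation will do; by \<open>wd\<close> all of them
    give the same power.\<close>
  define ch where "ch x = z ^ (SOME i. \<exists>k\<in>K. x = g [^] i \<otimes> k)" for x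
  have ch_pow: "ch (g [^] i \<otimes> k) = z ^ i" if "k \<in> K" for i k
  proof -
    define Q where "Q j \<longleftrightarrow> (\<exists>k'\<in>K. g [^] i \<otimes> k = g [^] (j::nat) \<otimes> k')" for j
    have "Q i" unfolding Q_def using that by blast
    then have "Q (Eps Q)" by (rule someI)
    then obtain k' where k': "k' \<in> K" "g [^] i \<otimes> k = g [^] Eps Q \<otimes> k'" unfolding Q_def by blast
    have "ch (g [^] i \<otimes> k) = z ^ Eps Q" unfolding ch_def Q_def ..
    also have "\<dots> = z ^ i" using wd[OF that k'] by simp
    finally show ?thesis .
  qed
  show ?thesis
  proof (rule that[of ch])
    fix x y assume xy: "x \<in> carrier G" "y \<in> carrier G"
    obtain i k where x: "x = g [^] (i::nat) \<otimes> k" "k \<in> K" using gen[OF xy(1)] by blast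
    obtain j l where y: "y = g [^] (j::nat) \<otimes> l" "l \<in> K" using gen[OF xy(2)] by blast
    have "x \<otimes> y = g [^] (i + j) \<otimes> (k \<otimes> l)"
      unfolding x(1) y(1) nat_pow_mult[OF g, symmetric] using g x(2) y(2) Kc by (intro mult_mult_swap) auto
    then show "ch (x \<otimes> y) = ch x * ch y"
      using ch_pow x y subgroup.m_closed[OF K] by (simp add: power_add)
  next
    fix x assume "x \<in> carrier G"
    then show "norm (ch x) = 1" by (simp add: ch_def z_def norm_power)
  next
    fix x assume x: "x \<in> K"
    then have "ch (g [^] (0::nat) \<otimes> x) = z ^ 0" by (rule ch_pow)
    then show "ch x = 1" using x Kc by auto
  next
    have "ch (g [^] (1::nat) \<otimes> \<one>) = z ^ 1" by (rule ch_pow) (rule subgroup.one_closed[OF K])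
    then show "ch g = cis (2 * pi / m)" using g by (simp add: z_def)
  qed
qed

text \<open>In the application the group of lattices is infinite, but \<open>H\<close> has finite
  index, witnessed by \<open>S\<close>. A maximal proper subgroup \<open>K\<close> above
  \<open>H\<close> has a cyclic quotient generated by any element outside \<open>K\<close>, and
  \<open>character_extension\<close> applies without forming a quotient group.\<close>

lemma (in comm_group) exists_nontrivial_character:
  assumes H: "subgroup H G" "H \<noteq> carrier G"
    and S: "finite S" "S \<subseteq> carrier G" "\<And>x. x \<in> carrier G \<Longrightarrow> \<exists>s\<in>S. \<exists>y\<in>H. x = y \<otimes> s"
  obtains ch :: "'a \<Rightarrow> complex" and g where "\<And>x y. x \<in> carrier G \<Longrightarrow> y \<in> carrier G \<Longrightarrow> ch (x \<otimes> y) = ch x * ch y"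
    "\<And>x. x \<in> carrier G \<Longrightarrow> norm (ch x) = 1" "\<And>x. x \<in> H \<Longrightarrow> ch x = 1" "g \<in> carrier G" "ch g \<noteq> 1"
proof -
  define P where "P K \<longleftrightarrow> subgroup K G \<and> H \<subseteq> K \<and> K \<noteq> carrier G" for K
  \<comment> \<open>The number of points of \<open>S\<close> measures the subgroups above
    \<open>H\<close>: it is bounded, and it grows strictly with the subgroup, so a maximum yields a
    maximal proper subgroup.\<close>
  define X where "X = (\<lambda>K. card (K \<inter> S)) ` {K. P K}"
  have PH: "P H" using H by (simp add: P_def)
  have "X \<subseteq> {0..card S}" unfolding X_def using S(1) by (auto intro: card_mono)
  then have finX: "finite X" by (rule finite_subset) simp
  moreover have "X \<noteq> {}" using PH by (auto simp: X_def)
  ultimately have "Max X \<in> X" by (rule Max_in)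
  then obtain K where K: "P K" "Max X = card (K \<inter> S)" unfolding X_def by auto
  have sub: "subgroup K G" and HK: "H \<subseteq> K" and Kc: "K \<subseteq> carrier G" "K \<noteq> carrier G"
    using K(1) by (auto simp: P_def dest: subgroup.subset)
  note clo = subgroup.m_closed[OF sub] subgroup.one_closed[OF sub] subgroup.m_inv_closed[OF sub]
  have maximal: "K' = carrier G" if K': "subgroup K' G" "K \<subset> K'" for K'
  proof (rule ccontr)
    assume ne: "K' \<noteq> carrier G"
    have "P K'" using K' HK ne by (auto simp: P_def)
    then have le: "card (K' \<inter> S) \<le> card (K \<inter> S)" unfolding K(2)[symmetric] using finX by (intro Max_ge) (auto simp: X_def)
    obtain x where x: "x \<in> K'" "x \<notin> K" using K'(2) by blast
    have xc: "x \<in> carrier G" using x K'(1) subgroup.subset by blast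
    obtain s y where sy: "s \<in> S" "y \<in> H" "x = y \<otimes> s" using S(3)[OF xc] by blast
    have yK: "y \<in> K" and sc: "s \<in> carrier G" and yc: "y \<in> carrier G" using sy HK S(2) Kc by auto
    have "s = inv y \<otimes> x" using sy(3) sc yc xc by (metis inv_solve_left')
    then have "s \<in> K'" using x(1) yK K' subgroup.m_closed[OF K'(1)] subgroup.m_inv_closed[OF K'(1)] by blast
    moreover have "s \<notin> K" using x(2) sy(3) yK clo(1) by blast
    ultimately have "K \<inter> S \<subset> K' \<inter> S" using K'(2) sy(1) by blast
    then have "card (K \<inter> S) < card (K' \<inter> S)" using S(1) by (intro psubset_card_mono) auto
    then show False using le by simp
  qed
  obtain g where g: "g \<in> carrier G" "g \<notin> K" using Kc by blast
  have "\<exists>m::nat. m > 0 \<and> g [^] m \<in> K"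
  proof -
    \<comment> \<open>Pigeonhole: two powers of \<open>g\<close> share a representative in
      \<open>S\<close>, so their quotient lies in \<open>K\<close>.\<close>
    define f where "f i = (SOME s. s \<in> S \<and> (\<exists>y\<in>H. g [^] (i::nat) = y \<otimes> s))" for i
    have f: "f i \<in> S \<and> (\<exists>y\<in>H. g [^] i = y \<otimes> f i)" for i
      unfolding f_def by (rule someI_ex) (use S(3)[of "g [^] i"] g(1) in auto)
    have "f ` UNIV \<subseteq> S" using f by auto
    then have "finite (range f)" using S(1) by (rule finite_subset)
    then have "\<not> inj f" using finite_imageD[of f UNIV] by auto
    then obtain i j where ij: "f i = f j" "i < j" unfolding inj_def by (metis linorder_neqE_nat)
    obtain y y' where y: "y \<in> H" "g [^] i = y \<otimes> f i" "y' \<in> H" "g [^] j = y' \<otimes> f i"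
      using f[of i] f[of j] ij(1) by auto
    have c: "y \<in> carrier G" "y' \<in> carrier G" "f i \<in> carrier G" using y HK Kc f S(2) by auto
    have "g [^] j = g [^] (j - i) \<otimes> g [^] i" using ij(2) g(1) by (simp add: nat_pow_mult)
    then have "y' \<otimes> f i = g [^] (j - i) \<otimes> (y \<otimes> f i)" using y by simp
    then have "y' \<otimes> f i = (g [^] (j - i) \<otimes> y) \<otimes> f i" using c g(1) by (simp add: m_assoc)
    then have "y' = g [^] (j - i) \<otimes> y" using c g(1) by simp
    then have "g [^] (j - i) = y' \<otimes> inv y" using c g(1) by (metis inv_solve_right nat_pow_closed)
    moreover have yK: "y \<in> K" "y' \<in> K" using y HK by auto
    ultimately have "g [^] (j - i) \<in> K" using clo(1)[OF yK(2) clo(3)[OF yK(1)]] by simp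
    then show ?thesis using ij(2) by (intro exI[of _ "j - i"]) auto
  qed
  then obtain m :: nat where m: "m > 0" "g [^] m \<in> K" "\<And>i::nat. i < m \<Longrightarrow> \<not> (i > 0 \<and> g [^] i \<in> K)"
    using exists_least_iff[of "\<lambda>m::nat. m > 0 \<and> g [^] m \<in> K"] by blast
  define K' where "K' = {g [^] i \<otimes> k | i k. (i::nat) \<in> UNIV \<and> k \<in> K}"
  have K'I: "g [^] (i::nat) \<otimes> k \<in> K'" if "k \<in> K" for i k using that unfolding K'_def by blast
  have "subgroup K' G"
  proof (rule subgroupI)
    show "K' \<subseteq> carrier G" using g(1) Kc by (auto simp: K'_def)
    show "K' \<noteq> {}" using K'I[OF clo(2)] by blast
  next
    fix a assume "a \<in> K'"
    then obtain i k where a: "a = g [^] (i::nat) \<otimes> k" "k \<in> K" unfolding K'_def by blast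
    have kc: "k \<in> carrier G" using a Kc by blast
    have mi: "g [^] (m * i) \<in> K" for i :: nat
      using m(2) g clo by (induction i) (auto simp: nat_pow_mult[symmetric] nat_pow_pow[symmetric])
    \<comment> \<open>Elements of \<open>K'\<close> use nonnegative powers of \<open>g\<close>.
      Since \<open>g [^] (m * i)\<close> lies in \<open>K\<close>, the inverse of
      \<open>g [^] i\<close> can be expressed with the exponent \<open>m * i - i\<close>.\<close>
    define k' where "k' = inv (g [^] (m * i)) \<otimes> inv k"
    have k': "k' \<in> K" unfolding k'_def using mi a(2) clo by blast
    have "i \<le> m * i" using m(1) by simp
    then have s: "g [^] (m * i) = g [^] (m * i - i) \<otimes> g [^] i" using g(1) by (simp add: nat_pow_mult)
    have "(g [^] (m * i - i) \<otimes> k') \<otimes> a = (g [^] (m * i - i) \<otimes> g [^] i) \<otimes> (k' \<otimes> k)"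
      unfolding a(1) using g(1) kc k' Kc by (intro mult_mult_swap) auto
    also have "\<dots> = g [^] (m * i) \<otimes> (inv (g [^] (m * i)) \<otimes> (inv k \<otimes> k))"
      unfolding s[symmetric] k'_def using g(1) kc by (subst m_assoc) auto
    also have "\<dots> = \<one>" using g(1) kc by simp
    finally have "inv a = g [^] (m * i - i) \<otimes> k'"
      using a g(1) kc k' Kc by (intro inv_equality) auto
    then show "inv a \<in> K'" using K'I[OF k'] by simp
  next
    fix a b assume "a \<in> K'" "b \<in> K'"
    then obtain i k j l where ab: "a = g [^] (i::nat) \<otimes> k" "k \<in> K" "b = g [^] (j::nat) \<otimes> l" "l \<in> K" unfolding K'_def by blast
    have "a \<otimes> b = g [^] (i + j) \<otimes> (k \<otimes> l)"
      unfolding ab(1,3) nat_pow_mult[OF g(1), symmetric] using g ab Kc by (intro mult_mult_swap) auto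
    then show "a \<otimes> b \<in> K'" using K'I clo(1) ab by simp
  qed
  moreover have "K \<subset> K'"
  proof
    show "K \<subseteq> K'"
    proof
      fix x assume "x \<in> K"
      then show "x \<in> K'" using K'I[of x 0] Kc by auto
    qed
    have "g \<in> K'" using K'I[OF clo(2), of 1] g(1) by simp
    then show "K \<noteq> K'" using g(2) by blast
  qed
  ultimately have full: "K' = carrier G" by (rule maximal)
  have gen: "\<exists>i::nat. \<exists>k\<in>K. x = g [^] i \<otimes> k" if "x \<in> carrier G" for x
    using that unfolding full[symmetric] K'_def by blast
  have least: "g [^] i \<notin> K" if "0 < i" "i < m" for i :: nat using m(3) that by blast
  obtain ch :: "'a \<Rightarrow> complex" where chi: "\<And>x y. x \<in> carrier G \<Longrightarrow> y \<in> carrier G \<Longrightarrow> ch (x \<otimes> y) = ch x * ch y"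
    "\<And>x. x \<in> carrier G \<Longrightarrow> norm (ch x) = 1" "\<And>x. x \<in> K \<Longrightarrow> ch x = 1" "ch g = cis (2 * pi / m)"
    using character_extension[OF sub g(1) m(1,2) least gen] by blast
  have "m \<noteq> 1"
  proof
    assume "m = 1"
    then show False using m(2) g by simp
  qed
  then have m2: "m \<ge> 2" using m(1) by simp
  have "cis (2 * pi / m) \<noteq> 1"
  proof
    assume "cis (2 * pi / m) = 1"
    then have "cos (2 * pi / m) = 1" by (simp add: complex_eq_iff)
    then obtain i :: int where "2 * pi / m = of_int i * 2 * pi" using cos_one_2pi_int by auto
    then have "(2 * pi) * (1 / real m) = (2 * pi) * of_int i" by (simp add: mult_ac)
    then have "1 / real m = of_int i" using mult_left_cancel[of "2 * pi" "1 / real m" "of_int i"] pi_gt_zero by simp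
    moreover have "0 < 1 / real m" "1 / real m < 1" using m2 by auto
    ultimately have "0 < i" "i < 1" by auto
    then show False by simp
  qed
  then show ?thesis using that[OF chi(1,2) _ g(1)] chi(3,4) HK by auto
qed

section \<open>Products of lattices\<close>

text \<open>As a module over the integers, the complex numbers have as spans exactly the additive
  subgroups generated by sets.\<close>

interpretation zmod: Modules.module "\<lambda>(r::int) (x::complex). of_int r * x"
  by standard (auto simp: algebra_simps)

\<comment> \<open>As a rewrite rule, scale_scale loops with of_int_mult.\<close>
declare zmod.scale_scale [simp del]

text \<open>The product of fractional ideals; the span is taken because the set of products is not
  closed under addition.\<close>

definition lprod :: "complex set \<Rightarrow> complex set \<Rightarrow> complex set" where
  "lprod A B = zmod.span {a * b | a b. a \<in> A \<and> b \<in> B}"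

definition smul :: "complex \<Rightarrow> complex set \<Rightarrow> complex set" where
  "smul \<alpha> A = (\<lambda>x. \<alpha> * x) ` A"

definition lat :: "complex \<Rightarrow> complex \<Rightarrow> complex set" where
  "lat a b = {of_int x * a + of_int y * b | x y :: int. True}"

lemma lat_eq_span: "lat a b = zmod.span {a, b}"
proof
  show "lat a b \<subseteq> zmod.span {a, b}"
  proof
    fix z assume "z \<in> lat a b"
    then obtain x y :: int where z: "z = of_int x * a + of_int y * b" unfolding lat_def by blast
    show "z \<in> zmod.span {a, b}"
      unfolding z by (rule zmod.span_add; rule zmod.span_scale; rule zmod.span_base) auto
  qed
  show "zmod.span {a, b} \<subseteq> lat a b"
  proof (rule zmod.span_minimal)
    have "a = of_int 1 * a + of_int 0 * b" "b = of_int 0 * a + of_int 1 * b" by simp_all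
    then show "{a, b} \<subseteq> lat a b" unfolding lat_def by blast
    show "zmod.subspace (lat a b)"
    proof (rule zmod.subspaceI)
      have "0 = of_int 0 * a + of_int 0 * b" by simp
      then show "0 \<in> lat a b" unfolding lat_def by blast
    next
      fix x y assume "x \<in> lat a b" "y \<in> lat a b"
      then obtain i j i' j' where "x = of_int i * a + of_int j * b" "y = of_int i' * a + of_int j' * b"
        unfolding lat_def by blast
      then have "x + y = of_int (i + i') * a + of_int (j + j') * b" by (simp add: algebra_simps)
      then show "x + y \<in> lat a b" unfolding lat_def by blast
    next
      fix c :: int and x assume "x \<in> lat a b"
      then obtain i j where "x = of_int i * a + of_int j * b" unfolding lat_def by blast
      then have "of_int c * x = of_int (c * i) * a + of_int (c * j) * b" by (simp add: algebra_simps)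
      then show "of_int c * x \<in> lat a b" unfolding lat_def by blast
    qed
  qed
qed

lemma lprod_commute: "lprod A B = lprod B A"
proof -
  have "{a * b | a b. a \<in> A \<and> b \<in> B} = {a * b | a b. a \<in> B \<and> b \<in> A}"
    by (intro Collect_cong) (metis mult.commute)
  then show ?thesis by (simp add: lprod_def)
qed

lemma lprod_mono: "A \<subseteq> A' \<Longrightarrow> B \<subseteq> B' \<Longrightarrow> lprod A B \<subseteq> lprod A' B'"
  unfolding lprod_def by (intro zmod.span_mono) blast

text \<open>Multiplication by a fixed \<open>b\<close> is additive, so generators suffice.\<close>

lemma lprod_span: "lprod (zmod.span A) B = lprod A B"
proof
  show "lprod A B \<subseteq> lprod (zmod.span A) B"
    by (intro lprod_mono zmod.span_superset order_refl)
  have "x * b \<in> lprod A B" if "x \<in> zmod.span A" "b \<in> B" for x b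
    using that(1)
  proof (induction rule: zmod.span_induct_alt)
    case base
    then show ?case by (simp add: lprod_def zmod.span_zero)
  next
    case (step c x y)
    have "x * b \<in> lprod A B" using step that(2) unfolding lprod_def by (intro zmod.span_base) blast
    then have "of_int c * (x * b) + y * b \<in> lprod A B"
      using step unfolding lprod_def by (intro zmod.span_add zmod.span_scale)
    then show ?case by (simp add: algebra_simps)
  qed
  then show "lprod (zmod.span A) B \<subseteq> lprod A B"
    unfolding lprod_def[of "zmod.span A"] by (intro zmod.span_minimal) (auto simp: lprod_def zmod.subspace_span)
qed

text \<open>Both sides are spanned by the triple products. Commutativity brings the inner product to
  the left, where \<open>lprod_span\<close> applies.\<close>

lemma lprod_assoc: "lprod (lprod A B) C = lprod A (lprod B C)"
proof -
  have "lprod (lprod A B) C = lprod {a * b | a b. a \<in> A \<and> b \<in> B} C"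
    unfolding lprod_def[of A B] by (rule lprod_span)
  also have "\<dots> = zmod.span {a * b * c | a b c. a \<in> A \<and> b \<in> B \<and> c \<in> C}"
    unfolding lprod_def by (rule arg_cong[where f = zmod.span]) blast
  also have "\<dots> = zmod.span {b * c * a | a b c. a \<in> A \<and> b \<in> B \<and> c \<in> C}"
    by (rule arg_cong[where f = zmod.span], rule Collect_cong) (metis mult.assoc mult.commute)
  also have "\<dots> = lprod {a * b | a b. a \<in> B \<and> b \<in> C} A"
    unfolding lprod_def by (rule arg_cong[where f = zmod.span]) blast
  also have "\<dots> = lprod (lprod B C) A"
    unfolding lprod_def[of B C] by (rule lprod_span[symmetric])
  finally show ?thesis by (simp add: lprod_commute)
qed

lemma smul_span: "smul \<alpha> (zmod.span A) = zmod.span (smul \<alpha> A)"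
proof
  have sub: "zmod.subspace (smul \<alpha> (zmod.span A))"
  proof (rule zmod.subspaceI)
    show "0 \<in> smul \<alpha> (zmod.span A)" using zmod.span_zero[of A] by (force simp: smul_def)
  next
    fix x y assume "x \<in> smul \<alpha> (zmod.span A)" "y \<in> smul \<alpha> (zmod.span A)"
    then obtain u v where "x = \<alpha> * u" "y = \<alpha> * v" "u \<in> zmod.span A" "v \<in> zmod.span A" by (auto simp: smul_def)
    then show "x + y \<in> smul \<alpha> (zmod.span A)" 
      using zmod.span_add[of u A v] by (auto simp: smul_def distrib_left[symmetric])
  next
    fix c :: int and x assume "x \<in> smul \<alpha> (zmod.span A)"
    then obtain u where "x = \<alpha> * u" "u \<in> zmod.span A" by (auto simp: smul_def)
    then show "of_int c * x \<in> smul \<alpha> (zmod.span A)"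
      using zmod.span_scale[of u A c] by (auto simp: smul_def mult.left_commute)
  qed
  show "zmod.span (smul \<alpha> A) \<subseteq> smul \<alpha> (zmod.span A)"
    by (rule zmod.span_minimal[OF _ sub]) (auto simp: smul_def intro: zmod.span_base)
  have "\<alpha> * x \<in> zmod.span (smul \<alpha> A)" if "x \<in> zmod.span A" for x
    using that
  proof (induction rule: zmod.span_induct_alt)
    case base
    then show ?case by (simp add: zmod.span_zero)
  next
    case (step c x y)
    have "\<alpha> * x \<in> zmod.span (smul \<alpha> A)" using step by (intro zmod.span_base) (auto simp: smul_def)
    then have "of_int c * (\<alpha> * x) + \<alpha> * y \<in> zmod.span (smul \<alpha> A)"
      using step by (intro zmod.span_add zmod.span_scale)
    then show ?case by (simp add: algebra_simps)
  qed
  then show "smul \<alpha> (zmod.span A) \<subseteq> zmod.span (smul \<alpha> A)" by (auto simp: smul_def)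
qed

lemma lprod_smul: "lprod (smul \<alpha> A) B = smul \<alpha> (lprod A B)"
proof -
  have "smul \<alpha> {a * b | a b. a \<in> A \<and> b \<in> B} = {a * b | a b. a \<in> smul \<alpha> A \<and> b \<in> B}"
    by (auto simp: smul_def image_iff) (metis mult.assoc)+
  then show ?thesis by (simp add: lprod_def smul_span)
qed

lemma lprod_smul_right: "lprod A (smul \<alpha> B) = smul \<alpha> (lprod A B)"
  using lprod_smul[of \<alpha> B A] by (simp add: lprod_commute)

lemma smul_smul [simp]: "smul \<alpha> (smul \<beta> A) = smul (\<alpha> * \<beta>) A"
  by (auto simp: smul_def image_image mult.assoc)

lemma smul_1 [simp]: "smul 1 A = A" by (simp add: smul_def)

lemma smul_eq_iff:
  assumes "\<alpha> \<noteq> 0"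
  shows "smul \<alpha> A = B \<longleftrightarrow> A = smul (1 / \<alpha>) B"
proof
  assume "smul \<alpha> A = B"
  then have "smul (1 / \<alpha>) B = smul (1 / \<alpha> * \<alpha>) A" by (simp only: smul_smul[symmetric])
  then show "A = smul (1 / \<alpha>) B" using assms by simp
next
  assume "A = smul (1 / \<alpha>) B"
  then have "smul \<alpha> A = smul (\<alpha> * (1 / \<alpha>)) B" by (simp only: smul_smul)
  then show "smul \<alpha> A = B" using assms by simp
qed

lemma mem_smul: "\<alpha> \<noteq> 0 \<Longrightarrow> x \<in> smul \<alpha> A \<longleftrightarrow> x / \<alpha> \<in> A"
  by (auto simp: smul_def image_iff intro: bexI[of _ "x / \<alpha>"])

lemma smul_lat: "smul \<alpha> (lat a b) = lat (\<alpha> * a) (\<alpha> * b)"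
  unfolding lat_eq_span smul_span by (simp add: smul_def)

lemma lprod_lat: "lprod (lat a b) (lat c d) = zmod.span {a * c, a * d, b * c, b * d}"
proof -
  have "lprod (lat a b) (lat c d) = lprod {a, b} {c, d}"
    unfolding lat_eq_span by (metis lprod_span lprod_commute)
  also have "\<dots> = zmod.span {a * c, a * d, b * c, b * d}"
    unfolding lprod_def by (rule arg_cong[where f = zmod.span]) auto
  finally show ?thesis .
qed

lemma span_subset_lat: "zmod.span S \<subseteq> lat c d \<longleftrightarrow> S \<subseteq> lat c d"
proof
  assume "S \<subseteq> lat c d"
  then show "zmod.span S \<subseteq> lat c d"
    unfolding lat_eq_span by (intro zmod.span_minimal zmod.subspace_span)
qed (use zmod.span_superset in blast)

lemma lat_subset_iff: "lat a b \<subseteq> lat c d \<longleftrightarrow> a \<in> lat c d \<and> b \<in> lat c d"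
  unfolding lat_eq_span[of a b] span_subset_lat by simp

lemma latI: "z = of_int x * a + of_int y * b \<Longrightarrow> z \<in> lat a b"
  unfolding lat_def by blast

lemma latE: assumes "z \<in> lat a b" obtains x y :: int where "z = of_int x * a + of_int y * b"
  using assms unfolding lat_def by blast

lemma lprod_cnj: "cnj ` lprod A B = lprod (cnj ` A) (cnj ` B)"
proof -
  have sub: "cnj ` lprod A B \<subseteq> lprod (cnj ` A) (cnj ` B)" for A B
  proof -
    have "cnj x \<in> lprod (cnj ` A) (cnj ` B)" if "x \<in> lprod A B" for x
      using that unfolding lprod_def[of A B]
    proof (induction rule: zmod.span_induct_alt)
      case base
      then show ?case by (simp add: lprod_def zmod.span_zero)
    next
      case (step c x y)
      then obtain a b where "x = a * b" "a \<in> A" "b \<in> B" by blast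
      then have "cnj x \<in> lprod (cnj ` A) (cnj ` B)"
        unfolding lprod_def by (intro zmod.span_base) auto
      then have "of_int c * cnj x + cnj y \<in> lprod (cnj ` A) (cnj ` B)"
        using step unfolding lprod_def by (intro zmod.span_add zmod.span_scale)
      then show ?case by simp
    qed
    then show ?thesis by blast
  qed
  have "lprod (cnj ` A) (cnj ` B) = cnj ` cnj ` lprod (cnj ` A) (cnj ` B)"
    by (simp add: image_image)
  also have "\<dots> \<subseteq> cnj ` lprod (cnj ` cnj ` A) (cnj ` cnj ` B)"
    by (intro image_mono sub)
  also have "\<dots> = cnj ` lprod A B" by (simp add: image_image)
  finally show ?thesis using sub[of A B] by blast
qed

lemma smul_cnj: "cnj ` smul \<alpha> A = smul (cnj \<alpha>) (cnj ` A)"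
  by (auto simp: smul_def image_image)

section \<open>Lattices attached to binary forms\<close>

lemma not_coprime_prime_divisor:
  fixes a b :: int
  assumes "\<not> coprime a b" "b \<noteq> 0"
  obtains p where "prime p" "p dvd a" "p dvd b"
proof -
  have "\<not> is_unit (gcd a b)" "gcd a b \<noteq> 0"
    using assms by (auto simp: coprime_iff_gcd_eq_1 is_unit_gcd)
  then obtain p where "prime p" "p dvd gcd a b" using prime_divisor_exists by blast
  then show ?thesis using that by simp
qed

text \<open>The pair is built from the primes \<open>p\<close> dividing \<open>N\<close>. If
  \<open>p\<close> does not divide \<open>a\<close>, it goes into \<open>y\<close>; if it divides
  \<open>a\<close> but not \<open>c\<close>, into \<open>x\<close>; if it divides both, into
  neither, and then \<open>b x y\<close> survives modulo \<open>p\<close>, since primitivity keeps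
  \<open>p\<close> from dividing \<open>b\<close>. The two sets of primes are disjoint.\<close>

lemma primitive_form_represents_coprime:
  fixes a b c N :: int
  assumes "gcd a (gcd b c) = 1" "N \<noteq> 0"
  obtains x y where "coprime x y" "coprime (a * x\<^sup>2 + b * x * y + c * y\<^sup>2) N"
proof -
  define S where "S = prime_factors N"
  have finS: "finite S" by (simp add: S_def)
  have S: "prime p" if "p \<in> S" for p using that by (auto simp: S_def)
  define x where "x = \<Prod>{p\<in>S. p dvd a \<and> \<not> p dvd c}"
  define y where "y = \<Prod>{p\<in>S. \<not> p dvd a}"
  have px: "p dvd x \<longleftrightarrow> p \<in> S \<and> p dvd a \<and> \<not> p dvd c" if pr: "prime p" "p > 0" for p
  proof
    assume "p dvd x"
    then obtain r where "r \<in> S" "r dvd a" "\<not> r dvd c" "p dvd r"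
      unfolding x_def using prime_dvd_prod_iff[of "{p\<in>S. p dvd a \<and> \<not> p dvd c}" p id] finS pr by auto
    moreover from this have "p = r" using primes_dvd_imp_eq[OF pr(1) S] by simp
    ultimately show "p \<in> S \<and> p dvd a \<and> \<not> p dvd c" by simp
  qed (auto simp: x_def finS intro!: dvd_prodI)
  have py: "p dvd y \<longleftrightarrow> p \<in> S \<and> \<not> p dvd a" if pr: "prime p" "p > 0" for p
  proof
    assume "p dvd y"
    then obtain r where "r \<in> S" "\<not> r dvd a" "p dvd r"
      unfolding y_def using prime_dvd_prod_iff[of "{p\<in>S. \<not> p dvd a}" p id] finS pr by auto
    moreover from this have "p = r" using primes_dvd_imp_eq[OF pr(1) S] by simp
    ultimately show "p \<in> S \<and> \<not> p dvd a" by simp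
  qed (auto simp: y_def finS intro!: dvd_prodI)
  show ?thesis
  proof (rule that)
    show "coprime x y"
    proof (rule ccontr)
      assume "\<not> coprime x y"
      moreover have "y \<noteq> 0" using finS S[of 0] by (auto simp: y_def)
      ultimately obtain p where p: "prime p" "p dvd x" "p dvd y"
        by (rule not_coprime_prime_divisor)
      then show False using px[of p] py[of p] prime_gt_0_int[of p] by auto
    qed
    show "coprime (a * x\<^sup>2 + b * x * y + c * y\<^sup>2) N"
    proof (rule ccontr)
      assume "\<not> coprime (a * x\<^sup>2 + b * x * y + c * y\<^sup>2) N"
      then obtain p where p: "prime p" "p dvd a * x\<^sup>2 + b * x * y + c * y\<^sup>2" "p dvd N"
        using assms(2) by (rule not_coprime_prime_divisor)
      have p0: "p > 0" using p(1) prime_gt_0_int by blast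
      have pS: "p \<in> S" using p assms(2) by (simp add: S_def prime_factors_dvd)
      note prm = prime_dvd_mult_iff[OF p(1)] 
      consider "\<not> p dvd a" | "p dvd a" "\<not> p dvd c" | "p dvd a" "p dvd c" by blast
      then show False
      proof cases
        case 1
        then have "p dvd y" "\<not> p dvd x" using px[OF p(1) p0] py[OF p(1) p0] pS by auto
        then have "p dvd b * x * y + c * y\<^sup>2" by (auto simp: power2_eq_square)
        then have "p dvd a * x\<^sup>2" using p(2) by (metis add.assoc dvd_add_left_iff)
        then show False using 1 \<open>\<not> p dvd x\<close> by (simp add: prm power2_eq_square)
      next
        case 2
        then have "p dvd x" "\<not> p dvd y" using px[OF p(1) p0] py[OF p(1) p0] pS by auto
        then have "p dvd a * x\<^sup>2 + b * x * y" by (auto simp: power2_eq_square)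
        then have "p dvd c * y\<^sup>2" using p(2) dvd_add_right_iff by blast
        then show False using 2 \<open>\<not> p dvd y\<close> by (simp add: prm power2_eq_square)
      next
        case 3
        then have nd: "\<not> p dvd x" "\<not> p dvd y" using px[OF p(1) p0] py[OF p(1) p0] by auto
        have "\<not> p dvd b"
        proof
          assume "p dvd b"
          then have "p dvd gcd a (gcd b c)" using 3 by simp
          then show False using assms(1) p(1) by (simp add: not_prime_unit)
        qed
        moreover have "a * x\<^sup>2 + b * x * y + c * y\<^sup>2 = b * x * y + (a * x\<^sup>2 + c * y\<^sup>2)" by simp
        then have "p dvd b * x * y" using p(2) 3 by (metis dvd_add dvd_add_left_iff dvd_mult2)
        ultimately show False using nd by (simp add: prm)
      qed
    qed
  qed
qed

lemma coprime_complement: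
  fixes x y :: int
  assumes "coprime x y"
  obtains u v where "x * v - y * u = 1"
proof -
  obtain a b where "a * x + b * y = 1" using bezout_int[of x y] assms by auto
  then have "x * a - y * (- b) = 1" by (simp add: algebra_simps)
  then show ?thesis by (rule that)
qed

text \<open>The forms \<open>n x^2 + 2 h x y + k y^2\<close> below have discriminant
  \<open>-4 D\<close>. As \<open>D\<close> is even, every \<open>n\<close> prime to \<open>D\<close>
  is odd, which makes these forms primitive.\<close>

locale disc =
  fixes D :: int
  assumes D_pos: "D > 0" and D_even: "even D"
begin

definition del :: complex where "del = \<i> * of_real (sqrt (of_int D))"

lemma del_sq: "del * del = - of_int D"
proof -
  have "of_real (sqrt (of_int D)) * of_real (sqrt (of_int D)) = (of_int D :: complex)"
    using D_pos by (simp flip: of_real_mult)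
  then show ?thesis by (simp add: del_def mult_ac)
qed

lemma cnj_del: "cnj del = - del"
  by (simp add: del_def)

lemma Re_del [simp]: "Re del = 0" and Im_del: "Im del > 0"
  using D_pos by (simp_all add: del_def)

text \<open>A root of \<open>n t^2 - 2 h t + k\<close>, where \<open>n k = h^2 + D\<close>; the form
  is recovered from the lattice spanned by 1 and \<open>t\<close> as
  \<open>n |x + y t|^2\<close>.\<close>

definition tau :: "int \<Rightarrow> int \<Rightarrow> complex" where "tau n h = (of_int h + del) / of_int n"

definition Mlat :: "int \<Rightarrow> int \<Rightarrow> complex set" where "Mlat n h = lat 1 (tau n h)"

text \<open>The ring generated by a square root of \<open>-D\<close>. It is in general not a maximal
  order, so not every lattice over it is invertible.\<close>

definition Ord :: "complex set" where "Ord = lat 1 del"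

lemma Ord_eq_Mlat: "Ord = Mlat 1 0"
  by (simp add: Ord_def Mlat_def tau_def)

lemma one_mem_Mlat: "1 \<in> Mlat n h"
  unfolding Mlat_def by (rule latI[of _ 1 _ 0]) simp

lemma tau_mult: "n \<noteq> 0 \<Longrightarrow> of_int n * tau n h = of_int h + del"
  by (simp add: tau_def)

lemma Mlat_subset_cong:
  assumes "n > 0" "[h = h'] (mod n)"
  shows "Mlat n h \<subseteq> Mlat n h'"
proof -
  obtain j where j: "h' = h + n * j" using assms(2) by (auto simp: cong_iff_lin)
  have "tau n h = of_int (-j) * 1 + of_int 1 * tau n h'"
    using assms(1) by (simp add: tau_def j field_simps)
  then show ?thesis unfolding Mlat_def lat_subset_iff
    using one_mem_Mlat[unfolded Mlat_def] latI by blast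
qed

lemma Mlat_cong: "n > 0 \<Longrightarrow> [h = h'] (mod n) \<Longrightarrow> Mlat n h = Mlat n h'"
  using Mlat_subset_cong[of n h h'] Mlat_subset_cong[of n h' h] by (auto simp: cong_sym_eq)

text \<open>Dirichlet's composition of forms with the same middle coefficient. With
  \<open>T = tau (n * n') h\<close> the products of generators are 1, \<open>n T\<close>,
  \<open>n' T\<close> and \<open>2 h T - k\<close>; coprimality of \<open>n\<close> and
  \<open>n'\<close> recovers \<open>T\<close>.\<close>

lemma Mlat_mult:
  assumes "n > 0" "n' > 0" "coprime n n'" "n * n' dvd h\<^sup>2 + D"
  shows "lprod (Mlat n h) (Mlat n' h) = Mlat (n * n') h"
proof -
  let ?t = "tau n h" and ?t' = "tau n' h" and ?T = "tau (n * n') h"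
  obtain k where k: "h\<^sup>2 + D = n * n' * k" using assms(4) by blast
  obtain u v where uv: "u * n + v * n' = 1" using bezout_int[of n n'] assms(3) by auto
  have nz: "of_int n \<noteq> (0::complex)" "of_int n' \<noteq> (0::complex)" using assms by auto
  have t: "?t = of_int n' * ?T" "?t' = of_int n * ?T" using nz by (auto simp: tau_def)
  have kc: "of_int h * of_int h + of_int D = (of_int n * of_int n' * of_int k :: complex)"
    using k by (metis of_int_add of_int_mult power2_eq_square)
  have tt: "?t * ?t' = of_int (2 * h) * ?T - of_int k"
  proof -
    have "(of_int h + del) * (of_int h + del) = of_int (2 * h) * (of_int h + del) - of_int n * of_int n' * of_int k"
    proof -
      have "(of_int h + del) * (of_int h + del) = of_int h * of_int h + of_int (2 * h) * del + del * del"
        by (simp add: algebra_simps)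
      also have "\<dots> = of_int (2 * h) * (of_int h + del) - (of_int h * of_int h + of_int D)"
        unfolding del_sq by (simp add: distrib_left)
      finally show ?thesis unfolding kc .
    qed
    then show ?thesis using nz by (simp add: tau_def divide_simps)
  qed
  have "lprod (Mlat n h) (Mlat n' h) = zmod.span {1, ?t', ?t, ?t * ?t'}"
    unfolding Mlat_def lprod_lat by (simp add: insert_commute)
  also have "\<dots> = lat 1 ?T"
  proof
    have "1 \<in> lat 1 ?T" by (rule latI[of _ 1 _ 0]) simp
    moreover have "?t' \<in> lat 1 ?T" by (rule latI[of _ 0 _ n]) (simp add: t)
    moreover have "?t \<in> lat 1 ?T" by (rule latI[of _ 0 _ n']) (simp add: t)
    moreover have "?t * ?t' \<in> lat 1 ?T" by (rule latI[of _ "-k" _ "2 * h"]) (simp add: tt)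
    ultimately show "zmod.span {1, ?t', ?t, ?t * ?t'} \<subseteq> lat 1 ?T"
      unfolding span_subset_lat by blast
    have "?T = of_int u * ?t' + of_int v * ?t"
    proof -
      have "of_int u * ?t' + of_int v * ?t = of_int (u * n + v * n') * ?T"
        by (simp only: t of_int_add of_int_mult distrib_right distrib_left mult_ac)
      then show ?thesis unfolding uv by simp
    qed
    moreover have "of_int u * ?t' + of_int v * ?t \<in> zmod.span {1, ?t', ?t, ?t * ?t'}"
      by (intro zmod.span_add zmod.span_scale) (auto intro: zmod.span_base)
    ultimately have "?T \<in> zmod.span {1, ?t', ?t, ?t * ?t'}" by simp
    moreover have "1 \<in> zmod.span {1, ?t', ?t, ?t * ?t'}" by (rule zmod.span_base) simp
    ultimately show "lat 1 ?T \<subseteq> zmod.span {1, ?t', ?t, ?t * ?t'}"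
      unfolding lat_eq_span by (intro zmod.span_minimal zmod.subspace_span) blast
  qed
  finally show ?thesis by (simp add: Mlat_def)
qed

text \<open>The second factor is the conjugate of the first. The product contains 1 and, as a
  difference of generators, \<open>2 h / n\<close>; since \<open>n\<close> is prime to
  \<open>2 h\<close>, it contains \<open>1 / n\<close> and then also \<open>del / n\<close>.\<close>

lemma Mlat_mult_inverse:
  assumes "n > 0" "coprime n (2 * h)" "n dvd h\<^sup>2 + D"
  shows "lprod (Mlat n h) (Mlat n (-h)) = smul (1 / of_int n) Ord"
proof -
  let ?t = "tau n h" and ?t' = "tau n (-h)" and ?i = "1 / of_int n :: complex"
  obtain k where k: "h\<^sup>2 + D = n * k" using assms(3) by blast
  obtain u v where uv: "u * n + v * (2 * h) = 1" using bezout_int[of n "2 * h"] assms(2) by auto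
  have nz: "of_int n \<noteq> (0::complex)" using assms by auto
  have kc: "of_int h * of_int h + of_int D = (of_int n * of_int k :: complex)"
    using k by (metis of_int_add of_int_mult power2_eq_square)
  have tt: "?t * ?t' = of_int (-k) * ?i"
  proof -
    have "(of_int h + del) * (of_int (-h) + del) = - (of_int n * of_int k)"
    proof -
      have "(of_int h + del) * (of_int (-h) + del) = del * del - of_int h * of_int h"
        by (simp add: algebra_simps)
      also have "\<dots> = - (of_int h * of_int h + of_int D)"
        unfolding del_sq by simp
      finally show ?thesis unfolding kc .
    qed
    then show ?thesis using nz by (simp add: tau_def divide_simps)
  qed
  have "lprod (Mlat n h) (Mlat n (-h)) = zmod.span {1, ?t', ?t, ?t * ?t'}"
    unfolding Mlat_def lprod_lat by (simp add: insert_commute)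
  also have "\<dots> = lat ?i (?i * del)"
  proof
    have "1 \<in> lat ?i (?i * del)" by (rule latI[of _ n _ 0]) (use assms(1) in simp)
    moreover have "?t' \<in> lat ?i (?i * del)" by (rule latI[of _ "-h" _ 1]) (use assms(1) in \<open>simp add: tau_def field_simps\<close>)
    moreover have "?t \<in> lat ?i (?i * del)" by (rule latI[of _ h _ 1]) (use assms(1) in \<open>simp add: tau_def field_simps\<close>)
    moreover have "?t * ?t' \<in> lat ?i (?i * del)" by (rule latI[of _ "-k" _ 0]) (simp add: tt)
    ultimately show "zmod.span {1, ?t', ?t, ?t * ?t'} \<subseteq> lat ?i (?i * del)"
      unfolding span_subset_lat by blast
    let ?S = "zmod.span {1, ?t', ?t, ?t * ?t'}"
    have "?i = of_int u * 1 + (of_int v * ?t - of_int v * ?t')"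
    proof -
      have "?t - ?t' = of_int (2 * h) * ?i" using nz by (simp add: tau_def diff_divide_distrib[symmetric])
      then have "of_int u * 1 + (of_int v * ?t - of_int v * ?t') = of_int u * (of_int n * ?i) + of_int v * (of_int (2 * h) * ?i)"
        using nz(1) by (simp only: right_diff_distrib[symmetric]) simp
      also have "\<dots> = of_int (u * n + v * (2 * h)) * ?i"
        by (simp only: of_int_add of_int_mult distrib_right mult.assoc)
      finally show ?thesis unfolding uv by simp
    qed
    moreover have "of_int u * 1 + (of_int v * ?t - of_int v * ?t') \<in> ?S"
      by (intro zmod.span_add zmod.span_diff zmod.span_scale) (auto intro: zmod.span_base)
    ultimately have i: "?i \<in> ?S" by simp
    have "?i * del = ?t - of_int h * ?i" using nz by (simp add: tau_def field_simps)
    moreover have "?t - of_int h * ?i \<in> ?S"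
      by (intro zmod.span_diff zmod.span_scale i zmod.span_base) auto
    ultimately have "?i * del \<in> ?S" by simp
    with i show "lat ?i (?i * del) \<subseteq> ?S"
      unfolding lat_eq_span by (intro zmod.span_minimal zmod.subspace_span) blast
  qed
  also have "\<dots> = smul ?i Ord" by (simp add: Ord_def smul_lat)
  finally show ?thesis .
qed

text \<open>The unimodular change to the basis \<open>x + y tau\<close>, \<open>u + v tau\<close>.
  Dividing by the first vector makes it 1 again and turns the second into the \<open>tau\<close> of
  the transformed form, whose leading coefficient is the value at \<open>(x, y)\<close>.\<close>

lemma Mlat_base_change:
  assumes n: "n > 0" and k: "n * k = h\<^sup>2 + D" and xy: "x * v - y * u = 1"
    and n': "n' = n * x\<^sup>2 + 2 * h * x * y + k * y\<^sup>2"
    and h': "h' = n * x * u + h * (x * v + y * u) + k * y * v"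
  shows "n' > 0" "n' dvd h'\<^sup>2 + D" "Mlat n h = smul (of_int x + of_int y * tau n h) (Mlat n' h')"
    "of_int x + of_int y * tau n h \<noteq> 0"
proof -
  define k' where "k' = n * u\<^sup>2 + 2 * h * u * v + k * v\<^sup>2"
  have "n' * k' - h'\<^sup>2 = (n * k - h\<^sup>2) * (x * v - y * u)\<^sup>2"
    unfolding n' h' k'_def by (simp add: power2_eq_square algebra_simps)
  then have k'e: "n' * k' = h'\<^sup>2 + D" using xy k by simp
  then show "n' dvd h'\<^sup>2 + D" by (metis dvd_triv_left)
  have nn: "n * n' = (n * x + h * y)\<^sup>2 + D * y\<^sup>2"
  proof -
    have "n * n' = (n * x + h * y)\<^sup>2 + (n * k - h\<^sup>2) * y\<^sup>2"
      unfolding n' by (simp add: power2_eq_square algebra_simps)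
    then show ?thesis using k by simp
  qed
  have "x \<noteq> 0 \<or> y \<noteq> 0" using xy by auto
  then have "(n * x + h * y)\<^sup>2 + D * y\<^sup>2 > 0"
  proof (cases "y = 0")
    case False
    then have "D * y\<^sup>2 > 0" using D_pos by simp
    then show ?thesis by (simp add: add_nonneg_pos)
  qed (use n in auto)
  then show n'_pos: "n' > 0" using nn n by (metis zero_less_mult_pos)
  let ?T = "tau n h" and ?T' = "tau n' h'"
  \<comment> \<open>\<open>A\<close> and \<open>B\<close> compare the rational parts and the
    coefficients of \<open>del\<close> in
    \<open>n (x + y tau) (h' + del) = n n' (u + v tau)\<close>.\<close>
  have A: "(n * x + y * h) * h' - y * D = n' * (n * u + v * h)"
  proof -
    have "(n * x + y * h) * h' - y * (n * k - h\<^sup>2) * (x * v - y * u) = n' * (n * u + v * h)"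
      unfolding n' h' by (simp add: power2_eq_square algebra_simps)
    then show ?thesis using xy k by simp
  qed
  have B: "n * x + y * h + y * h' = n' * v"
  proof -
    have "(n * x + y * h) * (x * v - y * u) + y * h' = n' * v"
      unfolding n' h' by (simp add: power2_eq_square algebra_simps)
    then show ?thesis using xy by simp
  qed
  have nz: "of_int n \<noteq> (0::complex)" "of_int n' \<noteq> (0::complex)" using n n'_pos by auto
  have AB: "of_int (n * x + y * h) * of_int h' - of_int y * of_int D = (of_int n' * of_int (n * u + v * h) :: complex)"
    "of_int (n * x + y * h) + of_int y * of_int h' = (of_int n' * of_int v :: complex)"
    using A B by (simp_all flip: of_int_mult of_int_add of_int_diff)
  have gen: "(p + y * del) * (h' + del) = n' * (r + v * del)"
    if eq: "p * h' - y * of_int D = n' * r" "p + y * h' = n' * v" for p y h' n' r v :: complex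
  proof -
    have "(p + y * del) * (h' + del) = p * h' + y * (del * del) + (p + y * h') * del"
      by (simp add: distrib_left distrib_right mult_ac)
    also have "\<dots> = (p * h' - y * of_int D) + (p + y * h') * del"
      unfolding del_sq by simp
    finally show ?thesis unfolding eq by (simp add: distrib_left mult.assoc)
  qed
  note main = gen[OF AB]
  have e1: "of_int x + of_int y * ?T = (of_int (n * x + y * h) + of_int y * del) / of_int n"
    "of_int u + of_int v * ?T = (of_int (n * u + v * h) + of_int v * del) / of_int n"
    using nz by (simp_all add: tau_def field_simps)
  have e2: "(of_int x + of_int y * ?T) * ?T' = of_int u + of_int v * ?T"
    unfolding e1 tau_def[of n' h'] times_divide_times_eq main using nz by simp
  show "Mlat n h = smul (of_int x + of_int y * ?T) (Mlat n' h')"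
    unfolding Mlat_def smul_lat e2
  proof
    have xyc: "of_int x * of_int v - of_int y * of_int u = (1::complex)"
      using arg_cong[OF xy, of "of_int :: int \<Rightarrow> complex"] by simp
    have poly: "V * (X + Y * T) - Y * (U + V * T) = X * V - Y * U"
      "X * (U + V * T) - U * (X + Y * T) = (X * V - Y * U) * T" for X Y U V T :: complex
      by (simp_all add: algebra_simps)
    have "1 = of_int v * ((of_int x + of_int y * ?T) * 1) + of_int (- y) * (of_int u + of_int v * ?T)"
      using poly(1)[of "of_int v" "of_int x" "of_int y" ?T "of_int u", unfolded xyc] by simp
    moreover have "?T = of_int (- u) * ((of_int x + of_int y * ?T) * 1) + of_int x * (of_int u + of_int v * ?T)"
      using poly(2)[of "of_int x" "of_int u" "of_int v" ?T "of_int y", unfolded xyc] by simp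
    ultimately show "lat 1 ?T \<subseteq> lat ((of_int x + of_int y * ?T) * 1) (of_int u + of_int v * ?T)"
      unfolding lat_subset_iff using latI by blast
    show "lat ((of_int x + of_int y * ?T) * 1) (of_int u + of_int v * ?T) \<subseteq> lat 1 ?T"
      unfolding lat_subset_iff
      by (rule conjI, rule latI[of _ x _ y], simp, rule latI[of _ u _ v], simp)
  qed
  show "of_int x + of_int y * ?T \<noteq> 0"
  proof
    assume "of_int x + of_int y * ?T = 0"
    then have 0: "of_int (n * x + y * h) + of_int y * del = 0" using e1(1) nz by simp
    then have "Im (of_int (n * x + y * h) + of_int y * del) = 0" by simp
    then have "y = 0" using Im_del by simp
    moreover from this have "x = 0" using 0 n by simp
    ultimately show False using xy by simp
  qed
qed

end

section \<open>The group of invertible lattices\<close>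

context disc
begin

text \<open>\<open>h\<close> is a square root of \<open>-D\<close> modulo \<open>n\<close>.
  Coprimality to \<open>D\<close> keeps the lattice prime to the conductor of \<open>Ord\<close>,
  which makes it invertible.\<close>

definition valid :: "int \<Rightarrow> int \<Rightarrow> bool" where
  "valid n h \<longleftrightarrow> n > 0 \<and> coprime n D \<and> n dvd h\<^sup>2 + D"

text \<open>Scalings are kept, so that the group law is the product of lattices itself; homothety
  classes appear only where finiteness matters.\<close>

definition invertible :: "complex set set" where
  "invertible = {smul \<alpha> (Mlat n h) | \<alpha> n h. \<alpha> \<noteq> 0 \<and> valid n h}"

definition idG :: "complex set monoid" where
  "idG = \<lparr>carrier = invertible, mult = lprod, one = Ord\<rparr>"

lemma invertible_I: "\<alpha> \<noteq> 0 \<Longrightarrow> valid n h \<Longrightarrow> smul \<alpha> (Mlat n h) \<in> invertible"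
  unfolding invertible_def by blast

lemma Mlat_invertible: "valid n h \<Longrightarrow> Mlat n h \<in> invertible"
  using invertible_I[of 1 n h] by simp

lemma valid_1: "valid 1 0" by (simp add: valid_def)

lemma Ord_invertible: "Ord \<in> invertible"
  unfolding Ord_eq_Mlat by (intro Mlat_invertible valid_1)

lemma smul_invertible: assumes "L \<in> invertible" "\<alpha> \<noteq> 0" shows "smul \<alpha> L \<in> invertible"
  using assms unfolding invertible_def by clarsimp (metis mult_eq_0_iff)

text \<open>A common divisor of \<open>n\<close> and \<open>h\<close> divides \<open>h^2 + D\<close>
  and \<open>h^2\<close>, hence \<open>D\<close>.\<close>

lemma valid_coprime_2h: assumes "valid n h" shows "coprime n (2 * h)"
proof -
  have n: "n > 0" "coprime n D" "n dvd h\<^sup>2 + D" using assms by (auto simp: valid_def)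
  have "coprime n 2" using n(2) D_even by (meson coprime_commute coprime_divisors dvd_refl)
  moreover have "coprime n h"
  proof (rule coprimeI)
    fix c assume c: "c dvd n" "c dvd h"
    then have "c dvd h\<^sup>2 + D" "c dvd h\<^sup>2" using n(3) by (auto simp: power2_eq_square)
    then have "c dvd D" using dvd_add_right_iff by blast
    then show "is_unit c" using n(2) c(1) by (meson coprime_common_divisor)
  qed
  ultimately show ?thesis by simp
qed

lemma valid_uminus: "valid n h \<Longrightarrow> valid n (-h)"
  by (simp add: valid_def)

lemma valid_cong:
  assumes "valid n h" "[h = h'] (mod n)" shows "valid n h'"
proof -
  have "[h\<^sup>2 + D = h'\<^sup>2 + D] (mod n)" using assms(2) by (intro cong_add cong_pow cong_refl)
  then show ?thesis using assms(1) by (simp add: valid_def cong_dvd_iff)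
qed

lemma valid_mult:
  assumes "valid n h" "valid n' h" "coprime n n'"
  shows "valid (n * n') h"
  using assms by (auto simp: valid_def divides_mult)

lemma primitive_rechoose:
  assumes "n > 0" "n * k = h\<^sup>2 + D" "gcd n (gcd (2 * h) k) = 1" "N \<noteq> 0"
  obtains x y n' h' where "coprime x y" "n' = n * x\<^sup>2 + 2 * h * x * y + k * y\<^sup>2" "valid n' h'" "coprime n' N"
    "Mlat n h = smul (of_int x + of_int y * tau n h) (Mlat n' h')" "of_int x + of_int y * tau n h \<noteq> 0"
proof -
  \<comment> \<open>The value is made prime to \<open>N * D\<close> and not just to
    \<open>N\<close>, so that the new index is again prime to \<open>D\<close>.\<close>
  have "N * D \<noteq> 0" using assms(4) D_pos by simp
  then obtain x y where xy: "coprime x y" "coprime (n * x\<^sup>2 + 2 * h * x * y + k * y\<^sup>2) (N * D)"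
    by (rule primitive_form_represents_coprime[OF assms(3)])
  obtain u v where uv: "x * v - y * u = 1" using xy(1) by (rule coprime_complement)
  note bc = Mlat_base_change[OF assms(1,2) uv refl refl]
  show ?thesis
    by (rule that[OF xy(1) refl _ _ bc(3,4)]) (use bc(1,2) xy(2) in \<open>auto simp: valid_def\<close>)
qed

lemma valid_rechoose:
  assumes "valid n h" "N \<noteq> 0"
  obtains \<alpha> n' h' where "\<alpha> \<noteq> 0" "valid n' h'" "coprime n' N" "Mlat n h = smul \<alpha> (Mlat n' h')"
proof -
  obtain k where k: "n * k = h\<^sup>2 + D" using assms(1) by (metis valid_def dvdE)
  have "gcd n (gcd (2 * h) k) = 1"
    using valid_coprime_2h[OF assms(1)] by (simp add: gcd.assoc[symmetric])
  then show ?thesis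
    using primitive_rechoose[OF _ k _ assms(2)] assms(1) that unfolding valid_def by metis
qed

lemma invertible_rep:
  assumes "L \<in> invertible" "N \<noteq> 0"
  obtains \<alpha> n h where "\<alpha> \<noteq> 0" "valid n h" "coprime n N" "L = smul \<alpha> (Mlat n h)"
proof -
  obtain \<beta> m j where L: "\<beta> \<noteq> 0" "valid m j" "L = smul \<beta> (Mlat m j)" using assms(1) unfolding invertible_def by blast
  obtain \<alpha> n h where "\<alpha> \<noteq> 0" "valid n h" "coprime n N" "Mlat m j = smul \<alpha> (Mlat n h)"
    using valid_rechoose[OF L(2) assms(2)] by blast
  then show ?thesis using L that[of "\<beta> * \<alpha>" n h] by simp
qed

lemma common_root:
  assumes "valid n h" "valid n' h'" "coprime n n'"
  obtains j where "[j = h] (mod n)" "[j = h'] (mod n')" "valid (n * n') j"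
proof -
  obtain j where j: "[j = h] (mod n)" "[j = h'] (mod n')"
    using binary_chinese_remainder_int[OF assms(3)] by blast
  have "valid n j" "valid n' j" using j valid_cong[OF assms(1)] valid_cong[OF assms(2)] by (auto simp: cong_sym_eq)
  then show ?thesis using valid_mult assms(3) j that by blast
qed

lemma Mlat_mult_common:
  assumes "valid n h" "valid n' h'" "coprime n n'" "[j = h] (mod n)" "[j = h'] (mod n')"
  shows "lprod (Mlat n h) (Mlat n' h') = Mlat (n * n') j"
proof -
  have "valid n j" "valid n' j" using assms valid_cong by (auto simp: cong_sym_eq)
  then have "valid (n * n') j" using assms(3) by (intro valid_mult)
  then have "lprod (Mlat n j) (Mlat n' j) = Mlat (n * n') j"
    using assms by (intro Mlat_mult) (auto simp: valid_def)
  moreover have "Mlat n j = Mlat n h" "Mlat n' j = Mlat n' h'"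
    using assms by (auto intro!: Mlat_cong simp: valid_def)
  ultimately show ?thesis by simp
qed

\<comment> \<open>The second factor is first replaced by a homothetic lattice of index coprime to that of the first.\<close>
lemma lprod_invertible:
  assumes "A \<in> invertible" "B \<in> invertible" shows "lprod A B \<in> invertible"
proof -
  obtain \<alpha> n h where A: "\<alpha> \<noteq> 0" "valid n h" "A = smul \<alpha> (Mlat n h)" using assms(1) unfolding invertible_def by blast
  have "n \<noteq> 0" using A(2) by (simp add: valid_def)
  then obtain \<beta> n' h' where B: "\<beta> \<noteq> 0" "valid n' h'" "coprime n' n" "B = smul \<beta> (Mlat n' h')"
    using invertible_rep[OF assms(2)] by blast
  have cop: "coprime n n'" using B(3) by (simp add: coprime_commute)
  obtain j where j: "[j = h] (mod n)" "[j = h'] (mod n')" "valid (n * n') j"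
    using common_root[OF A(2) B(2) cop] by blast
  show ?thesis
    unfolding A(3) B(4) lprod_smul lprod_smul_right smul_smul Mlat_mult_common[OF A(2) B(2) cop j(1,2)]
    by (intro invertible_I j(3)) (use A(1) B(1) in simp)
qed

lemma Ord_lprod: assumes "L \<in> invertible" shows "lprod Ord L = L"
proof -
  obtain \<alpha> n h where A: "\<alpha> \<noteq> 0" "valid n h" "L = smul \<alpha> (Mlat n h)" using assms unfolding invertible_def by blast
  have "lprod (Mlat 1 0) (Mlat n h) = Mlat (1 * n) h"
    by (rule Mlat_mult_common[OF valid_1 A(2)]) auto
  then show ?thesis unfolding A(3) lprod_smul_right by (simp add: Ord_eq_Mlat)
qed

lemma invertible_inverse:
  assumes "L \<in> invertible" obtains L' where "L' \<in> invertible" "lprod L' L = Ord"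
proof -
  obtain \<alpha> n h where A: "\<alpha> \<noteq> 0" "valid n h" "L = smul \<alpha> (Mlat n h)" using assms unfolding invertible_def by blast
  have n: "n > 0" "n dvd h\<^sup>2 + D" using A(2) by (auto simp: valid_def)
  have "lprod (smul (of_int n / \<alpha>) (Mlat n (-h))) L = smul (of_int n / \<alpha> * (\<alpha> * (1 / of_int n))) Ord"
    unfolding A(3) lprod_smul lprod_smul_right
    using Mlat_mult_inverse[OF n(1) valid_coprime_2h[OF A(2)] n(2)] by (simp add: lprod_commute)
  also have "\<dots> = Ord" using A(1) n by simp
  finally show ?thesis using that invertible_I[OF _ valid_uminus[OF A(2)], of "of_int n / \<alpha>"] A(1) n(1) by simp
qed

sublocale idG: comm_group idG
  rewrites "carrier idG = invertible" and "mult idG = lprod" and "one idG = Ord"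
proof -
  show "comm_group idG"
  proof (rule comm_groupI)
    fix x assume "x \<in> carrier idG"
    then show "\<exists>y\<in>carrier idG. y \<otimes>\<^bsub>idG\<^esub> x = \<one>\<^bsub>idG\<^esub>"
      using invertible_inverse[of x] by (auto simp: idG_def)
  next
    fix x y assume "x \<in> carrier idG" "y \<in> carrier idG"
    then show "x \<otimes>\<^bsub>idG\<^esub> y = y \<otimes>\<^bsub>idG\<^esub> x" by (simp add: idG_def lprod_commute)
  qed (simp_all add: idG_def lprod_invertible Ord_invertible lprod_assoc Ord_lprod)
qed (simp_all add: idG_def)

section \<open>Norms of invertible lattices\<close>

lemma real_mem_Mlat:
  assumes "n > 0" "of_real r \<in> Mlat n h"
  obtains i :: int where "r = of_int i"
proof -
  obtain x y :: int where xy: "of_real r = of_int x * 1 + of_int y * tau n h"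
    using assms(2) unfolding Mlat_def by (rule latE)
  then have "of_int n * complex_of_real r = of_int (n * x) + of_int y * (of_int n * tau n h)"
    by (simp add: algebra_simps)
  then have e: "of_int n * complex_of_real r = of_int (n * x) + of_int y * (of_int h + del)"
    using assms(1) by (simp add: tau_mult)
  have "Im (of_int n * complex_of_real r) = of_int y * Im del" unfolding e by simp
  then have "y = 0" using Im_del by simp
  then have "complex_of_real r = of_int x" using xy by simp
  then have "r = of_int x" by (metis of_real_eq_iff of_real_of_int_eq)
  then show ?thesis by (rule that)
qed

lemma int_mem_Mlat: "of_int i \<in> Mlat n h"
  unfolding Mlat_def by (rule latI[of _ i _ 0]) simp

text \<open>The quotients \<open>r / r'\<close> and \<open>r' / r\<close> are real elements of
  \<open>Ord\<close>, hence positive integers with product 1.\<close>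

lemma smul_Ord_real_eq:
  assumes "r > 0" "r' > 0" "smul (of_real r) Ord = smul (of_real r') Ord"
  shows "r = r'"
proof -
  have mem: "\<exists>i::int. a / b = of_int i" if "a > 0" "b > 0" "smul (of_real a) Ord = smul (of_real b) Ord" for a b :: real
  proof -
    have "of_real a \<in> smul (of_real a) Ord"
      using one_mem_Mlat[of 1 0] by (simp add: smul_def Ord_eq_Mlat image_iff) (metis mult.right_neutral)
    then have "of_real a \<in> smul (of_real b) Ord" using that by simp
    then have "of_real (a / b) \<in> Mlat 1 0"
      using that mem_smul[of "of_real b" "of_real a" Ord] by (simp add: Ord_eq_Mlat)
    then show ?thesis by (rule real_mem_Mlat[rotated]) auto
  qed
  obtain i j :: int where ij: "r / r' = of_int i" "r' / r = of_int j"
    using mem[of r r'] mem[of r' r] assms by auto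
  have "real_of_int (i * j) = (r / r') * (r' / r)" using ij by simp
  also have "\<dots> = real_of_int 1" using assms by simp
  finally have "i * j = 1" by (simp only: of_int_eq_iff)
  moreover have "real_of_int i > 0" unfolding ij(1)[symmetric] using assms by simp
  then have "i > 0" by simp
  ultimately have "i = 1" by (metis zmult_eq_1_iff less_minus_one_simps(1) not_less_iff_gr_or_eq order_less_trans zero_less_one)
  then show ?thesis using ij(1) assms by simp
qed

text \<open>The norm of a fractional ideal, characterized through the product with the conjugate and
  not through a representation \<open>smul \<alpha> (Mlat n h)\<close>; this makes it multiplicative
  at once.\<close>

definition lnorm :: "complex set \<Rightarrow> real" where
  "lnorm L = (THE r. r > 0 \<and> lprod L (cnj ` L) = smul (of_real r) Ord)"

lemma lnorm_eqI: "r > 0 \<Longrightarrow> lprod L (cnj ` L) = smul (of_real r) Ord \<Longrightarrow> lnorm L = r"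
  unfolding lnorm_def by (rule the_equality) (auto intro: smul_Ord_real_eq)

lemma cnj_Mlat: assumes "n > 0" shows "cnj ` Mlat n h = Mlat n (-h)"
proof -
  have sub: "cnj ` Mlat n h \<subseteq> Mlat n (-h)" for h
  proof (clarify)
    fix z assume "z \<in> Mlat n h"
    then obtain x y :: int where z: "z = of_int x * 1 + of_int y * tau n h" unfolding Mlat_def by (rule latE)
    have "cnj (tau n h) = - tau n (-h)" using assms by (simp add: tau_def cnj_del field_simps)
    then have "cnj z = of_int x * 1 + of_int (-y) * tau n (-h)" by (simp add: z)
    then show "cnj z \<in> Mlat n (-h)" unfolding Mlat_def by (rule latI)
  qed
  have "Mlat n (-h) = cnj ` cnj ` Mlat n (-h)" by (simp add: image_image)
  also have "\<dots> \<subseteq> cnj ` Mlat n (- (- h))" by (intro image_mono sub)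
  finally show ?thesis using sub[of h] by simp
qed

lemma lprod_cnj_eq:
  assumes "\<alpha> \<noteq> 0" "valid n h"
  shows "lprod (smul \<alpha> (Mlat n h)) (cnj ` smul \<alpha> (Mlat n h)) = smul (of_real ((cmod \<alpha>)\<^sup>2 / of_int n)) Ord"
proof -
  have n: "n > 0" "n dvd h\<^sup>2 + D" using assms(2) by (auto simp: valid_def)
  have "lprod (smul \<alpha> (Mlat n h)) (cnj ` smul \<alpha> (Mlat n h)) = smul (\<alpha> * cnj \<alpha> * (1 / of_int n)) Ord"
    unfolding smul_cnj cnj_Mlat[OF n(1)] lprod_smul lprod_smul_right 
      Mlat_mult_inverse[OF n(1) valid_coprime_2h[OF assms(2)] n(2)] by (simp add: mult_ac)
  also have "\<alpha> * cnj \<alpha> * (1 / of_int n) = of_real ((cmod \<alpha>)\<^sup>2 / of_int n)"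
    by (simp only: of_real_divide complex_norm_square of_real_of_int_eq) simp
  finally show ?thesis .
qed

lemma lnorm_smul_Mlat:
  assumes "\<alpha> \<noteq> 0" "valid n h"
  shows "lnorm (smul \<alpha> (Mlat n h)) = (cmod \<alpha>)\<^sup>2 / of_int n"
  by (rule lnorm_eqI[OF _ lprod_cnj_eq[OF assms]]) (use assms in \<open>auto simp: valid_def\<close>)

lemma lnorm_Mlat: "valid n h \<Longrightarrow> lnorm (Mlat n h) = 1 / of_int n"
  using lnorm_smul_Mlat[of 1 n h] by simp

lemma lnorm_G:
  assumes "L \<in> invertible" shows "lnorm L > 0" "lprod L (cnj ` L) = smul (of_real (lnorm L)) Ord"
proof -
  obtain \<alpha> n h where A: "\<alpha> \<noteq> 0" "valid n h" "L = smul \<alpha> (Mlat n h)" using assms unfolding invertible_def by blast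
  show "lnorm L > 0" unfolding A(3) lnorm_smul_Mlat[OF A(1,2)] using A(1,2) by (auto simp: valid_def)
  show "lprod L (cnj ` L) = smul (of_real (lnorm L)) Ord"
    unfolding A(3) lnorm_smul_Mlat[OF A(1,2)] by (rule lprod_cnj_eq[OF A(1,2)])
qed

lemma lnorm_lprod:
  assumes "A \<in> invertible" "B \<in> invertible" shows "lnorm (lprod A B) = lnorm A * lnorm B"
proof (rule lnorm_eqI)
  show "lnorm A * lnorm B > 0" using lnorm_G(1) assms by simp
  have "lprod (lprod A B) (cnj ` lprod A B) = lprod (lprod A (cnj ` A)) (lprod B (cnj ` B))"
    unfolding lprod_cnj by (metis lprod_assoc lprod_commute)
  also have "\<dots> = smul (of_real (lnorm A)) (smul (of_real (lnorm B)) (lprod Ord Ord))"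
    unfolding lnorm_G(2)[OF assms(1)] lnorm_G(2)[OF assms(2)] lprod_smul lprod_smul_right by (simp add: mult.commute)
  finally show "lprod (lprod A B) (cnj ` lprod A B) = smul (of_real (lnorm A * lnorm B)) Ord"
    unfolding Ord_lprod[OF Ord_invertible] smul_smul of_real_mult by (simp only: mult.commute)
qed

lemma lnorm_smul:
  assumes "L \<in> invertible" "\<alpha> \<noteq> 0" shows "lnorm (smul \<alpha> L) = (cmod \<alpha>)\<^sup>2 * lnorm L"
proof -
  obtain \<beta> n h where A: "\<beta> \<noteq> 0" "valid n h" "L = smul \<beta> (Mlat n h)" using assms unfolding invertible_def by blast
  show ?thesis using lnorm_smul_Mlat[of "\<alpha> * \<beta>" n h] lnorm_smul_Mlat[OF A(1,2)] A assms(2)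
    by (simp add: norm_mult power_mult_distrib)
qed

text \<open>Completing the square: \<open>n\<close> times the value of the form is
  \<open>(n x + h y)^2 + D y^2\<close>, the squared modulus of \<open>n (x + y tau)\<close>.\<close>

lemma cmod_lattice_point:
  assumes "n > 0" "n * k = h\<^sup>2 + D"
  shows "(cmod (of_int x + of_int y * tau n h))\<^sup>2 * of_int n = of_int (n * x\<^sup>2 + 2 * h * x * y + k * y\<^sup>2)"
proof -
  let ?z = "of_int x + of_int y * tau n h"
  have n0: "real_of_int n > 0" using assms(1) by simp
  have "of_int n * ?z = of_int (n * x) + of_int y * (of_int n * tau n h)" by (simp add: algebra_simps)
  also have "\<dots> = of_int (n * x) + of_int y * (of_int h + del)" using assms(1) by (simp only: tau_mult)
  finally have nz: "of_int n * ?z = of_int (n * x) + of_int y * (of_int h + del)" .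
  have "Re (of_int n * ?z) = n * x + y * h" "Im (of_int n * ?z) = y * sqrt D"
    unfolding nz by (simp_all add: del_def)
  then have "(cmod (of_int n * ?z))\<^sup>2 = (real_of_int (n * x + y * h))\<^sup>2 + (y * sqrt D)\<^sup>2"
    by (simp only: cmod_power2)
  also have "\<dots> = of_int ((n * x + y * h)\<^sup>2 + y\<^sup>2 * D)" using D_pos by (simp add: power_mult_distrib)
  also have "(n * x + y * h)\<^sup>2 + y\<^sup>2 * D = n * (n * x\<^sup>2 + 2 * h * x * y) + y\<^sup>2 * (h\<^sup>2 + D)"
    by (simp add: power2_eq_square algebra_simps)
  also have "\<dots> = n * (n * x\<^sup>2 + 2 * h * x * y + k * y\<^sup>2)"
    unfolding assms(2)[symmetric] by (simp add: algebra_simps)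
  finally have "(cmod (of_int n * ?z))\<^sup>2 = of_int n * of_int (n * x\<^sup>2 + 2 * h * x * y + k * y\<^sup>2)"
    by (simp only: of_int_mult)
  moreover have "(cmod (of_int n * ?z))\<^sup>2 = of_int n * ((cmod ?z)\<^sup>2 * of_int n)"
    using n0 by (simp add: norm_mult power2_eq_square)
  ultimately have "of_int n * ((cmod ?z)\<^sup>2 * of_int n) = of_int n * of_int (n * x\<^sup>2 + 2 * h * x * y + k * y\<^sup>2)"
    by (simp only:)
  then show ?thesis using n0 by (subst (asm) mult_left_cancel) auto
qed


text \<open>Gauss reduction: \<open>h\<close> is moved modulo \<open>n\<close> to \<open>j\<close>
  with \<open>|2 j| \<le> n\<close>, and the outer coefficients are swapped as long as
  \<open>k < n\<close>. At the end \<open>n^2 \<le> n k = j^2 + D \<le> n^2 / 4 + D\<close>, which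
  implies the crude bound \<open>2 * D\<close>. A swap can destroy coprimality to \<open>D\<close>,
  so \<open>valid\<close> is not part of the claim.\<close>

lemma Mlat_reduce:
  assumes "n > 0" "n dvd h\<^sup>2 + D"
  shows "\<exists>\<alpha> n' h'. \<alpha> \<noteq> 0 \<and> 0 < n' \<and> n' \<le> 2 * D \<and> 0 \<le> h' \<and> h' < n' \<and> Mlat n h = smul \<alpha> (Mlat n' h')"
  using assms
proof (induction "nat n" arbitrary: n h rule: less_induct)
  case less
  define d where "d = n div 2"
  define r where "r = (h + d) mod n"
  define j where "j = r - d"
  have jc: "[j = h] (mod n)" 
    unfolding j_def r_def cong_def mod_diff_left_eq by simp
  have "0 \<le> r" "r < n" unfolding r_def using less.prems by auto
  moreover have "2 * d \<le> n" "n \<le> 2 * d + 1" by (auto simp: d_def)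
  ultimately have "2 * j \<le> n" "- (2 * j) \<le> n" unfolding j_def by simp_all
  then have jb: "\<bar>2 * j\<bar> \<le> n" by (simp only: abs_le_iff simp_thms)
  have Mj: "Mlat n h = Mlat n j" using less.prems jc by (intro Mlat_cong) (auto simp: cong_sym_eq)
  have "[j\<^sup>2 + D = h\<^sup>2 + D] (mod n)" using jc by (intro cong_add cong_pow cong_refl)
  then have "n dvd j\<^sup>2 + D" using less.prems by (simp add: cong_dvd_iff)
  then obtain k where k: "n * k = j\<^sup>2 + D" by (metis dvdE)
  have kpos: "k > 0"
  proof -
    have "n * k > 0" unfolding k using D_pos by (simp add: add_nonneg_pos)
    then show ?thesis using less.prems by (simp add: zero_less_mult_iff)
  qed
  show ?case
  proof (cases "k < n")
    case True
    \<comment> \<open>The matrix \<open>x = 0\<close>, \<open>y = 1\<close>, \<open>u = -1\<close>,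
      \<open>v = 0\<close>, which exchanges the outer coefficients and negates the middle
      one.\<close>
    have "0 * (0::int) - 1 * (-1) = 1" by simp
    note bc = Mlat_base_change[OF less.prems(1) k this refl refl]
    have e: "n * 0\<^sup>2 + 2 * j * 0 * 1 + k * 1\<^sup>2 = k" "n * 0 * (-1) + j * (0 * 0 + 1 * (-1)) + k * 1 * 0 = - j" by auto
    have IH: "\<exists>\<alpha> n' h'. \<alpha> \<noteq> 0 \<and> 0 < n' \<and> n' \<le> 2 * D \<and> 0 \<le> h' \<and> h' < n' \<and> Mlat k (-j) = smul \<alpha> (Mlat n' h')"
      using True kpos bc(2) unfolding e by (intro less.hyps) auto
    then obtain \<alpha> n' h' where a: "\<alpha> \<noteq> 0" "0 < n'" "n' \<le> 2 * D" "0 \<le> h'" "h' < n'" "Mlat k (-j) = smul \<alpha> (Mlat n' h')"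
      by blast
    have "Mlat n h = smul ((of_int 0 + of_int 1 * tau n j) * \<alpha>) (Mlat n' h')"
      using bc(3) unfolding e Mj a(6) smul_smul .
    moreover have "(of_int 0 + of_int 1 * tau n j) * \<alpha> \<noteq> 0" using bc(4) a(1) by simp
    ultimately show ?thesis using a(2-5) by blast
  next
    case False
    have "n * n \<le> n * k" using False less.prems by (intro mult_left_mono) auto
    moreover have "4 * (j * j) \<le> n * n"
    proof -
      have "\<bar>2 * j\<bar> * \<bar>2 * j\<bar> \<le> n * n" using jb by (intro mult_mono) auto
      then show ?thesis by (simp add: abs_mult[symmetric])
    qed
    ultimately have "3 * (n * n) \<le> 4 * D" using k by (simp add: power2_eq_square)
    moreover have "n * 1 \<le> n * n" using less.prems by (intro mult_left_mono) auto
    ultimately have "n \<le> 2 * D" using D_pos by linarith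
    moreover have "Mlat n h = smul 1 (Mlat n (h mod n))"
      using less.prems by (simp, intro Mlat_cong) (auto simp: cong_def)
    moreover have "0 \<le> h mod n" "h mod n < n" using less.prems by auto
    ultimately show ?thesis using less.prems
      by (intro exI[of _ 1] exI[of _ n] exI[of _ "h mod n"]) simp
  qed
qed

section \<open>Classes, representatives, units and primitive lattice points\<close>

definition cls :: "complex set \<Rightarrow> complex set set" where
  "cls L = {smul \<alpha> L | \<alpha>. \<alpha> \<noteq> 0}"

lemma cls_self: "L \<in> cls L"
  unfolding cls_def using smul_1[of L] by (metis (mono_tags, lifting) mem_Collect_eq zero_neq_one)

lemma cls_smul: assumes "\<alpha> \<noteq> 0" shows "cls (smul \<alpha> L) = cls L"
proof -
  have "\<exists>\<gamma>. smul \<beta> L = smul \<gamma> (smul \<alpha> L) \<and> \<gamma> \<noteq> 0" if "\<beta> \<noteq> 0" for \<beta>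
    using that assms by (intro exI[of _ "\<beta> / \<alpha>"]) simp
  moreover have "\<exists>\<gamma>. smul \<beta> (smul \<alpha> L) = smul \<gamma> L \<and> \<gamma> \<noteq> 0" if "\<beta> \<noteq> 0" for \<beta>
    using that assms by (intro exI[of _ "\<beta> * \<alpha>"]) simp
  ultimately show ?thesis unfolding cls_def by blast
qed

lemma cls_eqE:
  assumes "cls A = cls B" obtains \<alpha> where "\<alpha> \<noteq> 0" "A = smul \<alpha> B"
  using cls_self[of A] unfolding assms unfolding cls_def by blast

text \<open>The underlying set of the class group; it is given no group structure of its own,
  products being formed on lattices.\<close>

definition Cl :: "complex set set set" where "Cl = cls ` invertible"

lemma finite_Cl: "finite Cl"
proof -
  define S where "S = (\<lambda>(n, h). cls (Mlat n h)) ` ({0..2 * D} \<times> {0..2 * D})"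
  have "Cl \<subseteq> S"
  proof
    fix C assume "C \<in> Cl"
    then obtain L where L: "L \<in> invertible" "C = cls L" by (auto simp: Cl_def)
    obtain \<alpha> n h where A: "\<alpha> \<noteq> 0" "valid n h" "L = smul \<alpha> (Mlat n h)" using L(1) unfolding invertible_def by blast
    have n: "n > 0" "n dvd h\<^sup>2 + D" using A(2) by (auto simp: valid_def)
    obtain \<beta> n' h' where B: "\<beta> \<noteq> 0" "0 < n'" "n' \<le> 2 * D" "0 \<le> h'" "h' < n'" "Mlat n h = smul \<beta> (Mlat n' h')"
      using Mlat_reduce[OF n] by blast
    have "C = cls (Mlat n' h')" unfolding L(2) A(3) B(6) using A(1) B(1) by (simp add: cls_smul)
    then show "C \<in> S" using B by (auto simp: S_def)
  qed
  moreover have "finite S" by (simp add: S_def)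
  ultimately show ?thesis by (rule finite_subset)
qed

text \<open>The representative is an unscaled \<open>Mlat n h\<close> with \<open>valid n h\<close>,
  so that statements about the explicit form apply to it directly.\<close>

definition rep :: "complex set set \<Rightarrow> int \<times> int" where
  "rep C = (SOME (n, h). valid n h \<and> C = cls (Mlat n h))"

definition repL :: "complex set set \<Rightarrow> complex set" where
  "repL C = Mlat (fst (rep C)) (snd (rep C))"

lemma rep:
  assumes "C \<in> Cl" shows "valid (fst (rep C)) (snd (rep C))" "cls (repL C) = C" "repL C \<in> invertible"
proof -
  obtain L where L: "L \<in> invertible" "C = cls L" using assms by (auto simp: Cl_def)
  obtain \<alpha> n h where A: "\<alpha> \<noteq> 0" "valid n h" "L = smul \<alpha> (Mlat n h)" using L(1) unfolding invertible_def by blast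
  have "case (n, h) of (n, h) \<Rightarrow> valid n h \<and> C = cls (Mlat n h)" using A L(2) by (simp add: cls_smul)
  then have "case rep C of (n, h) \<Rightarrow> valid n h \<and> C = cls (Mlat n h)"
    unfolding rep_def by (rule someI)
  then show "valid (fst (rep C)) (snd (rep C))" "cls (repL C) = C"
    by (auto simp: repL_def split: prod.splits)
  then show "repL C \<in> invertible" unfolding repL_def by (intro Mlat_invertible)
qed

lemma cls_in_Cl: "L \<in> invertible \<Longrightarrow> cls L \<in> Cl"
  by (simp add: Cl_def)

text \<open>The units of the ring \<open>Ord\<close>; by \<open>smul_eq_self_iff\<close> they are
  the self-homotheties of every invertible lattice.\<close>

definition unit_mults :: "complex set" where "unit_mults = {u. smul u Ord = Ord}"

lemma one_mem_Ord: "1 \<in> Ord" unfolding Ord_eq_Mlat by (rule one_mem_Mlat)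

lemma unit_mults_nonzero: assumes "u \<in> unit_mults" shows "u \<noteq> 0"
proof
  assume "u = 0"
  then have "1 \<in> smul 0 Ord" using assms one_mem_Ord by (simp add: unit_mults_def)
  then show False by (auto simp: smul_def)
qed

lemma smul_eq_self_iff: assumes "L \<in> invertible" shows "smul u L = L \<longleftrightarrow> u \<in> unit_mults"
proof
  assume e: "smul u L = L"
  obtain L' where L': "L' \<in> invertible" "lprod L' L = Ord" using invertible_inverse[OF assms] by blast
  have "smul u Ord = lprod L' (smul u L)" unfolding lprod_smul_right L'(2) ..
  then show "u \<in> unit_mults" using e L'(2) by (simp add: unit_mults_def)
next
  assume "u \<in> unit_mults"
  then have "lprod (smul u Ord) L = lprod Ord L" by (simp add: unit_mults_def)
  then show "smul u L = L" unfolding lprod_smul Ord_lprod[OF assms] .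
qed

lemma one_in_unit_mults: "1 \<in> unit_mults" by (simp add: unit_mults_def)

text \<open>Both \<open>u\<close> and \<open>1 / u\<close> lie in \<open>Ord\<close>, whose nonzero
  elements have modulus at least 1; so the coordinates of \<open>u\<close> satisfy
  \<open>x^2 + D y^2 \<le> 1\<close>.\<close>

lemma finite_unit_mults: "finite unit_mults"
proof -
  have "unit_mults \<subseteq> (\<lambda>(x, y). of_int x + of_int y * del) ` ({-1..1} \<times> {-1..1})"
  proof
    fix u assume u: "u \<in> unit_mults"
    have lo: "(cmod z)\<^sup>2 \<ge> 1" if z: "z \<in> Ord" "z \<noteq> 0" for z
    proof -
      obtain x y :: int where xy: "z = of_int x * 1 + of_int y * del" using z(1) unfolding Ord_def by (rule latE)
      have "Re z = x" "Im z = y * sqrt D" by (simp_all add: xy del_def)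
      then have c: "(cmod z)\<^sup>2 = of_int (x\<^sup>2 + y\<^sup>2 * D)" using D_pos by (simp add: cmod_power2 power_mult_distrib)
      moreover have "(cmod z)\<^sup>2 > 0" using z(2) by simp
      ultimately have "x\<^sup>2 + y\<^sup>2 * D > 0" by (simp only: of_int_0_less_iff)
      then have "1 \<le> x\<^sup>2 + y\<^sup>2 * D" by simp
      then show ?thesis unfolding c by (simp only: of_int_1_le_iff)
    qed
    have "u \<in> smul u Ord" using one_mem_Ord by (force simp: smul_def)
    then have uO: "u \<in> Ord" using u by (simp add: unit_mults_def)
    have "1 \<in> smul u Ord" using u one_mem_Ord by (simp add: unit_mults_def)
    then have "1 / u \<in> Ord" using mem_smul[OF unit_mults_nonzero[OF u]] by simp
    then have "(cmod (1 / u))\<^sup>2 \<ge> 1" using lo unit_mults_nonzero[OF u] by simp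
    then have u1: "(cmod u)\<^sup>2 \<le> 1" using unit_mults_nonzero[OF u] by (simp add: norm_divide power_divide)
    obtain x y :: int where xy: "u = of_int x * 1 + of_int y * del" using uO unfolding Ord_def by (rule latE)
    have "Re u = x" "Im u = y * sqrt D" by (simp_all add: xy del_def)
    then have "(cmod u)\<^sup>2 = of_int (x\<^sup>2 + y\<^sup>2 * D)" using D_pos by (simp add: cmod_power2 power_mult_distrib)
    then have b: "x\<^sup>2 + y\<^sup>2 * D \<le> 1" using u1 by (simp only: of_int_le_1_iff)
    have "y\<^sup>2 * 1 \<le> y\<^sup>2 * D" using D_pos by (intro mult_left_mono) auto
    then have "x\<^sup>2 \<le> 1" "y\<^sup>2 \<le> 1" using b zero_le_power2[of x] zero_le_power2[of y] by linarith+
    then have "\<bar>x\<bar> \<le> 1" "\<bar>y\<bar> \<le> 1" by (simp_all add: abs_square_le_1)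
    then show "u \<in> (\<lambda>(x, y). of_int x + of_int y * del) ` ({-1..1} \<times> {-1..1})"
      by (intro image_eqI[of _ _ "(x, y)"]) (auto simp: xy)
  qed
  then show ?thesis by (rule finite_subset) simp
qed

text \<open>With \<open>g\<close> the gcd of the coordinates, \<open>z / g\<close> is primitive and
  can serve as first basis vector; after base change the lattice is \<open>z / g\<close> times some
  \<open>Mlat n h\<close>. This is the classical link between representations of \<open>n\<close> by
  a form and square roots of \<open>-D\<close> modulo \<open>n\<close>.\<close>

lemma lattice_point_decompose:
  assumes "L \<in> invertible" "z \<in> L" "z \<noteq> 0"
  obtains g n h :: int where "g > 0" "n > 0" "n dvd h\<^sup>2 + D" "0 \<le> h" "h < n" 
    "L = smul (z / of_int g) (Mlat n h)" "(cmod z)\<^sup>2 / lnorm L = of_int (g\<^sup>2 * n)"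
proof -
  obtain \<beta> m j where L: "\<beta> \<noteq> 0" "valid m j" "L = smul \<beta> (Mlat m j)" using assms(1) unfolding invertible_def by blast
  have m: "m > 0" "m dvd j\<^sup>2 + D" using L(2) by (auto simp: valid_def)
  then obtain k where k: "m * k = j\<^sup>2 + D" by (metis dvdE)
  have "z / \<beta> \<in> Mlat m j" using assms(2) mem_smul[OF L(1)] L(3) by simp
  then obtain x y :: int where xy: "z / \<beta> = of_int x * 1 + of_int y * tau m j" unfolding Mlat_def by (rule latE)
  define g where "g = gcd x y"
  have "x \<noteq> 0 \<or> y \<noteq> 0" using xy assms(3) L(1) by auto
  then have g: "g > 0" by (auto simp: g_def)
  obtain x' y' where xy': "x = g * x'" "y = g * y'" unfolding g_def by (meson dvdE gcd_dvd1 gcd_dvd2)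
  have "gcd x' y' = 1"
  proof -
    have "g = gcd (g * x') (g * y')" unfolding xy'[symmetric] by (simp add: g_def)
    also have "\<dots> = g * gcd x' y'" using g by (simp add: gcd_mult_distrib_int[symmetric] abs_of_pos)
    finally show ?thesis using g by simp
  qed
  then have cop: "coprime x' y'" by (simp add: coprime_iff_gcd_eq_1)
  obtain u v where uv: "x' * v - y' * u = 1" using cop by (rule coprime_complement)
  define n where "n = m * x'\<^sup>2 + 2 * j * x' * y' + k * y'\<^sup>2"
  define h0 where "h0 = m * x' * u + j * (x' * v + y' * u) + k * y' * v"
  define w where "w = of_int x' + of_int y' * tau m j"
  note bc = Mlat_base_change[OF m(1) k uv n_def h0_def, folded w_def]
  have zw: "z = \<beta> * of_int g * w"
  proof -
    have "z / \<beta> = of_int g * w" unfolding xy xy' w_def by (simp add: distrib_left mult.assoc)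
    then show ?thesis using L(1) by (simp add: divide_eq_eq mult_ac)
  qed
  have "[h0 = h0 mod n] (mod n)" by (simp add: cong_def)
  note Mh = Mlat_cong[OF bc(1) this]
  show ?thesis
  proof (rule that[OF g bc(1)])
    have "[h0\<^sup>2 + D = (h0 mod n)\<^sup>2 + D] (mod n)" by (intro cong_add cong_pow cong_refl) (simp add: cong_def)
    then show "n dvd (h0 mod n)\<^sup>2 + D" using bc(2) by (simp add: cong_dvd_iff)
    show "0 \<le> h0 mod n" "h0 mod n < n" using bc(1) by auto
    have "z / of_int g = \<beta> * w" using g by (simp add: zw)
    then show "L = smul (z / of_int g) (Mlat n (h0 mod n))"
      using L(3) bc(3) Mh by simp
    have "(cmod w)\<^sup>2 * of_int m = of_int n"
      unfolding w_def n_def by (rule cmod_lattice_point[OF m(1) k])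
    moreover have "(cmod z)\<^sup>2 / lnorm L = (of_int g)\<^sup>2 * ((cmod w)\<^sup>2 * of_int m)"
      unfolding L(3) lnorm_smul_Mlat[OF L(1,2)] zw using L(1) m(1)
      by (simp add: norm_mult power_mult_distrib field_simps)
    ultimately show "(cmod z)\<^sup>2 / lnorm L = of_int (g\<^sup>2 * n)" by simp
  qed
qed

text \<open>Comparing imaginary parts, \<open>n\<close> and \<open>n'\<close> divide each other; the
  real parts then determine \<open>h\<close> modulo \<open>n\<close>.\<close>

lemma Mlat_inj:
  assumes "n > 0" "n' > 0" "0 \<le> h" "h < n" "0 \<le> h'" "h' < n'" "Mlat n h = Mlat n' h'"
  shows "n = n'" "h = h'"
proof -
  have mem: "\<exists>x y :: int. of_int h / of_int n = of_int x + of_int y * (real_of_int h' / of_int n') \<and> n' = y * n"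
    if "n > 0" "n' > 0" "Mlat n h = Mlat n' h'" for n n' h h'
  proof -
    have "tau n h \<in> Mlat n h" unfolding Mlat_def by (rule latI[of _ 0 _ 1]) simp
    then have "tau n h \<in> Mlat n' h'" using that by simp
    then obtain x y :: int where xy: "tau n h = of_int x * 1 + of_int y * tau n' h'" unfolding Mlat_def by (rule latE)
    have Re: "Re (tau n h) = of_int h / of_int n" and Im: "Im (tau n h) = sqrt D / of_int n" for n h
    proof -
      have "tau n h = (of_int h + del) / complex_of_real (of_int n)" by (simp add: tau_def)
      then show "Re (tau n h) = of_int h / of_int n" "Im (tau n h) = sqrt D / of_int n"
        by (simp_all only: Re_divide_of_real Im_divide_of_real) (simp_all add: del_def)
    qed
    have "Re (tau n h) = of_int x + of_int y * Re (tau n' h')" "Im (tau n h) = of_int y * Im (tau n' h')"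
      unfolding xy by simp_all
    then have 1: "of_int h / of_int n = of_int x + of_int y * (real_of_int h' / of_int n')" 
      and "sqrt D / of_int n = of_int y * (sqrt D / of_int n')" unfolding Re Im by auto
    then have "real_of_int n' = real_of_int (y * n)" using D_pos that by (simp add: field_simps)
    then have "n' = y * n" by (simp only: of_int_eq_iff)
    with 1 show ?thesis by blast
  qed
  obtain x y where xy: "of_int h / of_int n = of_int x + of_int y * (real_of_int h' / of_int n')" "n' = y * n"
    using mem[OF assms(1,2,7)] by blast
  obtain x2 y2 where xy2: "n = y2 * n'" using mem[OF assms(2,1) assms(7)[symmetric]] by blast
  have "n dvd n'" "n' dvd n" by (metis dvd_triv_right xy(2), metis dvd_triv_right xy2)
  from zdvd_antisym_nonneg[OF _ _ this] show nn: "n = n'" using assms(1,2) by simp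
  then have "y = 1" using xy(2) assms by simp
  then have "real_of_int h = real_of_int (x * n + h')" using xy(1) nn assms by (simp add: field_simps)
  then have "h = x * n + h'" by (simp only: of_int_eq_iff)
  then have "h mod n = h' mod n" by simp
  then show "h = h'" using assms nn by simp
qed

text \<open>As 1 lies in both lattices, the real number \<open>g / g'\<close> lies in
  \<open>Mlat n h\<close> and is an integer; by symmetry \<open>g = g'\<close>, and
  \<open>Mlat_inj\<close> does the rest.\<close>

lemma decompose_unique:
  fixes g g' :: int
  assumes "smul (z / of_int g) (Mlat n h) = smul (z / of_int g') (Mlat n' h')" "z \<noteq> 0" "g > 0" "g' > 0"
    "n > 0" "n' > 0" "0 \<le> h" "h < n" "0 \<le> h'" "h' < n'"
  shows "g = g'" "n = n'" "h = h'"
proof -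
  have mem: "g' dvd g" if asm: "smul (z / of_int g) (Mlat n h) = smul (z / of_int g') (Mlat n' h')" "g > 0" "g' > 0" "n > 0"
    for g g' n n' h h' :: int
  proof -
    have "z / of_int g' \<in> smul (z / of_int g) (Mlat n h)"
      unfolding asm(1) using one_mem_Mlat[of n' h'] by (force simp: smul_def)
    moreover have nz: "z / of_int g \<noteq> 0" using assms(2) asm by simp
    ultimately have "z / of_int g' / (z / of_int g) \<in> Mlat n h"
      by (simp only: mem_smul[OF nz])
    moreover have "z / of_int g' / (z / of_int g) = of_real (of_int g / of_int g')"
      using assms(2) asm by (simp add: field_simps)
    ultimately have "of_real (of_int g / of_int g') \<in> Mlat n h" by simp
    then obtain i :: int where "real_of_int g / of_int g' = of_int i" by (rule real_mem_Mlat[OF asm(4)])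
    then have "real_of_int g = real_of_int (i * g')" using asm by (simp add: field_simps)
    then have "g = i * g'" by (simp only: of_int_eq_iff)
    then show ?thesis by simp
  qed
  show gg: "g = g'"
    using zdvd_antisym_nonneg[OF _ _ mem[OF assms(1)[symmetric] assms(4,3,6)] mem[OF assms(1,3,4,5)]] assms(3,4) by simp
  have "smul (z / of_int g) (Mlat n h) = smul (z / of_int g) (Mlat n' h')" using assms(1) gg by simp
  then have "Mlat n h = Mlat n' h'" using smul_eq_iff[of "z / of_int g"] assms(2,3) by simp
  then show "n = n'" "h = h'" using Mlat_inj assms by metis+
qed

end

section \<open>Epstein sums twisted by a character\<close>

text \<open>\<open>F\<close> is a Dirichlet character modulo \<open>D\<close>, later a power of
  \<open>\<psi>\<close>, applied to values of the form; \<open>ch\<close> is a class group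
  character, given on lattices.\<close>

locale disc_chars = disc +
  fixes F :: "int \<Rightarrow> complex" and ch :: "complex set \<Rightarrow> complex"
  assumes D_6: "6 dvd D"
    and F_mult: "\<And>a b. F (a * b) = F a * F b"
    and F_mod: "\<And>a. F (a mod D) = F a"
    and F_zero: "\<And>a. \<not> coprime a D \<Longrightarrow> F a = 0"
    and F_norm: "\<And>a. coprime a D \<Longrightarrow> norm (F a) = 1"
    and ch_mult: "\<And>A B. A \<in> invertible \<Longrightarrow> B \<in> invertible \<Longrightarrow> ch (lprod A B) = ch A * ch B"
    and ch_norm: "\<And>A. A \<in> invertible \<Longrightarrow> norm (ch A) = 1"
    and ch_smul: "\<And>A \<alpha>. A \<in> invertible \<Longrightarrow> \<alpha> \<noteq> 0 \<Longrightarrow> ch (smul \<alpha> A) = ch A"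
begin

lemma F_cong: "[a = b] (mod D) \<Longrightarrow> F a = F b"
  by (metis F_mod cong_def)

lemma F_norm_le: "norm (F a) \<le> 1"
  using F_norm F_zero by (cases "coprime a D") auto

\<comment> \<open>\<open>(cmod z)\<^sup>2 / lnorm L\<close> is an integer for \<open>z \<in> L\<close>; it is the value at \<open>z\<close> of the quadratic form attached to \<open>L\<close>.\<close>
definition val :: "complex set \<Rightarrow> complex \<Rightarrow> int" where
  "val L z = \<lfloor>(cmod z)\<^sup>2 / lnorm L\<rfloor>"

definition twisted_epstein :: "complex set \<Rightarrow> real \<Rightarrow> complex" where
  "twisted_epstein L s = (\<Sum>\<^sub>\<infinity>z\<in>L - {0}. F (val L z) * of_real (of_int (val L z) powr (-s)))"

definition epstein :: "complex set \<Rightarrow> real \<Rightarrow> real" where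
  "epstein L s = (\<Sum>\<^sub>\<infinity>z\<in>L - {0}. of_int (val L z) powr (-s))"

definition point :: "int \<Rightarrow> int \<Rightarrow> int \<times> int \<Rightarrow> complex" where
  "point n h v = of_int (fst v) + of_int (snd v) * tau n h"

lemma point_0 [simp]: "point n h 0 = 0"
  by (simp add: point_def)

lemma point_bij:
  assumes "n > 0" shows "bij_betw (point n h) UNIV (Mlat n h)"
proof (rule bij_betw_imageI)
  show "inj_on (point n h) UNIV"
  proof (rule injI)
    fix v w assume eq: "point n h v = point n h w"
    have Im: "Im (point n h v) = of_int (snd v) * (sqrt D / of_int n)" for v
    proof -
      have "tau n h = (of_int h + del) / complex_of_real (of_int n)" by (simp add: tau_def)
      then have "Im (tau n h) = sqrt D / of_int n"
        by (simp only: Im_divide_of_real) (simp add: del_def)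
      then show ?thesis by (simp add: point_def)
    qed
    have "sqrt D / of_int n \<noteq> 0" using assms D_pos by simp
    then have 1: "snd v = snd w" using Im[of v] Im[of w] eq by simp
    moreover have "fst v = fst w" using eq 1 by (simp add: point_def)
    ultimately show "v = w" by (simp add: prod_eq_iff)
  qed
  show "range (point n h) = Mlat n h"
    unfolding Mlat_def lat_def point_def by (auto simp: image_iff) blast
qed

lemma point_bij_nonzero:
  assumes "n > 0" shows "bij_betw (point n h) (UNIV - {0}) (Mlat n h - {0})"
  using bij_betw_DiffI[OF point_bij[OF assms, of h], of "{0}" "{0}"] int_mem_Mlat[of 0 n h] by (simp add: bij_betw_def)

lemma pos_form_valid: "valid n h \<Longrightarrow> n * k = h\<^sup>2 + D \<Longrightarrow> pos_form n h k"
  using D_pos by unfold_locales (auto simp: valid_def)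

lemma val_point:
  assumes "valid n h" "n * k = h\<^sup>2 + D"
  shows "val (Mlat n h) (point n h v) = qv n h k v"
proof -
  have n: "n > 0" using assms(1) by (simp add: valid_def)
  have "(cmod (point n h v))\<^sup>2 / lnorm (Mlat n h) = (cmod (point n h v))\<^sup>2 * of_int n"
    using n by (simp add: lnorm_Mlat[OF assms(1)])
  also have "\<dots> = of_int (qv n h k v)"
    unfolding point_def qv_def using cmod_lattice_point[OF n assms(2), of "fst v" "snd v"] by simp
  finally show ?thesis by (simp add: val_def)
qed

lemma twisted_epstein_Mlat:
  assumes "valid n h" "n * k = h\<^sup>2 + D"
  shows "twisted_epstein (Mlat n h) s = (\<Sum>\<^sub>\<infinity>v. F (qv n h k v) * of_real (pos_form.qt n h k s v))"
proof -
  interpret pos_form n h k by (rule pos_form_valid[OF assms])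
  have "twisted_epstein (Mlat n h) s = (\<Sum>\<^sub>\<infinity>v\<in>UNIV - {0}. F (qv n h k v) * of_real (of_int (qv n h k v) powr (-s)))"
    unfolding twisted_epstein_def infsum_reindex_bij_betw[OF point_bij_nonzero[OF n_pos, of h], symmetric] val_point[OF assms] ..
  also have "\<dots> = (\<Sum>\<^sub>\<infinity>v. F (qv n h k v) * of_real (qt s v))"
    by (rule infsum_cong_neutral) (auto simp: qt_def)
  finally show ?thesis .
qed

lemma epstein_Mlat:
  assumes "valid n h" "n * k = h\<^sup>2 + D"
  shows "epstein (Mlat n h) s = (\<Sum>\<^sub>\<infinity>v. pos_form.qt n h k s v)"
proof -
  interpret pos_form n h k by (rule pos_form_valid[OF assms])
  have "epstein (Mlat n h) s = (\<Sum>\<^sub>\<infinity>v\<in>UNIV - {0}. of_int (qv n h k v) powr (-s))"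
    unfolding epstein_def infsum_reindex_bij_betw[OF point_bij_nonzero[OF n_pos, of h], symmetric] val_point[OF assms] ..
  also have "\<dots> = U s"
    by (rule infsum_cong_neutral) (auto simp: qt_def)
  finally show ?thesis .
qed

lemma twisted_epstein_summable_Mlat:
  assumes "valid n h" "s > 1"
  shows "(\<lambda>z. norm (F (val (Mlat n h) z) * of_real (of_int (val (Mlat n h) z) powr (-s)))) summable_on (Mlat n h - {0})"
proof -
  obtain k where k: "n * k = h\<^sup>2 + D" using assms(1) unfolding valid_def by (metis dvdE)
  interpret pos_form n h k by (rule pos_form_valid[OF assms(1) k])
  have "(\<lambda>v. norm (F (qv n h k v) * of_real (qt s v))) summable_on (UNIV - {0})"
    by (rule summable_on_subset[OF weighted_abs_summable[OF F_norm_le assms(2)]]) auto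
  then show ?thesis
    unfolding summable_on_reindex_bij_betw[OF point_bij_nonzero[OF n_pos, of h], symmetric] 
      val_point[OF assms(1) k] qt_def .
qed

lemma smul_bij: "\<alpha> \<noteq> 0 \<Longrightarrow> bij_betw (\<lambda>z. \<alpha> * z) (L - {0}) (smul \<alpha> L - {0})"
  by (rule bij_betwI[where g = "\<lambda>z. z / \<alpha>"]) (auto simp: mem_smul)

lemma val_smul:
  assumes "L \<in> invertible" "\<alpha> \<noteq> 0" shows "val (smul \<alpha> L) (\<alpha> * z) = val L z"
  using assms by (simp add: val_def lnorm_smul norm_mult power_mult_distrib)

lemma epstein_smul: "L \<in> invertible \<Longrightarrow> \<alpha> \<noteq> 0 \<Longrightarrow> epstein (smul \<alpha> L) s = epstein L s"
  unfolding epstein_def infsum_reindex_bij_betw[OF smul_bij, symmetric] by (simp add: val_smul)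

definition mean :: complex where "mean = (\<Sum>t\<in>{0..<D}. (F t)\<^sup>2) / of_int D"

lemma affine_residue_bij:
  assumes "coprime n D"
  shows "bij_betw (\<lambda>x. (n * x + c) mod D) {0..<D} {0..<D}"
proof -
  have "inj_on (\<lambda>x. (n * x + c) mod D) {0..<D}"
  proof (rule inj_onI)
    fix x y assume xy: "x \<in> {0..<D}" "y \<in> {0..<D}" "(n * x + c) mod D = (n * y + c) mod D"
    then have "[n * x + c = n * y + c] (mod D)" by (simp add: cong_def)
    then have "[n * x = n * y] (mod D)" by (simp add: cong_add_rcancel)
    then have "[x = y] (mod D)" using assms by (simp add: cong_mult_lcancel coprime_commute)
    then show "x = y" using xy by (auto simp: cong_def)
  qed
  moreover have "(\<lambda>x. (n * x + c) mod D) ` {0..<D} \<subseteq> {0..<D}" using D_pos by auto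
  ultimately show ?thesis by (simp add: bij_betw_def endo_inj_surj)
qed

\<comment> \<open>\<open>n q(x, y) \<equiv> (n x + h y)\<^sup>2\<close> modulo \<open>D\<close>, so the mean of \<open>F \<circ> q\<close> is that of \<open>F\<^sup>2\<close> up to a constant.\<close>
lemma F_form:
  assumes "valid n h" "n * k = h\<^sup>2 + D"
  shows "F (qv n h k (x, y)) = cnj (F n) * (F ((n * x + h * y) mod D))\<^sup>2"
proof -
  have "n * qv n h k (x, y) = (n * x + h * y)\<^sup>2 + (n * k - h\<^sup>2) * y\<^sup>2"
    by (simp add: qv_def power2_eq_square algebra_simps)
  then have "n * qv n h k (x, y) = (n * x + h * y) * (n * x + h * y) + D * y\<^sup>2"
    using assms(2) by (simp add: power2_eq_square)
  then have "[n * qv n h k (x, y) = (n * x + h * y) * (n * x + h * y)] (mod D)"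
    by (simp add: cong_def)
  then have "F (n * qv n h k (x, y)) = F ((n * x + h * y) * (n * x + h * y))" by (rule F_cong)
  then have "F n * F (qv n h k (x, y)) = (F ((n * x + h * y) mod D))\<^sup>2"
    unfolding F_mult F_mod power2_eq_square .
  moreover have "cnj (F n) * F n = 1"
  proof -
    have "norm (F n) = 1" using assms(1) by (intro F_norm) (simp add: valid_def)
    then show ?thesis by (metis complex_norm_square mult.commute of_real_1 power_one)
  qed
  ultimately show ?thesis by (metis mult.assoc mult.left_neutral)
qed

text \<open>For fixed \<open>y\<close> the map from \<open>x\<close> to \<open>n x + h y\<close>
  permutes the residues modulo \<open>D\<close>, because \<open>n\<close> is prime to
  \<open>D\<close>.\<close>

lemma F_form_sum:
  assumes "valid n h" "n * k = h\<^sup>2 + D"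
  shows "(\<Sum>r\<in>{0..<D} \<times> {0..<D}. F (qv n h k r)) / of_int (D\<^sup>2) = cnj (F n) * mean"
proof -
  have cop: "coprime n D" using assms(1) by (simp add: valid_def)
  have "(\<Sum>r\<in>{0..<D} \<times> {0..<D}. F (qv n h k r)) = (\<Sum>x\<in>{0..<D}. \<Sum>y\<in>{0..<D}. F (qv n h k (x, y)))"
    by (simp add: sum.cartesian_product)
  also have "\<dots> = (\<Sum>y\<in>{0..<D}. \<Sum>x\<in>{0..<D}. F (qv n h k (x, y)))" by (rule sum.swap)
  also have "\<dots> = (\<Sum>y\<in>{0..<D}. cnj (F n) * (\<Sum>x\<in>{0..<D}. (F ((n * x + h * y) mod D))\<^sup>2))"
    unfolding F_form[OF assms] by (simp add: sum_distrib_left)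
  also have "\<dots> = (\<Sum>y\<in>{0..<D}. cnj (F n) * (\<Sum>t\<in>{0..<D}. (F t)\<^sup>2))"
    unfolding sum.reindex_bij_betw[OF affine_residue_bij[OF cop], of "\<lambda>t. (F t)\<^sup>2"] ..
  also have "\<dots> = of_int D * (cnj (F n) * (\<Sum>t\<in>{0..<D}. (F t)\<^sup>2))"
    using D_pos by simp
  finally show ?thesis using D_pos by (simp add: mean_def power2_eq_square)
qed

lemma twisted_epstein_asymp_Mlat:
  assumes "valid n h"
  obtains C where "\<And>s. 1 < s \<Longrightarrow> s \<le> 2 \<Longrightarrow> norm (twisted_epstein (Mlat n h) s - cnj (F n) * mean * of_real (epstein (Mlat n h) s)) \<le> C"
proof -
  obtain k where k: "n * k = h\<^sup>2 + D" using assms(1) unfolding valid_def by (metis dvdE)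
  interpret pos_form n h k by (rule pos_form_valid[OF assms(1) k])
  have "F (qv n h k (x, y)) = F (qv n h k (x mod D, y mod D))" for x y
    unfolding qv_def fst_conv snd_conv
    by (intro F_cong cong_add cong_mult cong_pow cong_refl) (simp_all add: cong_def)
  then obtain C where "\<And>s. 1 < s \<Longrightarrow> s \<le> 2 \<Longrightarrow>
    norm ((\<Sum>\<^sub>\<infinity>v. F (qv n h k v) * of_real (qt s v)) - (\<Sum>r\<in>{0..<D} \<times> {0..<D}. F (qv n h k r)) / of_int (D\<^sup>2) * of_real (U s)) \<le> C"
    using qsum_mean[OF D_pos, of "\<lambda>v. F (qv n h k v)"] by blast
  then show ?thesis
    unfolding F_form_sum[OF assms k] twisted_epstein_Mlat[OF assms k, symmetric] epstein_Mlat[OF assms k, symmetric] by (rule that)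
qed

text \<open>All classes share one leading term. With \<open>I\<close> inverse to \<open>L\<close>,
  write \<open>L'\<close> as \<open>L\<close> times \<open>lprod I L'\<close> and give the second
  factor an index \<open>n0\<close> prime to \<open>n\<close>. Up to homothety the two lattices then
  have a common root \<open>j\<close> and indices \<open>n\<close> and \<open>n * n0\<close>, the
  situation of \<open>U_compare\<close>.\<close>

lemma epstein_diff_bounded:
  assumes "L \<in> invertible" "L' \<in> invertible"
  obtains C where "\<And>s. 1 < s \<Longrightarrow> s \<le> 2 \<Longrightarrow> \<bar>epstein L' s - epstein L s\<bar> \<le> C"
proof -
  obtain I where I: "I \<in> invertible" "lprod I L = Ord" using invertible_inverse[OF assms(1)] by blast
  have J: "lprod I L' \<in> invertible" using I assms by (intro lprod_invertible)
  obtain \<alpha> n h where L: "\<alpha> \<noteq> 0" "valid n h" "L = smul \<alpha> (Mlat n h)" using assms(1) unfolding invertible_def by blast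
  have n: "n > 0" using L(2) by (simp add: valid_def)
  then have "n \<noteq> 0" by simp
  then obtain \<beta> n0 h0 where B: "\<beta> \<noteq> 0" "valid n0 h0" "coprime n0 n" "lprod I L' = smul \<beta> (Mlat n0 h0)"
    using invertible_rep[OF J] by blast
  have cop: "coprime n n0" using B(3) by (simp add: coprime_commute)
  obtain j where j: "[j = h] (mod n)" "[j = h0] (mod n0)" "valid (n * n0) j"
    using common_root[OF L(2) B(2) cop] by blast
  have n0: "n0 > 0" using B(2) by (simp add: valid_def)
  have "L' = lprod L (lprod I L')"
    using I(2) Ord_lprod[OF assms(2)] by (metis lprod_assoc lprod_commute)
  also have "\<dots> = smul (\<beta> * \<alpha>) (Mlat (n * n0) j)"
    unfolding B(4) L(3) lprod_smul lprod_smul_right Mlat_mult_common[OF L(2) B(2) cop j(1,2)] by (simp add: mult.commute)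
  finally have L': "L' = smul (\<beta> * \<alpha>) (Mlat (n * n0) j)" .
  have Lj: "L = smul \<alpha> (Mlat n j)" using L(3) Mlat_cong[OF n, of j h] j(1) by simp
  have vj: "valid n j" using L(2) j(1) valid_cong by (meson cong_sym)
  obtain k where k: "n * n0 * k = j\<^sup>2 + D" using j(3) unfolding valid_def by (metis dvdE)
  then have k': "n * (k * n0) = j\<^sup>2 + D" by (simp add: mult_ac)
  obtain C where "\<And>s. 1 < s \<Longrightarrow> s \<le> 2 \<Longrightarrow>
    \<bar>(\<Sum>\<^sub>\<infinity>v. pos_form.qt (n * n0) j k s v) - (\<Sum>\<^sub>\<infinity>v. pos_form.qt n j (k * n0) s v)\<bar> \<le> C"
    using U_compare[OF pos_form_valid[OF j(3) k] pos_form_valid[OF vj k'] n0] by blast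
  moreover have "epstein L' s = (\<Sum>\<^sub>\<infinity>v. pos_form.qt (n * n0) j k s v)" for s
    unfolding L' epstein_Mlat[OF j(3) k, symmetric] using B(1) L(1) j(3) by (intro epstein_smul Mlat_invertible) auto
  moreover have "epstein L s = (\<Sum>\<^sub>\<infinity>v. pos_form.qt n j (k * n0) s v)" for s
    unfolding Lj epstein_Mlat[OF vj k', symmetric] using L(1) vj by (intro epstein_smul Mlat_invertible) auto
  ultimately show ?thesis using that[of C] by simp
qed

lemma epstein_lower:
  obtains c where "c > 0" "\<And>s. 1 < s \<Longrightarrow> s \<le> 2 \<Longrightarrow> c / (s - 1) \<le> epstein Ord s"
proof -
  have k: "1 * (D :: int) = 0\<^sup>2 + D" by simp
  interpret pos_form 1 0 D by (rule pos_form_valid[OF valid_1 k])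
  show ?thesis using U_lower that unfolding Ord_eq_Mlat epstein_Mlat[OF valid_1 k] by blast
qed

end

section \<open>Dirichlet series of class group characters\<close>

context disc_chars
begin

section \<open>Square roots of -D and the parametrization of lattice points\<close>

definition rts :: "nat \<Rightarrow> int set" where
  "rts n = {h. valid (int n) h \<and> 0 \<le> h \<and> h < int n}"

text \<open>For \<open>n\<close> prime to \<open>D\<close>, the lattices \<open>n * Mlat n h\<close>
  with \<open>h\<close> in \<open>rts n\<close> are the primitive ideals of \<open>Ord\<close> of
  norm \<open>n\<close>. The resulting series is thus that of a Hecke character restricted to
  primitive ideals.\<close>

definition coeff :: "nat \<Rightarrow> complex" where
  "coeff n = F (int n) * (\<Sum>h\<in>rts n. ch (Mlat (int n) h))"

definition lam :: "nat \<times> int \<Rightarrow> complex" where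
  "lam p = (SOME \<alpha>. \<alpha> \<noteq> 0 \<and> repL (cls (Mlat (int (fst p)) (snd p))) = smul \<alpha> (Mlat (int (fst p)) (snd p)))"

definition root_pairs :: "(nat \<times> int) set" where "root_pairs = Sigma UNIV rts"

definition coprime_nats :: "nat set" where "coprime_nats = {g. g > 0 \<and> coprime (int g) D}"

definition \<Omega> :: "(complex set set \<times> complex) set" where
  "\<Omega> = Sigma Cl (\<lambda>C. {z \<in> repL C - {0}. coprime (val (repL C) z) D})"

definition \<Psi> :: "complex \<times> nat \<times> nat \<times> int \<Rightarrow> complex set set \<times> complex" where
  "\<Psi> = (\<lambda>(u, g, p). (cls (Mlat (int (fst p)) (snd p)), u * of_nat g * lam p))"

lemma finite_rts: "finite (rts n)"
  by (rule finite_subset[of _ "{0..<int n}"]) (auto simp: rts_def)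

lemma rtsD: "h \<in> rts n \<Longrightarrow> valid (int n) h"
  by (simp add: rts_def)

lemma lam:
  assumes "valid (int n) h"
  shows "lam (n, h) \<noteq> 0" "repL (cls (Mlat (int n) h)) = smul (lam (n, h)) (Mlat (int n) h)"
proof -
  have "cls (repL (cls (Mlat (int n) h))) = cls (Mlat (int n) h)"
    using assms by (intro rep(2) cls_in_Cl Mlat_invertible)
  then have "\<exists>\<alpha>. \<alpha> \<noteq> 0 \<and> repL (cls (Mlat (int n) h)) = smul \<alpha> (Mlat (int n) h)"
    by (rule cls_eqE) blast
  from someI_ex[OF this] show "lam (n, h) \<noteq> 0" "repL (cls (Mlat (int n) h)) = smul (lam (n, h)) (Mlat (int n) h)"
    by (simp_all add: lam_def)
qed

lemma repL_unit_multiple: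
  assumes "valid (int n) h" "u \<in> unit_mults"
  shows "repL (cls (Mlat (int n) h)) = smul (u * lam (n, h)) (Mlat (int n) h)"
proof -
  have "repL (cls (Mlat (int n) h)) \<in> invertible" using assms by (intro rep(3) cls_in_Cl Mlat_invertible)
  then have "smul u (repL (cls (Mlat (int n) h))) = repL (cls (Mlat (int n) h))"
    using assms(2) by (simp add: smul_eq_self_iff)
  then show ?thesis unfolding lam(2)[OF assms(1)] by simp
qed

lemma val_\<Psi>:
  assumes "valid (int n) h" "u \<in> unit_mults"
  shows "val (repL (cls (Mlat (int n) h))) (u * of_nat g * lam (n, h)) = (int g)\<^sup>2 * int n"
proof -
  have nz: "u * lam (n, h) \<noteq> 0" using lam(1)[OF assms(1)] unit_mults_nonzero[OF assms(2)] by simp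
  have n: "int n > 0" using assms(1) by (simp add: valid_def)
  have "(cmod (u * of_nat g * lam (n, h)))\<^sup>2 / lnorm (repL (cls (Mlat (int n) h))) = of_int ((int g)\<^sup>2 * int n)"
    unfolding repL_unit_multiple[OF assms] lnorm_smul_Mlat[OF nz assms(1)] using nz n
    by (simp add: norm_mult power_mult_distrib)
  then show ?thesis unfolding val_def by (simp only: floor_of_int)
qed

\<comment> \<open>Every admissible point of a representative lattice is, in exactly one way, a unit times a positive integer times
  the generator \<open>lam (n, h)\<close> of a homothety from \<open>Mlat n h\<close>, where \<open>h\<close> is a square root of \<open>-D\<close> modulo \<open>n\<close>.\<close>
lemma \<Psi>_bij: "bij_betw \<Psi> (unit_mults \<times> coprime_nats \<times> root_pairs) \<Omega>"
proof (rule bij_betw_imageI)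
  have scaled: "repL (cls (Mlat (int n) h)) = smul (u * of_nat g * lam (n, h) / of_int (int g)) (Mlat (int n) h)"
    if "valid (int n) h" "u \<in> unit_mults" "g > 0" for n h u g
    unfolding repL_unit_multiple[OF that(1,2)] using that(3) by simp
  have nz: "u * of_nat g * lam (n, h) \<noteq> 0" if "valid (int n) h" "u \<in> unit_mults" "g > 0" for n h u and g :: nat
    using lam(1)[OF that(1)] unit_mults_nonzero[OF that(2)] that(3) by simp
  show "inj_on \<Psi> (unit_mults \<times> coprime_nats \<times> root_pairs)"
  proof (rule inj_onI)
    fix x y assume xy: "x \<in> unit_mults \<times> coprime_nats \<times> root_pairs" "y \<in> unit_mults \<times> coprime_nats \<times> root_pairs" "\<Psi> x = \<Psi> y"
    obtain u g n h where x: "x = (u, g, n, h)" by (rule prod_cases4)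
    obtain u' g' n' h' where y: "y = (u', g', n', h')" by (rule prod_cases4)
    have u: "u \<in> unit_mults" "u' \<in> unit_mults" and g: "g \<in> coprime_nats" "g' \<in> coprime_nats" and p: "(n, h) \<in> root_pairs" "(n', h') \<in> root_pairs"
      and eq: "\<Psi> (u, g, n, h) = \<Psi> (u', g', n', h')"
      using xy by (simp_all add: x y)
    have v: "valid (int n) h" "valid (int n') h'" "0 \<le> h" "h < int n" "0 \<le> h'" "h' < int n'"
      using p by (auto simp: root_pairs_def rts_def)
    have g0: "g > 0" "g' > 0" using g by (auto simp: coprime_nats_def)
    define z where "z = u * of_nat g * lam (n, h)"
    have z: "z = u' * of_nat g' * lam (n', h')" and C: "cls (Mlat (int n) h) = cls (Mlat (int n') h')"
      using eq by (auto simp: \<Psi>_def z_def)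
    have s1: "repL (cls (Mlat (int n) h)) = smul (z / of_int (int g)) (Mlat (int n) h)"
      unfolding z_def by (rule scaled[OF v(1) u(1) g0(1)])
    have s2: "repL (cls (Mlat (int n) h)) = smul (z / of_int (int g')) (Mlat (int n') h')"
      unfolding C z by (rule scaled[OF v(2) u(2) g0(2)])
    have z0: "z \<noteq> 0" unfolding z_def by (rule nz[OF v(1) u(1) g0(1)])
    have pos: "int n > 0" "int n' > 0" "int g > 0" "int g' > 0" using v g0 by (auto simp: valid_def)
    note un = decompose_unique[OF trans[OF s1[symmetric] s2] z0 pos(3,4,1,2) v(3-6)]
    have e: "g = g'" "n = n'" "h = h'" using un by simp_all
    have "u = u'" using z z0 unfolding z_def e by auto
    then show "x = y" using e by (simp add: x y)
  qed
  show "\<Psi> ` (unit_mults \<times> coprime_nats \<times> root_pairs) = \<Omega>"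
  proof (intro equalityI subsetI)
    fix x assume "x \<in> \<Psi> ` (unit_mults \<times> coprime_nats \<times> root_pairs)"
    then obtain u g n h where x: "x = \<Psi> (u, g, n, h)" "u \<in> unit_mults" "g \<in> coprime_nats" "(n, h) \<in> root_pairs" by auto
    have v: "valid (int n) h" using x(4) by (auto simp: root_pairs_def rts_def)
    have g: "g > 0" "coprime (int g) D" using x(3) by (auto simp: coprime_nats_def)
    have n: "coprime (int n) D" using v by (simp add: valid_def)
    have "u * of_nat g * lam (n, h) \<in> repL (cls (Mlat (int n) h))"
    proof -
      have "of_nat g \<in> Mlat (int n) h" using int_mem_Mlat[of "int g"] by simp
      then have "u * lam (n, h) * of_nat g \<in> smul (u * lam (n, h)) (Mlat (int n) h)" by (auto simp: smul_def)
      then show ?thesis unfolding repL_unit_multiple[OF v x(2)] by (simp add: mult_ac)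
    qed
    moreover have "coprime ((int g)\<^sup>2 * int n) D" using g n by simp
    ultimately show "x \<in> \<Omega>"
      using nz[OF v x(2) g(1)] cls_in_Cl[OF Mlat_invertible[OF v]]
      by (simp add: x(1) \<Psi>_def \<Omega>_def val_\<Psi>[OF v x(2)])
  next
    fix x assume "x \<in> \<Omega>"
    then obtain C z where x: "x = (C, z)" "C \<in> Cl" "z \<in> repL C" "z \<noteq> 0" "coprime (val (repL C) z) D"
      by (auto simp: \<Omega>_def)
    note r = rep[OF x(2)]
    obtain g n h :: int where d: "g > 0" "n > 0" "n dvd h\<^sup>2 + D" "0 \<le> h" "h < n" 
      "repL C = smul (z / of_int g) (Mlat n h)" "(cmod z)\<^sup>2 / lnorm (repL C) = of_int (g\<^sup>2 * n)"
      using lattice_point_decompose[OF r(3) x(3,4)] by blast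
    have "coprime (g\<^sup>2 * n) D" using x(5) unfolding val_def d(7) by (simp only: floor_of_int)
    then have cop: "coprime g D" "coprime n D" by auto
    have v: "valid n h" using d cop by (simp add: valid_def)
    have zg: "z / of_int g \<noteq> 0" using x(4) d(1) by simp
    have C: "C = cls (Mlat n h)" using r(2) unfolding d(6) using zg by (simp add: cls_smul)
    have v': "valid (int (nat n)) h" using v d(2) by simp
    define u where "u = z / of_int g / lam (nat n, h)"
    have l: "lam (nat n, h) \<noteq> 0" "repL C = smul (lam (nat n, h)) (Mlat n h)"
      using lam[OF v'] d(2) C by simp_all
    have "smul u (repL C) = smul (z / of_int g) (Mlat n h)"
      by (subst l(2)) (simp add: u_def l(1))
    then have "smul u (repL C) = repL C" using d(6) by simp
    then have uE: "u \<in> unit_mults" by (simp add: smul_eq_self_iff[OF r(3)])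
    have "\<Psi> (u, nat g, nat n, h) = x"
      using d(1,2) l(1) C by (simp add: \<Psi>_def x(1) u_def)
    moreover have "(u, nat g, nat n, h) \<in> unit_mults \<times> coprime_nats \<times> root_pairs"
      using uE d v cop by (simp add: coprime_nats_def root_pairs_def rts_def)
    ultimately show "x \<in> \<Psi> ` (unit_mults \<times> coprime_nats \<times> root_pairs)" by (metis image_eqI)
  qed
qed

definition lattice_term :: "real \<Rightarrow> complex set set \<times> complex \<Rightarrow> complex" where
  "lattice_term s x = ch (repL (fst x)) * (F (val (repL (fst x)) (snd x)) * of_real (of_int (val (repL (fst x)) (snd x)) powr (-s)))"

definition square_term :: "real \<Rightarrow> nat \<Rightarrow> complex" where
  "square_term s g = (F (int g))\<^sup>2 * of_real (real g powr (- 2 * s))"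

definition root_term :: "real \<Rightarrow> nat \<times> int \<Rightarrow> complex" where
  "root_term s p = F (int (fst p)) * ch (Mlat (int (fst p)) (snd p)) * of_real (real (fst p) powr (-s))"

lemma lattice_term_norm_summable:
  assumes "s > 1" shows "(\<lambda>x. norm (lattice_term s x)) summable_on \<Omega>"
  unfolding \<Omega>_def
proof (rule summable_on_SigmaI)
  fix C assume C: "C \<in> Cl"
  let ?A = "{z \<in> repL C - {0}. coprime (val (repL C) z) D}"
  have "(\<lambda>z. norm (F (val (repL C) z) * of_real (of_int (val (repL C) z) powr (-s)))) summable_on (repL C - {0})"
    unfolding repL_def by (rule twisted_epstein_summable_Mlat[OF rep(1)[OF C] assms])
  then have "(\<lambda>z. norm (F (val (repL C) z) * of_real (of_int (val (repL C) z) powr (-s)))) summable_on ?A"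
    by (rule summable_on_subset) auto
  then have "(\<lambda>z. norm (lattice_term s (C, z))) summable_on ?A"
    using ch_norm[OF rep(3)[OF C]] by (simp add: lattice_term_def norm_mult)
  then show "((\<lambda>z. norm (lattice_term s (C, z))) has_sum infsum (\<lambda>z. norm (lattice_term s (C, z))) ?A) ?A"
    by (rule has_sum_infsum)
qed (auto simp: finite_Cl)

lemma lattice_term_\<Psi>:
  assumes "(u, g, p) \<in> unit_mults \<times> coprime_nats \<times> root_pairs"
  shows "lattice_term s (\<Psi> (u, g, p)) = square_term s g * root_term s p"
proof -
  obtain n h where p: "p = (n, h)" by (cases p)
  have v: "valid (int n) h" and u: "u \<in> unit_mults" using assms by (auto simp: p root_pairs_def rts_def)
  have "ch (repL (cls (Mlat (int n) h))) = ch (Mlat (int n) h)"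
    unfolding lam(2)[OF v] by (rule ch_smul[OF Mlat_invertible[OF v] lam(1)[OF v]])
  moreover have "real_of_int ((int g)\<^sup>2 * int n) powr (-s) = real g powr (- 2 * s) * real n powr (-s)"
    by (simp add: powr_mult powr_powr flip: powr_numeral)
  ultimately show ?thesis
    unfolding p \<Psi>_def lattice_term_def prod.case fst_conv snd_conv val_\<Psi>[OF v u] square_term_def root_term_def
    by (simp add: F_mult power2_eq_square mult_ac)
qed

lemma triple_norm_summable:
  assumes "s > 1" shows "(\<lambda>(u, g, p). norm (square_term s g * root_term s p)) summable_on (unit_mults \<times> coprime_nats \<times> root_pairs)"
proof -
  have "(\<lambda>x. norm (lattice_term s (\<Psi> x))) summable_on (unit_mults \<times> coprime_nats \<times> root_pairs)"
    using lattice_term_norm_summable[OF assms] unfolding summable_on_reindex_bij_betw[OF \<Psi>_bij, of "\<lambda>x. norm (lattice_term s x)"] .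
  moreover have "norm (lattice_term s (\<Psi> x)) = (\<lambda>(u, g, p). norm (square_term s g * root_term s p)) x" if "x \<in> unit_mults \<times> coprime_nats \<times> root_pairs" for x
    using that lattice_term_\<Psi> by (cases x rule: prod_cases3) simp
  ultimately show ?thesis by (simp cong: summable_on_cong)
qed

lemma F_1: "F 1 = 1"
proof -
  have "F 1 * F 1 = F 1" using F_mult[of 1 1] by simp
  moreover have "F 1 \<noteq> 0" using F_norm[of 1] by auto
  ultimately show ?thesis by simp
qed

lemma square_term_1: "square_term s 1 = 1" by (simp add: square_term_def F_1)

lemma one_in_coprime_nats: "1 \<in> coprime_nats" by (simp add: coprime_nats_def)

text \<open>Absolute convergence is inherited from the sum over lattice points by restriction to
  \<open>u = 1\<close>, \<open>g = 1\<close>; no estimate for the number of roots modulo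
  \<open>n\<close> enters.\<close>

lemma root_term_norm_summable:
  assumes "s > 1" shows "(\<lambda>p. norm (root_term s p)) summable_on root_pairs"
proof -
  have "(\<lambda>(u, g, p). norm (square_term s g * root_term s p)) summable_on ((\<lambda>p. (1 :: complex, 1 :: nat, p)) ` root_pairs)"
    by (rule summable_on_subset[OF triple_norm_summable[OF assms]]) (use one_in_unit_mults one_in_coprime_nats in auto)
  moreover have inj: "inj_on (\<lambda>p. (1 :: complex, 1 :: nat, p)) root_pairs" by (simp add: inj_on_def)
  ultimately show ?thesis
    using summable_on_reindex[OF inj, of "\<lambda>(u, g, p). norm (square_term s g * root_term s p)"] by (simp only: o_def prod.case square_term_1) simp
qed

lemma square_term_norm_summable:
  assumes "s > 1" shows "(\<lambda>g. norm (square_term s g)) summable_on coprime_nats"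
proof (rule summable_on_comparison_test)
  have "summable (\<lambda>n. real n powr (- 2 * s))" using assms by (subst summable_real_powr_iff) auto
  then have "(\<lambda>n. real n powr (- 2 * s)) summable_on UNIV" by (intro norm_summable_imp_summable_on) simp
  then show "(\<lambda>n. real n powr (- 2 * s)) summable_on coprime_nats" by (rule summable_on_subset) auto
  show "norm (square_term s g) \<le> real g powr (- 2 * s)" for g
    using F_norm_le[of "int g"] by (simp add: square_term_def norm_mult norm_power mult_left_le_one_le power_le_one)
qed auto

definition square_sum :: "real \<Rightarrow> complex" where "square_sum s = (\<Sum>\<^sub>\<infinity>g\<in>coprime_nats. square_term s g)"

lemma root_term_inner: "(\<Sum>h\<in>rts n. root_term s (n, h)) = coeff n * of_real (real n powr (-s))"
  by (simp add: root_term_def coeff_def sum_distrib_left sum_distrib_right)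

lemma coeff_norm_summable:
  assumes "s > 1" shows "(\<lambda>n. norm (coeff n) * real n powr (-s)) summable_on UNIV"
proof (rule summable_on_comparison_test)
  have "(\<lambda>n. \<Sum>\<^sub>\<infinity>h\<in>rts n. norm (root_term s (n, h))) summable_on UNIV"
    using root_term_norm_summable[OF assms] unfolding root_pairs_def
    by (rule summable_on_SigmaD) (simp add: finite_rts)
  then show "(\<lambda>n. \<Sum>h\<in>rts n. norm (root_term s (n, h))) summable_on UNIV" by (simp add: finite_rts)
  show "norm (coeff n) * real n powr (-s) \<le> (\<Sum>h\<in>rts n. norm (root_term s (n, h)))" for n
  proof -
    have "norm (coeff n) * real n powr (-s) = norm (coeff n * of_real (real n powr (-s)))" by (simp add: norm_mult)
    also have "\<dots> \<le> (\<Sum>h\<in>rts n. norm (root_term s (n, h)))" unfolding root_term_inner[symmetric] by (rule norm_sum)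
    finally show ?thesis .
  qed
qed auto

lemma root_term_sum:
  assumes "s > 1" shows "(\<Sum>\<^sub>\<infinity>p\<in>root_pairs. root_term s p) = (\<Sum>\<^sub>\<infinity>n. coeff n * of_real (real n powr (-s)))"
proof -
  have "root_term s summable_on root_pairs" by (rule abs_summable_summable) (rule root_term_norm_summable[OF assms])
  then have "(\<Sum>\<^sub>\<infinity>p\<in>root_pairs. root_term s p) = (\<Sum>\<^sub>\<infinity>n. \<Sum>\<^sub>\<infinity>h\<in>rts n. root_term s (n, h))"
    unfolding root_pairs_def by (subst infsum_Sigma'_banach) (auto simp: case_prod_unfold)
  then show ?thesis by (simp add: finite_rts root_term_inner)
qed

definition class_dseries :: "real \<Rightarrow> complex" where "class_dseries s = (\<Sum>\<^sub>\<infinity>n. coeff n * of_real (real n powr (-s)))"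

text \<open>Reindexed by \<open>\<Psi>\<close>, a point has the value \<open>g^2 n\<close>, and its
  term splits into a part in \<open>g\<close> and a part in \<open>(n, h)\<close>, independent of
  the unit. This carries estimates for lattice sums over to a series with an Euler product.\<close>

theorem class_sum_identity:
  assumes "s > 1"
  shows "(\<Sum>C\<in>Cl. ch (repL C) * twisted_epstein (repL C) s) = of_nat (card unit_mults) * square_sum s * class_dseries s"
proof -
  have wsum: "lattice_term s summable_on \<Omega>" by (rule abs_summable_summable) (rule lattice_term_norm_summable[OF assms])
  have absum: "(\<lambda>(u, g, p). square_term s g * root_term s p) summable_on (unit_mults \<times> coprime_nats \<times> root_pairs)"
    by (rule abs_summable_summable) (use triple_norm_summable[OF assms] in \<open>simp add: case_prod_unfold\<close>)
  have absum2: "(\<lambda>(g, p). square_term s g * root_term s p) summable_on (coprime_nats \<times> root_pairs)"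
  proof -
    have "(\<lambda>(u, g, p). square_term s g * root_term s p) summable_on (Pair (1 :: complex) ` (coprime_nats \<times> root_pairs))"
      by (rule summable_on_subset[OF absum]) (auto simp: one_in_unit_mults)
    moreover have inj: "inj_on (Pair (1 :: complex)) (coprime_nats \<times> root_pairs)" by (simp add: inj_on_def)
    ultimately show ?thesis
      using summable_on_reindex[OF inj, of "\<lambda>(u, g, p). square_term s g * root_term s p"] by (simp add: o_def)
  qed
  have inner: "(\<Sum>\<^sub>\<infinity>z\<in>{z \<in> repL C - {0}. coprime (val (repL C) z) D}. lattice_term s (C, z)) = ch (repL C) * twisted_epstein (repL C) s" for C
  proof -
    have "(\<Sum>\<^sub>\<infinity>z\<in>{z \<in> repL C - {0}. coprime (val (repL C) z) D}. lattice_term s (C, z)) = (\<Sum>\<^sub>\<infinity>z\<in>repL C - {0}. lattice_term s (C, z))"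
      by (rule infsum_cong_neutral) (auto simp: lattice_term_def F_zero)
    then show ?thesis by (simp add: lattice_term_def twisted_epstein_def infsum_cmult_right')
  qed
  have "(\<Sum>C\<in>Cl. ch (repL C) * twisted_epstein (repL C) s) = 
      (\<Sum>\<^sub>\<infinity>C\<in>Cl. \<Sum>\<^sub>\<infinity>z\<in>{z \<in> repL C - {0}. coprime (val (repL C) z) D}. lattice_term s (C, z))"
    by (simp only: inner) (simp add: finite_Cl)
  also have "\<dots> = (\<Sum>\<^sub>\<infinity>x\<in>\<Omega>. lattice_term s x)"
    using wsum unfolding \<Omega>_def by (subst infsum_Sigma'_banach) (auto simp: case_prod_unfold)
  also have "\<dots> = (\<Sum>\<^sub>\<infinity>x\<in>unit_mults \<times> coprime_nats \<times> root_pairs. lattice_term s (\<Psi> x))"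
    by (rule infsum_reindex_bij_betw[OF \<Psi>_bij, symmetric])
  also have "\<dots> = (\<Sum>\<^sub>\<infinity>(u, g, p)\<in>unit_mults \<times> coprime_nats \<times> root_pairs. square_term s g * root_term s p)"
  proof (rule infsum_cong)
    fix x assume "x \<in> unit_mults \<times> coprime_nats \<times> root_pairs"
    then show "lattice_term s (\<Psi> x) = (case x of (u, g, p) \<Rightarrow> square_term s g * root_term s p)"
      using lattice_term_\<Psi> by (cases x rule: prod_cases3) simp
  qed
  also have "\<dots> = (\<Sum>\<^sub>\<infinity>u\<in>unit_mults. \<Sum>\<^sub>\<infinity>(g, p)\<in>coprime_nats \<times> root_pairs. square_term s g * root_term s p)"
    using absum by (subst infsum_Sigma'_banach) (auto simp: case_prod_unfold)
  also have "\<dots> = of_nat (card unit_mults) * (\<Sum>\<^sub>\<infinity>(g, p)\<in>coprime_nats \<times> root_pairs. square_term s g * root_term s p)"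
    by (simp add: finite_unit_mults)
  also have "(\<Sum>\<^sub>\<infinity>(g, p)\<in>coprime_nats \<times> root_pairs. square_term s g * root_term s p) = (\<Sum>\<^sub>\<infinity>g\<in>coprime_nats. \<Sum>\<^sub>\<infinity>p\<in>root_pairs. square_term s g * root_term s p)"
    using absum2 by (subst infsum_Sigma'_banach) (auto simp: case_prod_unfold)
  also have "\<dots> = square_sum s * class_dseries s"
    by (simp add: infsum_cmult_right' infsum_cmult_left' square_sum_def class_dseries_def root_term_sum[OF assms])
  finally show ?thesis by (simp add: mult.assoc)
qed


section \<open>Multiplicativity and size of the coefficients\<close>

lemma ch_Ord: "ch Ord = 1"
proof -
  have "ch Ord * ch Ord = ch Ord" using ch_mult[OF Ord_invertible Ord_invertible] Ord_lprod[OF Ord_invertible] by simp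
  moreover have "ch Ord \<noteq> 0" using ch_norm[OF Ord_invertible] by auto
  ultimately show ?thesis by simp
qed

lemma rts_1: "rts 1 = {0}"
  by (auto simp: rts_def valid_def)

lemma rts_mult_bij:
  fixes a b :: nat
  assumes "coprime a b" "a > 0" "b > 0"
  shows "bij_betw (\<lambda>h. (h mod int a, h mod int b)) (rts (a * b)) (rts a \<times> rts b)"
proof (rule bij_betw_imageI)
  have cop: "coprime (int a) (int b)" using assms(1) by simp
  show "inj_on (\<lambda>h. (h mod int a, h mod int b)) (rts (a * b))"
  proof (rule inj_onI)
    fix h h' assume h: "h \<in> rts (a * b)" "h' \<in> rts (a * b)" "(h mod int a, h mod int b) = (h' mod int a, h' mod int b)"
    then have "[h = h'] (mod int a)" "[h = h'] (mod int b)" by (auto simp: cong_def)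
    then have "[h = h'] (mod int a * int b)" using cop by (simp add: coprime_cong_mult)
    then show "h = h'" using h(1,2) by (auto simp: rts_def cong_def)
  qed
  show "(\<lambda>h. (h mod int a, h mod int b)) ` rts (a * b) = rts a \<times> rts b"
  proof (intro equalityI subsetI)
    fix x assume "x \<in> (\<lambda>h. (h mod int a, h mod int b)) ` rts (a * b)"
    then obtain h where h: "h \<in> rts (a * b)" "x = (h mod int a, h mod int b)" by blast
    have "valid (int a * int b) h" using h(1) by (simp add: rts_def)
    then have "valid (int a) h" "valid (int b) h"
      using assms by (auto simp: valid_def elim: dvd_mult_left dvd_mult_right)
    then have "valid (int a) (h mod int a)" "valid (int b) (h mod int b)"
      by (auto elim!: valid_cong simp: cong_def)
    then show "x \<in> rts a \<times> rts b" using assms by (simp add: h(2) rts_def)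
  next
    fix x assume "x \<in> rts a \<times> rts b"
    then obtain i j where x: "x = (i, j)" "i \<in> rts a" "j \<in> rts b" by blast
    obtain h where h: "[h = i] (mod int a)" "[h = j] (mod int b)" "valid (int a * int b) h"
      using common_root[OF rtsD[OF x(2)] rtsD[OF x(3)] cop] by blast
    define h' where "h' = h mod (int a * int b)"
    have h': "h' \<in> rts (a * b)"
    proof -
      have "valid (int a * int b) h'" using h(3) by (rule valid_cong) (simp add: h'_def cong_def)
      then show ?thesis using assms by (simp add: rts_def h'_def)
    qed
    have "h' mod int a = i" "h' mod int b = j"
      using h(1,2) x(2,3) by (simp_all add: h'_def cong_def rts_def mod_mult2_eq mod_mod_cancel)
    then show "x \<in> (\<lambda>h. (h mod int a, h mod int b)) ` rts (a * b)" using h' x(1) by force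
  qed
qed

text \<open>The Chinese remainder theorem for the roots matches the product of lattices with a
  common root.\<close>

lemma coeff_mult:
  fixes a b :: nat
  assumes "coprime a b" shows "coeff (a * b) = coeff a * coeff b"
proof (cases "a = 0 \<or> b = 0")
  case True
  have "coeff 0 = 0" by (simp add: coeff_def rts_def valid_def)
  then show ?thesis using True by auto
next
  case False
  then have pos: "a > 0" "b > 0" by auto
  have cop: "coprime (int a) (int b)" using assms by simp
  have "ch (Mlat (int a * int b) h) = ch (Mlat (int a) (h mod int a)) * ch (Mlat (int b) (h mod int b))"
    if "h \<in> rts (a * b)" for h
  proof -
    have "(h mod int a, h mod int b) \<in> rts a \<times> rts b"
      using that rts_mult_bij[OF assms pos] by (auto simp: bij_betw_def)
    then have v: "valid (int a) (h mod int a)" "valid (int b) (h mod int b)" by (auto dest: rtsD)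
    have "lprod (Mlat (int a) (h mod int a)) (Mlat (int b) (h mod int b)) = Mlat (int a * int b) h"
      by (rule Mlat_mult_common[OF v cop]) (simp_all add: cong_def)
    then show ?thesis using ch_mult[OF Mlat_invertible[OF v(1)] Mlat_invertible[OF v(2)]] by simp
  qed
  then have "(\<Sum>h\<in>rts (a * b). ch (Mlat (int (a * b)) h)) = 
      (\<Sum>h\<in>rts (a * b). case (h mod int a, h mod int b) of (i, j) \<Rightarrow> ch (Mlat (int a) i) * ch (Mlat (int b) j))"
    by simp
  also have "\<dots> = (\<Sum>(i, j)\<in>rts a \<times> rts b. ch (Mlat (int a) i) * ch (Mlat (int b) j))"
    by (rule sum.reindex_bij_betw[OF rts_mult_bij[OF assms pos]])
  also have "\<dots> = (\<Sum>i\<in>rts a. ch (Mlat (int a) i)) * (\<Sum>j\<in>rts b. ch (Mlat (int b) j))"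
    by (simp add: sum_product sum.cartesian_product)
  finally show ?thesis by (simp add: coeff_def F_mult mult_ac)
qed

text \<open>Validity makes \<open>p\<close> prime to \<open>2 h0\<close>, so \<open>p\<close> cannot
  divide both \<open>h - h0\<close> and \<open>h + h0\<close>; the full power of \<open>p\<close>
  then divides one of them.\<close>

lemma card_rts_prime_power:
  assumes p: "prime p" "e > 0" shows "card (rts (p ^ e)) \<le> 2"
proof (cases "rts (p ^ e) = {}")
  case False
  then obtain h0 where h0: "h0 \<in> rts (p ^ e)" by blast
  let ?P = "int p ^ e"
  have P: "int (p ^ e) = ?P" by simp
  have pp: "prime (int p)" using p(1) by simp
  have v0: "valid ?P h0" using h0 unfolding rts_def by simp
  have "rts (p ^ e) \<subseteq> {h0, (- h0) mod ?P}"
  proof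
    fix h assume h: "h \<in> rts (p ^ e)"
    have v: "valid ?P h" using h unfolding rts_def by simp
    have "?P dvd (h\<^sup>2 + D) - (h0\<^sup>2 + D)" using v v0 unfolding valid_def by (intro dvd_diff) auto
    then have d: "?P dvd (h - h0) * (h + h0)" by (simp add: power2_eq_square algebra_simps)
    have range: "0 \<le> h" "h < ?P" "0 \<le> h0" "h0 < ?P" using h h0 by (auto simp: rts_def)
    have "\<not> int p dvd h - h0 \<or> \<not> int p dvd h + h0"
    proof (rule ccontr)
      assume "\<not> ?thesis"
      then have "int p dvd h - h0" "int p dvd h + h0" by blast+
      then have "int p dvd (h + h0) - (h - h0)" using dvd_diff by blast
      then have "int p dvd 2 * h0" by simp
      moreover have "int p dvd ?P" using p(2) by simp
      ultimately have "is_unit (int p)" using coprime_common_divisor[OF valid_coprime_2h[OF v0]] by blast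
      then show False using pp by (simp add: not_prime_unit)
    qed
    then consider "coprime ?P (h - h0)" | "coprime ?P (h + h0)"
      using prime_imp_coprime[OF pp] by auto
    then show "h \<in> {h0, (- h0) mod ?P}"
    proof cases
      case 1
      then have "?P dvd h + h0" using d by (simp add: coprime_dvd_mult_right_iff)
      then have "[h = - h0] (mod ?P)" by (simp add: cong_iff_dvd_diff)
      then have "h = (- h0) mod ?P" using range by (simp add: cong_def)
      then show ?thesis by simp
    next
      case 2
      then have "?P dvd h - h0" using d by (simp add: coprime_dvd_mult_left_iff)
      then have "[h = h0] (mod ?P)" by (simp add: cong_iff_dvd_diff)
      then show ?thesis using range by (simp add: cong_def)
    qed
  qed
  then have "card (rts (p ^ e)) \<le> card {h0, (- h0) mod ?P}" by (intro card_mono) auto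
  also have "\<dots> \<le> 2" by (simp add: card_insert_if)
  finally show ?thesis .
qed simp

lemma coeff_norm_le: "norm (coeff n) \<le> real (card (rts n))"
proof -
  have "norm (coeff n) \<le> 1 * norm (\<Sum>h\<in>rts n. ch (Mlat (int n) h))"
    unfolding coeff_def norm_mult by (intro mult_right_mono F_norm_le) auto
  also have "\<dots> \<le> (\<Sum>h\<in>rts n. norm (ch (Mlat (int n) h)))" by (simp add: norm_sum)
  also have "\<dots> = real (card (rts n))" using ch_norm Mlat_invertible rtsD by simp
  finally show ?thesis .
qed

lemma coeff_1: "coeff 1 = 1"
  using ch_Ord by (simp add: coeff_def rts_1[simplified] F_1 Ord_eq_Mlat)

lemma coeff_mult_dirichlet: "mult_dirichlet coeff"
proof
  show "coeff 0 = 0" by (simp add: coeff_def rts_def valid_def)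
  show "coeff 1 = 1" by (rule coeff_1)
  show "coeff (a * b) = coeff a * coeff b" if "coprime a b" for a b :: nat by (rule coeff_mult[OF that])
  show "norm (coeff (p ^ e)) \<le> 2" if "prime p" for p e
  proof (cases "e = 0")
    case True
    then show ?thesis using coeff_1 by simp
  next
    case False
    then show ?thesis using coeff_norm_le[of "p ^ e"] card_rts_prime_power[OF that, of e] by simp
  qed
  show "coeff (p ^ e) = 0" if p: "prime p" "p < 5" "e > 0" for p e
  proof -
    have "p \<in> {0, 1, 2, 3, 4}" using p(2) by auto
    moreover have "\<not> prime (4 :: nat)" using prime_nat_iff[of 4] by (auto intro!: exI[of _ 2])
    ultimately have "p = 2 \<or> p = 3" using p(1) by auto
    then have "int p dvd D" using D_6 dvd_trans[of _ 6 D] by auto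
    moreover have "int p dvd int (p ^ e)" using p(3) by simp
    moreover have "\<not> is_unit (int p)" using prime_gt_1_nat[OF p(1)] by simp
    ultimately have "\<not> coprime (int (p ^ e)) D" by (meson coprime_common_divisor)
    then have "F (int (p ^ e)) = 0" by (rule F_zero)
    then show ?thesis by (simp only: coeff_def mult_zero_left)
  qed
  show "(\<lambda>n. norm (coeff n) * real n powr (-s)) summable_on UNIV" if "s > 1" for s
    by (rule coeff_norm_summable[OF that])
qed

lemma class_dseries_eq: "mult_dirichlet.L coeff s = class_dseries s"
  unfolding class_dseries_def mult_dirichlet.L_def[OF coeff_mult_dirichlet] mult_dirichlet.g_def[OF coeff_mult_dirichlet] ..

lemma inverse_square_sum_bound: "N \<ge> 4 \<Longrightarrow> (\<Sum>g=5..N. 1 / (real g)\<^sup>2) \<le> 1 / 4 - 1 / real N"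
proof (induction N rule: nat_induct_at_least)
  case (Suc n)
  have "1 / (real (Suc n))\<^sup>2 \<le> 1 / (real n * real (Suc n))"
    using Suc by (intro divide_left_mono) (auto simp: power2_eq_square)
  also have "\<dots> = 1 / real n - 1 / real (Suc n)" using Suc by (simp add: field_simps)
  finally show ?case using Suc by (simp add: sum.atLeast_Suc_atMost_Suc_shift)
qed simp

text \<open>As 6 divides \<open>D\<close>, the terms after \<open>g = 1\<close> begin at
  \<open>g = 5\<close>, where the remaining inverse squares add up to at most 1/4. So the factor
  stays away from 0 as \<open>s\<close> tends to 1.\<close>

lemma square_sum_bound:
  assumes "s > 1" shows "3 / 4 \<le> norm (square_sum s)" "norm (square_sum s) \<le> 5 / 4"
proof -
  have ns: "(\<lambda>g. norm (square_term s g)) summable_on A" if "A \<subseteq> coprime_nats" for A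
    by (rule summable_on_subset[OF square_term_norm_summable[OF assms] that])
  have sm: "square_term s summable_on A" if "A \<subseteq> coprime_nats" for A
    by (rule abs_summable_summable) (rule ns[OF that])
  have "coprime_nats = {1} \<union> (coprime_nats - {1})" using one_in_coprime_nats by auto
  then have "square_sum s = (\<Sum>\<^sub>\<infinity>g\<in>{1} \<union> (coprime_nats - {1}). square_term s g)" by (simp add: square_sum_def)
  also have "\<dots> = (\<Sum>\<^sub>\<infinity>g\<in>{1}. square_term s g) + (\<Sum>\<^sub>\<infinity>g\<in>coprime_nats - {1}. square_term s g)"
    by (intro infsum_Un_disjoint sm) (auto simp: one_in_coprime_nats[simplified])
  finally have square_sum: "square_sum s = 1 + (\<Sum>\<^sub>\<infinity>g\<in>coprime_nats - {1}. square_term s g)" using square_term_1[of s] by simp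
  have "norm (\<Sum>\<^sub>\<infinity>g\<in>coprime_nats - {1}. square_term s g) \<le> (\<Sum>\<^sub>\<infinity>g\<in>coprime_nats - {1}. norm (square_term s g))"
    by (rule norm_infsum_bound) (rule ns, auto)
  also have "\<dots> \<le> 1 / 4"
  proof (rule infsum_le_finite_sums)
    show "(\<lambda>g. norm (square_term s g)) summable_on coprime_nats - {1}" by (rule ns) auto
    fix A assume A: "finite A" "A \<subseteq> coprime_nats - {1}"
    define N where "N = Max (insert 4 A)"
    have ge5: "5 \<le> g" if "g \<in> A" for g
    proof (rule ccontr)
      assume "\<not> 5 \<le> g"
      then have "g \<in> {0, 1, 2, 3, 4}" by auto
      moreover have g: "g > 0" "coprime (int g) D" "g \<noteq> 1" using that A(2) by (auto simp: coprime_nats_def)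
      ultimately have "g = 2 \<or> g = 3 \<or> g = 4" by auto
      then obtain q :: int where q: "q dvd int g" "q dvd 6" "\<not> is_unit q"
        by (auto intro: that[of 2] that[of 3])
      then show False using g(2) D_6 by (meson coprime_common_divisor dvd_trans)
    qed
    have sub: "A \<subseteq> {5..N}" using ge5 A(1) by (auto simp: N_def)
    have "(\<Sum>g\<in>A. norm (square_term s g)) \<le> (\<Sum>g\<in>A. 1 / (real g)\<^sup>2)"
    proof (rule sum_mono)
      fix g assume g: "g \<in> A"
      have "norm (square_term s g) \<le> real g powr (- 2 * s)"
        using F_norm_le[of "int g"] by (simp add: square_term_def norm_mult norm_power mult_left_le_one_le power_le_one)
      also have "\<dots> \<le> real g powr (-2)" using assms ge5[OF g] by (intro powr_mono) auto
      finally show "norm (square_term s g) \<le> 1 / (real g)\<^sup>2" using ge5[OF g] by (simp add: powr_minus divide_inverse)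
    qed
    also have "\<dots> \<le> (\<Sum>g=5..N. 1 / (real g)\<^sup>2)" using sub by (intro sum_mono2) auto
    also have "\<dots> \<le> 1 / 4 - 1 / real N" using A(1) by (intro inverse_square_sum_bound) (simp add: N_def)
    also have "\<dots> \<le> 1 / 4" by simp
    finally show "(\<Sum>g\<in>A. norm (square_term s g)) \<le> 1 / 4" .
  qed
  finally have r: "norm (\<Sum>\<^sub>\<infinity>g\<in>coprime_nats - {1}. square_term s g) \<le> 1 / 4" .
  show "3 / 4 \<le> norm (square_sum s)" using norm_diff_ineq[of 1 "\<Sum>\<^sub>\<infinity>g\<in>coprime_nats - {1}. square_term s g"] r by (simp add: square_sum)
  show "norm (square_sum s) \<le> 5 / 4" using norm_triangle_ineq[of 1 "\<Sum>\<^sub>\<infinity>g\<in>coprime_nats - {1}. square_term s g"] r by (simp add: square_sum)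
qed

section \<open>The class series near s = 1\<close>

lemma card_unit_mults: "card unit_mults > 0"
  using finite_unit_mults one_in_unit_mults by (auto simp: card_gt_0_iff)

lemma class_dseries_bounded:
  assumes "\<And>s. 1 < s \<Longrightarrow> s \<le> 2 \<Longrightarrow> norm (\<Sum>C\<in>Cl. ch (repL C) * twisted_epstein (repL C) s) \<le> M"
  shows "1 < s \<Longrightarrow> s \<le> 2 \<Longrightarrow> norm (class_dseries s) \<le> 2 * M"
proof -
  assume s: "1 < s" "s \<le> 2"
  \<comment> \<open>At least one unit and a square factor of at least 3/4; the 2 in the conclusion
    rounds up 4/3.\<close>
  have e: "1 * (3/4) \<le> real (card unit_mults) * norm (square_sum s)" using square_sum_bound(1)[OF s(1)] card_unit_mults by (intro mult_mono) auto
  have "(1 * (3/4)) * norm (class_dseries s) \<le> real (card unit_mults) * norm (square_sum s) * norm (class_dseries s)" by (intro mult_right_mono e) auto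
  also have "\<dots> = norm (\<Sum>C\<in>Cl. ch (repL C) * twisted_epstein (repL C) s)"
    unfolding class_sum_identity[OF s(1)] by (simp add: norm_mult)
  also have "\<dots> \<le> M" by (rule assms[OF s])
  finally show "norm (class_dseries s) \<le> 2 * M" using norm_ge_zero[of "class_dseries s"] by linarith
qed

lemma class_sum_bounded:
  fixes R :: "complex set set \<Rightarrow> real \<Rightarrow> complex"
  assumes "\<And>C. C \<in> Cl \<Longrightarrow> \<exists>K. \<forall>s. 1 < s \<longrightarrow> s \<le> 2 \<longrightarrow> norm (R C s) \<le> (K :: real)"
  obtains M where "\<And>s. 1 < s \<Longrightarrow> s \<le> 2 \<Longrightarrow> norm (\<Sum>C\<in>Cl. ch (repL C) * R C s) \<le> M"
proof -
  have "\<forall>C\<in>Cl. \<exists>K. \<forall>s. 1 < s \<longrightarrow> s \<le> 2 \<longrightarrow> norm (R C s) \<le> (K :: real)" using assms by blast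
  then obtain K where K: "\<forall>C\<in>Cl. \<forall>s. 1 < s \<longrightarrow> s \<le> 2 \<longrightarrow> norm (R C s) \<le> K C"
    using bchoice[of Cl] by metis
  show ?thesis
  proof (rule that)
    fix s :: real assume s: "1 < s" "s \<le> 2"
    show "norm (\<Sum>C\<in>Cl. ch (repL C) * R C s) \<le> (\<Sum>C\<in>Cl. K C)"
    proof (rule sum_norm_le)
      fix C assume C: "C \<in> Cl"
      then show "norm (ch (repL C) * R C s) \<le> K C"
        using K s ch_norm[OF rep(3)[OF C]] by (simp add: norm_mult)
    qed
  qed
qed

text \<open>Here the leading term cancels within each class separately, whatever \<open>ch\<close>
  is.\<close>

theorem class_dseries_bounded_mean_zero:
  assumes "mean = 0"
  obtains M where "\<And>s. 1 < s \<Longrightarrow> s \<le> 2 \<Longrightarrow> norm (class_dseries s) \<le> M"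
proof -
  have "\<exists>K. \<forall>s. 1 < s \<longrightarrow> s \<le> 2 \<longrightarrow> norm (twisted_epstein (repL C) s) \<le> K" if "C \<in> Cl" for C
    using twisted_epstein_asymp_Mlat[OF rep(1)[OF that]] unfolding repL_def[symmetric] assms by (simp, metis)
  then obtain M where "\<And>s. 1 < s \<Longrightarrow> s \<le> 2 \<Longrightarrow> norm (\<Sum>C\<in>Cl. ch (repL C) * twisted_epstein (repL C) s) \<le> M"
    using class_sum_bounded[of "\<lambda>C s. twisted_epstein (repL C) s"] by blast
  then show ?thesis using that class_dseries_bounded by blast
qed

text \<open>For principal \<open>F\<close> every class has the leading term
  \<open>mean * epstein Ord s\<close> up to a bounded error; it factors out and leaves the sum of
  \<open>ch\<close> over the classes.\<close>

lemma class_sum_asymp: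
  assumes "\<And>x. coprime x D \<Longrightarrow> F x = 1"
  obtains M where "\<And>s. 1 < s \<Longrightarrow> s \<le> 2 \<Longrightarrow>
    norm ((\<Sum>C\<in>Cl. ch (repL C) * twisted_epstein (repL C) s) - (\<Sum>C\<in>Cl. ch (repL C)) * (mean * of_real (epstein Ord s))) \<le> M"
proof -
  have "\<exists>K. \<forall>s. 1 < s \<longrightarrow> s \<le> 2 \<longrightarrow> norm (twisted_epstein (repL C) s - mean * of_real (epstein Ord s)) \<le> K" if C: "C \<in> Cl" for C
  proof -
    have "F (fst (rep C)) = 1" using rep(1)[OF C] by (intro assms) (simp add: valid_def)
    then obtain K where K: "\<And>s. 1 < s \<Longrightarrow> s \<le> 2 \<Longrightarrow> norm (twisted_epstein (repL C) s - mean * of_real (epstein (repL C) s)) \<le> K"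
      using twisted_epstein_asymp_Mlat[OF rep(1)[OF C]] unfolding repL_def[symmetric] by (simp, metis)
    obtain K' where K': "\<And>s. 1 < s \<Longrightarrow> s \<le> 2 \<Longrightarrow> \<bar>epstein (repL C) s - epstein Ord s\<bar> \<le> K'"
      using epstein_diff_bounded[OF Ord_invertible rep(3)[OF C]] by blast
    have "norm (twisted_epstein (repL C) s - mean * of_real (epstein Ord s)) \<le> K + norm mean * K'" if s: "1 < s" "s \<le> 2" for s
    proof -
      have "twisted_epstein (repL C) s - mean * of_real (epstein Ord s) 
          = (twisted_epstein (repL C) s - mean * of_real (epstein (repL C) s)) + mean * of_real (epstein (repL C) s - epstein Ord s)"
        by (simp add: right_diff_distrib)
      also have "norm \<dots> \<le> norm (twisted_epstein (repL C) s - mean * of_real (epstein (repL C) s)) + norm mean * \<bar>epstein (repL C) s - epstein Ord s\<bar>"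
        by (rule order.trans[OF norm_triangle_ineq]) (simp only: norm_mult norm_of_real order.refl)
      also have "\<dots> \<le> K + norm mean * K'" using K[OF s] K'[OF s] by (intro add_mono mult_left_mono) auto
      finally show ?thesis .
    qed
    then show ?thesis by blast
  qed
  then obtain M where M: "\<And>s. 1 < s \<Longrightarrow> s \<le> 2 \<Longrightarrow>
    norm (\<Sum>C\<in>Cl. ch (repL C) * (twisted_epstein (repL C) s - mean * of_real (epstein Ord s))) \<le> M"
    using class_sum_bounded[of "\<lambda>C s. twisted_epstein (repL C) s - mean * of_real (epstein Ord s)"] by blast
  show ?thesis
    by (rule that[of M]) (use M in \<open>simp add: right_diff_distrib sum_subtractf sum_distrib_right\<close>)
qed

lemma ch_cls: assumes "L \<in> invertible" shows "ch (repL (cls L)) = ch L"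
proof -
  have "cls (repL (cls L)) = cls L" using assms by (intro rep(2) cls_in_Cl)
  then obtain \<alpha> where "\<alpha> \<noteq> 0" "repL (cls L) = smul \<alpha> L" by (rule cls_eqE)
  then show ?thesis using ch_smul[OF assms] by simp
qed

text \<open>Orthogonality: multiplication by \<open>A\<close> permutes the classes and multiplies
  the sum by \<open>ch A\<close>.\<close>

lemma sum_ch_zero:
  assumes A: "A \<in> invertible" "ch A \<noteq> 1" shows "(\<Sum>C\<in>Cl. ch (repL C)) = 0"
proof -
  define \<phi> where "\<phi> C = cls (lprod A (repL C))" for C
  have in_G: "lprod A (repL C) \<in> invertible" if "C \<in> Cl" for C using A(1) rep(3)[OF that] by (rule lprod_invertible)
  have maps: "\<phi> ` Cl \<subseteq> Cl" using in_G cls_in_Cl by (auto simp: \<phi>_def)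
  have "inj_on \<phi> Cl"
  proof (rule inj_onI)
    fix C C' assume C: "C \<in> Cl" "C' \<in> Cl" "\<phi> C = \<phi> C'"
    obtain \<alpha> where \<alpha>: "\<alpha> \<noteq> 0" "lprod A (repL C) = smul \<alpha> (lprod A (repL C'))"
      using C(3) unfolding \<phi>_def by (rule cls_eqE)
    obtain I where I: "I \<in> invertible" "lprod I A = Ord" using invertible_inverse[OF A(1)] by blast
    have "lprod I (lprod A (repL C)) = smul \<alpha> (lprod I (lprod A (repL C')))"
      unfolding \<alpha>(2) lprod_smul_right ..
    then have "repL C = smul \<alpha> (repL C')"
      unfolding lprod_assoc[symmetric] I(2) Ord_lprod[OF rep(3)[OF C(1)]] Ord_lprod[OF rep(3)[OF C(2)]] .
    then have "cls (repL C) = cls (repL C')" using \<alpha>(1) by (simp add: cls_smul)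
    then show "C = C'" using rep(2) C by simp
  qed
  then have bij: "bij_betw \<phi> Cl Cl" using endo_inj_surj[OF finite_Cl maps] by (simp add: bij_betw_def)
  have "(\<Sum>C\<in>Cl. ch (repL C)) = (\<Sum>C\<in>Cl. ch (repL (\<phi> C)))"
    by (rule sum.reindex_bij_betw[OF bij, symmetric])
  also have "\<dots> = (\<Sum>C\<in>Cl. ch A * ch (repL C))"
    using in_G ch_mult[OF A(1) rep(3)] by (intro sum.cong) (simp_all add: \<phi>_def ch_cls)
  also have "\<dots> = ch A * (\<Sum>C\<in>Cl. ch (repL C))" by (simp only: sum_distrib_left)
  finally have "(\<Sum>C\<in>Cl. ch (repL C)) = ch A * (\<Sum>C\<in>Cl. ch (repL C))" .
  then show ?thesis using A(2) by simp
qed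

theorem class_dseries_bounded_nontrivial:
  assumes "\<And>x. coprime x D \<Longrightarrow> F x = 1" "A \<in> invertible" "ch A \<noteq> 1"
  obtains M where "\<And>s. 1 < s \<Longrightarrow> s \<le> 2 \<Longrightarrow> norm (class_dseries s) \<le> M"
proof -
  obtain M where M: "\<And>s. 1 < s \<Longrightarrow> s \<le> 2 \<Longrightarrow>
    norm ((\<Sum>C\<in>Cl. ch (repL C) * twisted_epstein (repL C) s) - (\<Sum>C\<in>Cl. ch (repL C)) * (mean * of_real (epstein Ord s))) \<le> M"
    using class_sum_asymp assms(1) by blast
  then have "\<And>s. 1 < s \<Longrightarrow> s \<le> 2 \<Longrightarrow> norm (\<Sum>C\<in>Cl. ch (repL C) * twisted_epstein (repL C) s) \<le> M"
    unfolding sum_ch_zero[OF assms(2,3)] by simp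
  then show ?thesis using that class_dseries_bounded by blast
qed

theorem class_dseries_lower_trivial:
  assumes "\<And>x. coprime x D \<Longrightarrow> F x = 1" "\<And>A. A \<in> invertible \<Longrightarrow> ch A = 1"
  obtains c M where "c > 0" "\<And>s. 1 < s \<Longrightarrow> s \<le> 2 \<Longrightarrow> c / (s - 1) - M \<le> norm (class_dseries s)"
proof -
  obtain M where M: "\<And>s. 1 < s \<Longrightarrow> s \<le> 2 \<Longrightarrow>
    norm ((\<Sum>C\<in>Cl. ch (repL C) * twisted_epstein (repL C) s) - (\<Sum>C\<in>Cl. ch (repL C)) * (mean * of_real (epstein Ord s))) \<le> M"
    using class_sum_asymp assms(1) by blast
  obtain c where c: "c > 0" "\<And>s. 1 < s \<Longrightarrow> s \<le> 2 \<Longrightarrow> c / (s - 1) \<le> epstein Ord s"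
    using epstein_lower by blast
  have card: "(\<Sum>C\<in>Cl. ch (repL C)) = of_nat (card Cl)" using assms(2) rep(3) by simp
  have "card Cl > 0" using finite_Cl cls_in_Cl[OF Ord_invertible] by (auto simp: card_gt_0_iff)
  then have card1: "real (card Cl) \<ge> 1" by simp
  \<comment> \<open>The mean is the proportion of residues prime to \<open>D\<close>, and 1 is such
    a residue.\<close>
  have mean: "norm mean \<ge> 1 / of_int D"
  proof -
    have F01: "F t = of_bool (coprime t D)" for t using assms(1) F_zero by simp
    have "(\<Sum>t\<in>{0..<D}. (F t)\<^sup>2) = of_nat (card ({0..<D} \<inter> {t. coprime t D}))"
      unfolding F01 by (simp add: power2_eq_square)
    moreover have "1 \<in> {0..<D} \<inter> {t. coprime t D}" using D_6 D_pos zdvd_imp_le[of 6 D] by simp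
    then have "card ({0..<D} \<inter> {t. coprime t D}) > 0" by (metis card_gt_0_iff empty_iff finite_Int finite_atLeastLessThan_int)
    ultimately show ?thesis using D_pos by (simp add: mean_def norm_divide divide_right_mono)
  qed
  define B where "B = real (card unit_mults) * (5 / 4)"
  have B: "B > 0" using card_unit_mults by (simp add: B_def)
  show ?thesis
  proof (rule that)
    show "c / of_int D / B > 0" using c(1) D_pos B by simp
    fix s :: real assume s: "1 < s" "s \<le> 2"
    have U: "epstein Ord s \<ge> c / (s - 1)" "c / (s - 1) > 0" using c s by auto
    have "1 * (1 / of_int D * (c / (s - 1))) \<le> real (card Cl) * (norm mean * \<bar>epstein Ord s\<bar>)"
      using card1 mean U D_pos c(1) s by (intro mult_mono) auto
    also have "\<dots> = norm ((\<Sum>C\<in>Cl. ch (repL C)) * (mean * of_real (epstein Ord s)))"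
      unfolding card by (simp add: norm_mult)
    also have "\<dots> \<le> norm (\<Sum>C\<in>Cl. ch (repL C) * twisted_epstein (repL C) s) + M"
      using M[OF s] norm_triangle_ineq2[of "(\<Sum>C\<in>Cl. ch (repL C)) * (mean * of_real (epstein Ord s))" "\<Sum>C\<in>Cl. ch (repL C) * twisted_epstein (repL C) s"]
      by (simp add: norm_minus_commute)
    also have "norm (\<Sum>C\<in>Cl. ch (repL C) * twisted_epstein (repL C) s) = real (card unit_mults) * norm (square_sum s) * norm (class_dseries s)"
      unfolding class_sum_identity[OF s(1)] by (simp add: norm_mult)
    also have "\<dots> \<le> B * norm (class_dseries s)"
      unfolding B_def using square_sum_bound(2)[OF s(1)] by (intro mult_right_mono mult_left_mono) auto
    finally have "c / of_int D / (s - 1) - M \<le> norm (class_dseries s) * B" by (simp add: field_simps)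
    then have "(c / of_int D / (s - 1) - M) / B \<le> norm (class_dseries s)" using B by (simp add: pos_divide_le_eq)
    then show "c / of_int D / B / (s - 1) - M / B \<le> norm (class_dseries s)"
      by (simp add: diff_divide_distrib mult_ac)
  qed
qed

end

section \<open>Prime sums and Dirichlet characters\<close>

text \<open>Discrete logarithm to a primitive root, followed by a root of unity of exact order
  \<open>totient l\<close>. Faithfulness is the point: it makes -1 the only residue at which the
  value is -1.\<close>

lemma faithful_character_exists:
  fixes l :: nat
  assumes l: "prime l" "l > 2"
  obtains \<psi> :: "int \<Rightarrow> complex" where "\<And>a b. \<psi> (a * b) = \<psi> a * \<psi> b" "\<And>a b. [a = b] (mod int l) \<Longrightarrow> \<psi> a = \<psi> b"
    "\<And>a. int l dvd a \<Longrightarrow> \<psi> a = 0" "\<And>a. \<not> int l dvd a \<Longrightarrow> norm (\<psi> a) = 1"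
    "\<And>a b. \<not> int l dvd a \<Longrightarrow> \<not> int l dvd b \<Longrightarrow> \<psi> a = \<psi> b \<Longrightarrow> [a = b] (mod int l)"
proof -
  define m where "m = totient l"
  have "odd l" using l by (simp add: prime_odd_nat)
  then have "l ^ 1 \<in> {p ^ k |p k. prime p \<and> odd p \<and> k > 0}" using l(1) zero_less_one by blast
  then have "l \<in> cyclic_moduli" by (simp add: cyclic_moduli_def)
  then obtain g where g: "residue_primroot l g" using residue_primroot_iff_in_cyclic_moduli by blast
  have cop: "coprime l g" and ord: "ord l g = m" using g by (auto simp: residue_primroot_def m_def)
  have m: "m \<ge> 1" using l by (simp add: m_def Suc_leI totient_gt_0_iff)
  have bij: "bij_betw (\<lambda>i. g ^ i mod l) {..<m} (totatives l)"
    unfolding m_def using l g by (intro residue_primroot_is_generator) auto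
  have "\<exists>i. [int (g ^ i) = a] (mod int l)" if "\<not> int l dvd a" for a
  proof -
    define r where "r = nat (a mod int l)"
    have ra: "int r = a mod int l" using l by (simp add: r_def)
    have "int l > 0" using l by simp
    then have "0 \<le> a mod int l" "a mod int l < int l" by simp_all
    moreover have "a mod int l \<noteq> 0" using that by (simp add: dvd_eq_mod_eq_0)
    ultimately have "0 < a mod int l" "a mod int l < int l" by simp_all
    then have "0 < r" "r < l" using ra by auto
    then have "r \<in> totatives l" using l by (auto simp: totatives_prime)
    then obtain i where "r = g ^ i mod l" using bij unfolding bij_betw_def by blast
    then have "int (g ^ i) mod int l = a mod int l" using ra by (simp add: zmod_int)
    then show ?thesis by (auto simp: cong_def)
  qed
  then obtain ind where ind: "\<And>a. \<not> int l dvd a \<Longrightarrow> [int (g ^ ind a) = a] (mod int l)" by metis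
  have pow: "i mod m = j mod m \<longleftrightarrow> [int (g ^ i) = int (g ^ j)] (mod int l)" for i j
    using order_divides_expdiff[OF cop, of i j] unfolding ord cong_int_iff by (simp add: cong_def)
  define e where "e i = exp (2 * of_real pi * \<i> * of_nat i / of_nat m)" for i :: nat
  have e_eq: "e i = e j \<longleftrightarrow> [int (g ^ i) = int (g ^ j)] (mod int l)" for i j
    unfolding e_def pow[symmetric] by (rule complex_root_unity_eq[OF m])
  have e_add: "e (i + j) = e i * e j" for i j
    by (simp add: e_def exp_add[symmetric] add_divide_distrib distrib_left)
  define \<psi> where "\<psi> a = (if int l dvd a then 0 else e (ind a))" for a
  have pl: "prime (int l)" using l by simp
  show ?thesis
  proof (rule that[of \<psi>])
    fix a b :: int
    show "\<psi> (a * b) = \<psi> a * \<psi> b"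
    proof (cases "int l dvd a \<or> int l dvd b")
      case False
      then have ab: "\<not> int l dvd a * b" using pl by (simp add: prime_dvd_mult_iff)
      have "[int (g ^ (ind a + ind b)) = a * b] (mod int l)"
        using ind[of a] ind[of b] False by (simp add: power_add cong_mult)
      then have "e (ind (a * b)) = e (ind a + ind b)"
        unfolding e_eq using ind[OF ab] by (metis cong_sym cong_trans)
      then show ?thesis using ab False by (simp add: \<psi>_def e_add)
    qed (auto simp: \<psi>_def)
  next
    fix a b :: int assume ab: "[a = b] (mod int l)"
    then have d: "int l dvd a \<longleftrightarrow> int l dvd b" by (rule cong_dvd_iff)
    show "\<psi> a = \<psi> b"
    proof (cases "int l dvd a")
      case False
      then have "[int (g ^ ind a) = int (g ^ ind b)] (mod int l)"
        using ind[of a] ind[of b] d ab by (metis cong_sym cong_trans)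
      then show ?thesis using False d by (simp add: \<psi>_def e_eq)
    qed (use d in \<open>simp add: \<psi>_def\<close>)
  next
    fix a b :: int assume ab: "\<not> int l dvd a" "\<not> int l dvd b" "\<psi> a = \<psi> b"
    then have "[int (g ^ ind a) = int (g ^ ind b)] (mod int l)" by (simp add: \<psi>_def e_eq)
    then show "[a = b] (mod int l)" using ind[OF ab(1)] ind[OF ab(2)] by (metis cong_sym cong_trans)
  next
    fix a :: int assume "\<not> int l dvd a"
    moreover have "e i = cis (2 * pi * i / m)" for i by (simp add: e_def cis_conv_exp mult_ac)
    ultimately show "norm (\<psi> a) = 1" by (simp add: \<psi>_def)
  qed (simp add: \<psi>_def)
qed

section \<open>Prime sums with bounded weights\<close>

definition psum :: "(nat \<Rightarrow> real) \<Rightarrow> real \<Rightarrow> real" where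
  "psum \<phi> s = (\<Sum>\<^sub>\<infinity>p\<in>{p. prime p}. \<phi> p * real p powr (-s))"

definition prime_bounded :: "(nat \<Rightarrow> real) \<Rightarrow> bool" where
  "prime_bounded \<phi> \<longleftrightarrow> (\<exists>B. \<forall>p. prime p \<longrightarrow> \<bar>\<phi> p\<bar> \<le> B)"

lemma prime_boundedI: "(\<And>p. prime p \<Longrightarrow> \<bar>\<phi> p\<bar> \<le> B) \<Longrightarrow> prime_bounded \<phi>"
  unfolding prime_bounded_def by blast

lemma psum_summable:
  assumes "prime_bounded \<phi>" "s > 1"
  shows "(\<lambda>p. \<phi> p * real p powr (-s)) summable_on {p. prime p}"
proof -
  obtain B where B: "\<And>p. prime p \<Longrightarrow> \<bar>\<phi> p\<bar> \<le> B" using assms(1) unfolding prime_bounded_def by blast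
  have "summable (\<lambda>n. real n powr (-s))" using assms(2) by (subst summable_real_powr_iff) auto
  then have "(\<lambda>n. real n powr (-s)) summable_on UNIV" by (intro norm_summable_imp_summable_on) simp
  then have "(\<lambda>n. real n powr (-s)) summable_on {p. prime p}" by (rule summable_on_subset) auto
  then have S: "(\<lambda>n. B * real n powr (-s)) summable_on {p. prime p}" by (rule summable_on_cmult_right)
  have "(\<lambda>p. norm (\<phi> p * real p powr (-s))) summable_on {p. prime p}"
    by (rule summable_on_comparison_test[OF S]) (use B in \<open>auto simp: abs_mult intro!: mult_right_mono\<close>)
  then show ?thesis by (rule abs_summable_summable)
qed

lemma psum_mono:
  assumes "prime_bounded \<phi>" "prime_bounded \<theta>" "s > 1" "\<And>p. prime p \<Longrightarrow> \<phi> p \<le> \<theta> p"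
  shows "psum \<phi> s \<le> psum \<theta> s"
  unfolding psum_def using assms
  by (intro infsum_mono psum_summable mult_right_mono) auto

lemma prime_bounded_lin:
  assumes "prime_bounded \<phi>" "prime_bounded \<theta>"
  shows "prime_bounded (\<lambda>p. c * \<phi> p + d * \<theta> p)"
proof -
  obtain B C where B: "\<And>p. prime p \<Longrightarrow> \<bar>\<phi> p\<bar> \<le> B" and C: "\<And>p. prime p \<Longrightarrow> \<bar>\<theta> p\<bar> \<le> C"
    using assms unfolding prime_bounded_def by blast
  show ?thesis
  proof (rule prime_boundedI)
    fix p :: nat assume p: "prime p"
    have "\<bar>c * \<phi> p + d * \<theta> p\<bar> \<le> \<bar>c\<bar> * \<bar>\<phi> p\<bar> + \<bar>d\<bar> * \<bar>\<theta> p\<bar>"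
      by (rule order.trans[OF abs_triangle_ineq]) (simp add: abs_mult)
    also have "\<dots> \<le> \<bar>c\<bar> * B + \<bar>d\<bar> * C" using B[OF p] C[OF p] by (intro add_mono mult_left_mono) auto
    finally show "\<bar>c * \<phi> p + d * \<theta> p\<bar> \<le> \<bar>c\<bar> * B + \<bar>d\<bar> * C" .
  qed
qed

lemma psum_lin:
  assumes "prime_bounded \<phi>" "prime_bounded \<theta>" "s > 1"
  shows "psum (\<lambda>p. c * \<phi> p + d * \<theta> p) s = c * psum \<phi> s + d * psum \<theta> s"
proof -
  have "psum (\<lambda>p. c * \<phi> p + d * \<theta> p) s 
      = (\<Sum>\<^sub>\<infinity>p\<in>{p. prime p}. c * (\<phi> p * real p powr (-s)) + d * (\<theta> p * real p powr (-s)))"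
    unfolding psum_def by (simp add: distrib_right mult.assoc)
  also have "\<dots> = (\<Sum>\<^sub>\<infinity>p\<in>{p. prime p}. c * (\<phi> p * real p powr (-s))) + (\<Sum>\<^sub>\<infinity>p\<in>{p. prime p}. d * (\<theta> p * real p powr (-s)))"
    by (intro infsum_add summable_on_cmult_right psum_summable assms)
  finally show ?thesis by (simp add: psum_def infsum_cmult_right')
qed

context mult_dirichlet
begin

lemma P_eq_psum: "P s = psum (\<lambda>p. Re (f p)) s"
  by (simp add: P_def psum_def)

lemma prime_bounded_f: "prime_bounded (\<lambda>p. Re (f p))"
proof (rule prime_boundedI)
  fix p :: nat assume "prime p"
  then show "\<bar>Re (f p)\<bar> \<le> 2" using f_bound[of p 1] abs_Re_le_cmod[of "f p"] by simp
qed

lemma psum_upper: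
  assumes "norm (L s) \<le> M" "1 < s" "s \<le> 2"
  shows "psum (\<lambda>p. Re (f p)) s \<le> ln M + K"
proof -
  have e: "exp (P s - K) \<le> M" using euler_bound(2)[OF assms(2,3)] assms(1) by linarith
  moreover from this have "M > 0" using exp_gt_zero[of "P s - K"] by linarith
  ultimately have "P s - K \<le> ln M" by (simp add: ln_ge_iff)
  then show ?thesis by (simp add: P_eq_psum)
qed

lemma psum_lower:
  assumes "m \<le> norm (L s)" "0 < m" "1 < s" "s \<le> 2"
  shows "ln m - K \<le> psum (\<lambda>p. Re (f p)) s"
proof -
  have "m \<le> exp (P s + K)" using euler_bound(1)[OF assms(3,4)] assms(1) by linarith
  then have "ln m \<le> P s + K" using assms(2) by (metis ln_exp ln_mono exp_gt_zero)
  then show ?thesis by (simp add: P_eq_psum)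
qed

end

text \<open>Ordinary Dirichlet series, used for the characters modulo 5. Deleting the multiples of 2
  and 3, as \<open>f6\<close> does, makes the bounds of \<open>mult_dirichlet\<close>
  applicable.\<close>

locale comp_mult =
  fixes F :: "nat \<Rightarrow> complex"
  assumes F_1: "F 1 = 1" and F_mult: "\<And>a b. F (a * b) = F a * F b" and F_le: "\<And>n. norm (F n) \<le> 1"
begin

definition f6 :: "nat \<Rightarrow> complex" where "f6 n = (if n > 0 \<and> \<not> 2 dvd n \<and> \<not> 3 dvd n then F n else 0)"

definition DS :: "(nat \<Rightarrow> bool) \<Rightarrow> real \<Rightarrow> complex" where
  "DS Q s = (\<Sum>\<^sub>\<infinity>n\<in>{n. Q n}. F n * of_real (real n powr (-s)))"

lemma term_summable:
  assumes "s > 1" shows "(\<lambda>n. norm (F n * of_real (real n powr (-s)))) summable_on A"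
proof -
  have "summable (\<lambda>n. real n powr (-s))" using assms by (subst summable_real_powr_iff) auto
  then have "(\<lambda>n. real n powr (-s)) summable_on UNIV" by (intro norm_summable_imp_summable_on) simp
  then have "(\<lambda>n. real n powr (-s)) summable_on A" by (rule summable_on_subset) auto
  then show ?thesis
    by (rule summable_on_comparison_test) (auto simp: norm_mult F_le mult_left_le_one_le)
qed

lemma term_summable': "s > 1 \<Longrightarrow> (\<lambda>n. F n * of_real (real n powr (-s))) summable_on A"
  by (rule abs_summable_summable) (rule term_summable)

text \<open>Multiplication by \<open>q\<close> maps the index set onto its multiples of
  \<open>q\<close>, and complete multiplicativity pulls out the factor at \<open>q\<close>.\<close>

lemma remove_prime:
  assumes "s > 1" "q > 0" "\<And>n. Q (q * n) \<longleftrightarrow> Q n"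
  shows "DS (\<lambda>n. Q n \<and> \<not> q dvd n) s = (1 - F q * of_real (real q powr (-s))) * DS Q s"
proof -
  let ?t = "\<lambda>n. F n * complex_of_real (real n powr (-s))"
  have inj: "inj_on ((*) q) {n. Q n}" using assms(2) by (simp add: inj_on_def)
  have img: "(*) q ` {n. Q n} = {n. Q n \<and> q dvd n}" using assms(3) by (auto elim!: dvdE)
  have "infsum ?t {n. Q n \<and> q dvd n} = infsum (\<lambda>n. ?t (q * n)) {n. Q n}"
    unfolding img[symmetric] infsum_reindex[OF inj] o_def ..
  also have "\<dots> = F q * of_real (real q powr (-s)) * DS Q s"
    unfolding DS_def by (simp add: F_mult powr_mult infsum_cmult_right'[symmetric] mult_ac)
  finally have d: "infsum ?t {n. Q n \<and> q dvd n} = F q * of_real (real q powr (-s)) * DS Q s" .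
  have "{n. Q n} = {n. Q n \<and> \<not> q dvd n} \<union> {n. Q n \<and> q dvd n}" by auto
  then have "DS Q s = infsum ?t ({n. Q n \<and> \<not> q dvd n} \<union> {n. Q n \<and> q dvd n})"
    unfolding DS_def by (rule arg_cong)
  also have "\<dots> = infsum ?t {n. Q n \<and> \<not> q dvd n} + infsum ?t {n. Q n \<and> q dvd n}"
    by (rule infsum_Un_disjoint[OF term_summable' term_summable']) (use assms(1) in auto)
  finally have "DS (\<lambda>n. Q n \<and> \<not> q dvd n) s + F q * of_real (real q powr (-s)) * DS Q s = DS Q s"
    unfolding d DS_def[of "\<lambda>n. Q n \<and> \<not> q dvd n"] by (rule sym)
  then show ?thesis by (simp only: left_diff_distrib mult_1_left eq_diff_eq)
qed

lemma f6_mult_dirichlet: "mult_dirichlet f6"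
proof
  show "f6 0 = 0" "f6 1 = 1" using F_1 by (auto simp: f6_def)
  show "f6 (a * b) = f6 a * f6 b" if "coprime a b" for a b
  proof -
    have "prime (2::nat)" "prime (3::nat)" by simp_all
    then show ?thesis by (auto simp: f6_def F_mult prime_dvd_mult_iff)
  qed
  show "norm (f6 (p ^ e)) \<le> 2" for p e
    using F_le[of "p ^ e"] by (simp add: f6_def)
  show "f6 (p ^ e) = 0" if p: "prime p" "p < 5" "e > 0" for p e
  proof -
    have "p \<in> {0, 1, 2, 3, 4}" using p(2) by auto
    moreover have "\<not> prime (4 :: nat)" using prime_nat_iff[of 4] by (auto intro!: exI[of _ 2])
    ultimately have "p = 2 \<or> p = 3" using p(1) by auto
    then show ?thesis using p(3) by (auto simp: f6_def)
  qed
  show "(\<lambda>n. norm (f6 n) * real n powr (-s)) summable_on UNIV" if "s > 1" for s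
    by (rule summable_on_comparison_test[OF term_summable[OF that, of UNIV]])
       (auto simp: f6_def norm_mult)
qed

lemma L_f6:
  assumes "s > 1"
  shows "mult_dirichlet.L f6 s = (1 - F 3 * of_real (3 powr (-s))) * ((1 - F 2 * of_real (2 powr (-s))) * DS (\<lambda>n. n > 0) s)"
proof -
  have 1: "DS (\<lambda>n. n > 0 \<and> \<not> 2 dvd n) s = (1 - F 2 * of_real (2 powr (-s))) * DS (\<lambda>n. n > 0) s"
    using remove_prime[OF assms, of 2 "\<lambda>n. n > 0"] by simp
  have "prime (3::nat)" "\<not> (2::nat) dvd 3" "prime (2::nat)" by simp_all
  then have 2: "DS (\<lambda>n. (n > 0 \<and> \<not> 2 dvd n) \<and> \<not> 3 dvd n) s = (1 - F 3 * of_real (3 powr (-s))) * DS (\<lambda>n. n > 0 \<and> \<not> 2 dvd n) s"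
    using remove_prime[OF assms, of 3 "\<lambda>n. n > 0 \<and> \<not> 2 dvd n"] by (simp add: prime_dvd_mult_iff)
  have "mult_dirichlet.L f6 s = DS (\<lambda>n. (n > 0 \<and> \<not> 2 dvd n) \<and> \<not> 3 dvd n) s"
    unfolding mult_dirichlet.L_def[OF f6_mult_dirichlet] mult_dirichlet.g_def[OF f6_mult_dirichlet] DS_def
    by (rule infsum_cong_neutral) (auto simp: f6_def)
  then show ?thesis unfolding 2 1 .
qed

text \<open>The factors at 2 and 3 have modulus between 1/2 and 2, because
  \<open>q powr (-s) \<le> 1/2\<close>.\<close>

lemma L_f6_bounds:
  assumes "s > 1"
  shows "norm (mult_dirichlet.L f6 s) \<le> 4 * norm (DS (\<lambda>n. n > 0) s)" 
    "norm (DS (\<lambda>n. n > 0) s) / 4 \<le> norm (mult_dirichlet.L f6 s)"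
proof -
  have f: "1 / 2 \<le> norm (1 - F q * of_real (real q powr (-s)))" "norm (1 - F q * of_real (real q powr (-s))) \<le> 2" if "q \<ge> 2" for q
  proof -
    have "real q powr (-s) \<le> real q powr (-1)" using that assms by (intro powr_mono) auto
    also have "\<dots> \<le> 1 / 2" using that by (simp add: powr_minus divide_simps)
    finally have h: "real q powr (-s) \<le> 1 / 2" .
    have "norm (F q * of_real (real q powr (-s))) \<le> 1 * (1 / 2)"
      unfolding norm_mult using F_le[of q] h by (intro mult_mono) auto
    then show "1 / 2 \<le> norm (1 - F q * of_real (real q powr (-s)))" "norm (1 - F q * of_real (real q powr (-s))) \<le> 2"
      using norm_triangle_ineq2[of 1 "F q * of_real (real q powr (-s))"] 
        norm_triangle_ineq4[of 1 "F q * of_real (real q powr (-s))"] by auto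
  qed
  let ?A = "norm (1 - F 3 * of_real (3 powr (-s)))" and ?B = "norm (1 - F 2 * of_real (2 powr (-s)))" 
    and ?X = "norm (DS (\<lambda>n. n > 0) s)"
  have A: "1 / 2 \<le> ?A" "?A \<le> 2" using f[of 3] by auto
  have B: "1 / 2 \<le> ?B" "?B \<le> 2" using f[of 2] by auto
  have L: "norm (mult_dirichlet.L f6 s) = ?A * ?B * ?X" unfolding L_f6[OF assms] by (simp add: norm_mult)
  have "?A * ?B \<le> 2 * 2" using A B by (intro mult_mono) auto
  then show "norm (mult_dirichlet.L f6 s) \<le> 4 * ?X" unfolding L by (intro mult_right_mono) auto
  have "(1 / 2) * (1 / 2) \<le> ?A * ?B" using A B by (intro mult_mono) auto
  then have "(1 / 2) * (1 / 2) * ?X \<le> ?A * ?B * ?X" by (intro mult_right_mono) auto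
  then show "?X / 4 \<le> norm (mult_dirichlet.L f6 s)" unfolding L by simp
qed

lemma DS_sums:
  assumes "s > 1"
  shows "(\<lambda>n. F n * of_real (real n powr (-s))) sums DS (\<lambda>n. n > 0) s"
proof -
  have "DS (\<lambda>n. n > 0) s = (\<Sum>\<^sub>\<infinity>n. F n * of_real (real n powr (-s)))"
    unfolding DS_def by (rule infsum_cong_neutral) auto
  then show ?thesis using term_summable'[OF assms, of UNIV] by (metis has_sum_imp_sums has_sum_infsum)
qed

end

text \<open>Integral comparison by telescoping. The terms at 0 and 1 are split off first; the one at
  0 is 0 by the convention for \<open>powr\<close>.\<close>

lemma zeta_sums_upper:
  fixes s S :: real
  assumes "1 < s" "s \<le> 2" "(\<lambda>n. real n powr (-s)) sums S"
  shows "S \<le> 2 / (s - 1)"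
proof -
  define u where "u n = real (Suc n) powr (1 - s) / (s - 1)" for n
  have "(\<lambda>n. real (n + 2) powr (-s)) sums (S - (\<Sum>i<2. real i powr (-s)))"
    by (rule sums_split_initial_segment[OF assms(3)])
  then have 1: "(\<lambda>n. real (n + 2) powr (-s)) sums (S - 1)" by (simp add: numeral_2_eq_2)
  have "(\<lambda>n. real (Suc n) powr (1 - s) / (s - 1)) \<longlonglongrightarrow> 0 / (s - 1)"
    using assms by (intro tendsto_intros tendsto_neg_powr filterlim_compose[OF filterlim_real_sequentially filterlim_Suc]) auto
  then have "(\<lambda>n. u n - u (Suc n)) sums (u 0 - 0)"
    unfolding u_def[symmetric] by (intro telescope_sums') simp
  then have 2: "(\<lambda>n. u n - u (Suc n)) sums (1 / (s - 1))" by (simp add: u_def)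
  have "real (n + 2) powr (-s) \<le> u n - u (Suc n)" for n
  proof -
    have "\<exists>z>real (Suc n). z < real (n + 2) \<and> 
      real (n + 2) powr (1 - s) - real (Suc n) powr (1 - s) = (real (n + 2) - real (Suc n)) * ((1 - s) * z powr (- s))"
      by (intro MVT2) (auto intro!: derivative_eq_intros simp: field_simps)
    then obtain z where z: "z > real (Suc n)" "z < real (n + 2)"
      "real (n + 2) powr (1 - s) - real (Suc n) powr (1 - s) = (1 - s) * z powr (- s)" by auto
    have "real (n + 2) powr (-s) \<le> z powr (-s)" using z assms by (intro powr_mono2') auto
    also have "\<dots> = (real (Suc n) powr (1 - s) - real (n + 2) powr (1 - s)) / (s - 1)"
      using z(3) assms by (simp add: divide_simps) (simp add: algebra_simps)
    finally show ?thesis by (simp add: u_def diff_divide_distrib)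
  qed
  then have "S - 1 \<le> 1 / (s - 1)" by (rule sums_le[OF _ 1 2])
  then have "S \<le> 1 + 1 / (s - 1)" by simp
  also have "\<dots> = s / (s - 1)" using assms by (simp add: field_simps)
  also have "\<dots> \<le> 2 / (s - 1)" using assms by (intro divide_right_mono) auto
  finally show ?thesis .
qed

lemma inverse_powr_antimono: "s > 1 \<Longrightarrow> 0 < m \<Longrightarrow> m \<le> n \<Longrightarrow> real n powr (-s) \<le> real m powr (-s)"
  by (intro powr_mono2') auto

\<comment> \<open>For a character \<open>\<psi>\<close> of order 4 modulo 5, the sum \<open>1 + \<psi>\<^sup>2 - 2 Re \<psi>\<close> is 4 at the residue \<open>-1\<close> and 0 at the other
  units. Grouping the terms in blocks of five shows that \<open>L(s, \<psi>\<^sup>2)\<close> is bounded and \<open>Re L(s, \<psi>) \<ge> 3/4\<close>.\<close>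
lemma prime_minus_one_mod_5_bound:
  obtains K where "\<And>s. 1 < s \<Longrightarrow> s \<le> 2 \<Longrightarrow> psum (\<lambda>p. of_bool ([int p = -1] (mod 5))) s \<le> ln (1 / (s - 1)) / 4 + K"
proof -
  have l: "prime (5 :: nat)" "(5 :: nat) > 2" by simp_all
  obtain \<psi> :: "int \<Rightarrow> complex" where psi: "\<And>a b. \<psi> (a * b) = \<psi> a * \<psi> b" "\<And>a b. [a = b] (mod 5) \<Longrightarrow> \<psi> a = \<psi> b"
    "\<And>a. 5 dvd a \<Longrightarrow> \<psi> a = 0" "\<And>a. \<not> 5 dvd a \<Longrightarrow> norm (\<psi> a) = 1"
    "\<And>a b. \<not> 5 dvd a \<Longrightarrow> \<not> 5 dvd b \<Longrightarrow> \<psi> a = \<psi> b \<Longrightarrow> [a = b] (mod 5)"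
    using faithful_character_exists[OF l, unfolded of_nat_numeral] by blast
  have psi_le: "norm (\<psi> a) \<le> 1" for a using psi(3,4)[of a] by (cases "5 dvd a") auto
  have psi1: "\<psi> 1 = 1"
  proof -
    have "\<psi> 1 * \<psi> 1 = \<psi> 1" using psi(1)[of 1 1] by simp
    moreover have "\<psi> 1 \<noteq> 0" using psi(4)[of 1] by auto
    ultimately show ?thesis by simp
  qed
  \<comment> \<open>4 is the residue -1; faithfulness excludes the other square root of 1.\<close>
  have psi4: "\<psi> 4 = -1"
  proof -
    have "\<psi> 4 * \<psi> 4 = \<psi> 1" unfolding psi(1)[symmetric] by (rule psi(2)) (simp add: cong_def)
    then have "\<psi> 4 = 1 \<or> \<psi> 4 = -1" by (simp add: psi1 square_eq_1_iff)
    moreover have "\<psi> 4 \<noteq> 1" using psi(5)[of 4 1] psi1 by (auto simp: cong_def)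
    ultimately show ?thesis by blast
  qed
  define v where "v = \<psi> 2"
  have v2: "v * v = -1" unfolding v_def psi(1)[symmetric] using psi4 by simp
  have psi3: "\<psi> 3 = - v"
  proof -
    have "\<psi> 3 = \<psi> (2 * 4)" by (rule psi(2)) (simp add: cong_def)
    then show ?thesis unfolding psi(1) psi4 v_def by simp
  qed
  have Rev: "Re v = 0"
  proof -
    have "Im (v * v) = 0" "Re (v * v) = -1" unfolding v2 by simp_all
    then have *: "Re v = 0 \<or> Im v = 0" "(Re v)\<^sup>2 - (Im v)\<^sup>2 = -1" by (auto simp: power2_eq_square)
    show ?thesis
    proof (rule ccontr)
      assume "Re v \<noteq> 0"
      then have "(Re v)\<^sup>2 = -1" using * by simp
      then show False using zero_le_power2[of "Re v"] by linarith
    qed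
  qed
  have block: "\<psi> (int (j * 5 + i)) = \<psi> (int i)" for i j
    by (rule psi(2)) (simp add: cong_def)
  interpret F0: comp_mult "\<lambda>_. 1" by unfold_locales auto
  interpret F1: comp_mult "\<lambda>n. \<psi> (int n)" by unfold_locales (auto simp: psi psi1 psi_le)
  interpret F2: comp_mult "\<lambda>n. (\<psi> (int n))\<^sup>2" 
    by unfold_locales (auto simp: psi psi1 psi_le power_mult_distrib norm_power power_le_one)
  note M0 = F0.f6_mult_dirichlet and M1 = F1.f6_mult_dirichlet and M2 = F2.f6_mult_dirichlet
  have blk: "{j * 5..<j * 5 + 5} = {j * 5 + 0, j * 5 + 1, j * 5 + 2, j * 5 + 3, j * 5 + 4}" for j :: nat by auto
  have b0: "norm (F0.DS (\<lambda>n. n > 0) s) \<le> 2 / (s - 1)" if s: "1 < s" "s \<le> 2" for s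
  proof -
    have e: "(\<lambda>n. complex_of_real (real n powr (-s))) sums F0.DS (\<lambda>n. n > 0) s" using F0.DS_sums[OF s(1)] by simp
    have "summable (\<lambda>n. real n powr (-s))" using s by (subst summable_real_powr_iff) auto
    then obtain S where S: "(\<lambda>n. real n powr (-s)) sums S" unfolding summable_def by blast
    have "(\<lambda>n. complex_of_real (real n powr (-s))) sums of_real S" using S by (simp add: sums_of_real_iff)
    then have eq: "F0.DS (\<lambda>n. n > 0) s = of_real S" using e sums_unique2 by blast
    have "S \<ge> 0" by (rule sums_le[OF _ sums_zero S]) simp
    then show ?thesis unfolding eq using zeta_sums_upper[OF s S] by simp
  qed
  have b2: "norm (F2.DS (\<lambda>n. n > 0) s) \<le> 1" if s: "1 < s" "s \<le> 2" for s
  proof -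
    define u where "u n = real n powr (-s)" for n
    define w where "w j = (\<Sum>n\<in>{j * 5..<j * 5 + 5}. (\<psi> (int n))\<^sup>2 * of_real (u n))" for j
    have sw: "w sums F2.DS (\<lambda>n. n > 0) s"
      unfolding w_def u_def by (rule sums_group[OF F2.DS_sums[OF s(1)]]) simp
    have weq: "w j = of_real (u (j * 5 + 1) - u (j * 5 + 2) - u (j * 5 + 3) + u (j * 5 + 4))" for j
    proof -
      have "\<psi> 0 = 0" using psi(3)[of 0] by simp
      moreover have "v\<^sup>2 = -1" using v2 by (simp add: power2_eq_square)
      ultimately show ?thesis unfolding w_def blk
        using block[of j 0] block[of j 1] block[of j 2] block[of j 3] block[of j 4]
        by (simp add: psi1 psi3 psi4 v_def[symmetric])
    qed
    have "u \<longlonglongrightarrow> 0" unfolding u_def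
      using s by (intro tendsto_neg_powr filterlim_real_sequentially) auto
    moreover have "strict_mono (\<lambda>j::nat. j * 5 + 1)" by (simp add: strict_mono_def)
    ultimately have "(\<lambda>j. u (j * 5 + 1)) \<longlonglongrightarrow> 0"
      using LIMSEQ_subseq_LIMSEQ[of u 0 "\<lambda>j. j * 5 + 1"] by (simp add: o_def)
    then have tel: "(\<lambda>j. u (j * 5 + 1) - u (Suc j * 5 + 1)) sums (u (0 * 5 + 1) - 0)" by (rule telescope_sums')
    \<comment> \<open>In a block \<open>\<psi>^2\<close> takes the values 0, 1, -1, -1, 1. By
      monotonicity the block sum is dominated by the drop to the start of the next block, and these
      drops telescope to 1.\<close>
    have "norm (w j) \<le> u (j * 5 + 1) - u (Suc j * 5 + 1)" for j
    proof -
      note m = inverse_powr_antimono[OF s(1), folded u_def]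
      have "u (j * 5 + 2) \<le> u (j * 5 + 1)" "u (j * 5 + 3) \<le> u (j * 5 + 2)" "u (j * 5 + 4) \<le> u (j * 5 + 3)" 
        "u (Suc j * 5 + 1) \<le> u (j * 5 + 4)" by (rule m; simp)+
      then show ?thesis unfolding weq norm_of_real by linarith
    qed
    then have "norm (suminf w) \<le> suminf (\<lambda>j. u (j * 5 + 1) - u (Suc j * 5 + 1))"
      using tel by (intro norm_suminf_le) (auto simp: sums_iff)
    then show ?thesis using sw tel by (simp add: sums_iff u_def)
  qed
  have b1: "norm (F1.DS (\<lambda>n. n > 0) s) \<ge> 3 / 4" if s: "1 < s" "s \<le> 2" for s
  proof -
    define u where "u n = real n powr (-s)" for n
    define w where "w j = (\<Sum>n\<in>{j * 5..<j * 5 + 5}. \<psi> (int n) * of_real (u n))" for j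
    have sw: "w sums F1.DS (\<lambda>n. n > 0) s"
      unfolding w_def u_def by (rule sums_group[OF F1.DS_sums[OF s(1)]]) simp
    \<comment> \<open>In a block \<open>\<psi>\<close> takes the values 0, 1, \<open>v\<close>,
      \<open>-v\<close>, -1 with \<open>v\<close> purely imaginary, so two terms make up the real
      part. It is nonnegative, and in the first block at least \<open>1 - 1/4\<close>.\<close>
    have weq: "Re (w j) = u (j * 5 + 1) - u (j * 5 + 4)" for j
    proof -
      have "\<psi> 0 = 0" using psi(3)[of 0] by simp
      then show ?thesis unfolding w_def blk
        using block[of j 0] block[of j 1] block[of j 2] block[of j 3] block[of j 4] Rev
        by (simp add: psi1 psi3 psi4 v_def[symmetric])
    qed
    have nn: "Re (w j) \<ge> 0" for j
      unfolding weq u_def using inverse_powr_antimono[OF s(1), of "j * 5 + 1" "j * 5 + 4"] by simp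
    have "(\<lambda>j. if j = 0 then Re (w j) else 0) sums Re (w 0)" by (rule sums_single)
    moreover have "(\<lambda>j. Re (w j)) sums Re (F1.DS (\<lambda>n. n > 0) s)" by (rule sums_Re[OF sw])
    ultimately have "Re (w 0) \<le> Re (F1.DS (\<lambda>n. n > 0) s)"
      by (rule sums_le[rotated]) (use nn in auto)
    moreover have "Re (w 0) \<ge> 3 / 4"
    proof -
      have "(4::real) powr (-s) \<le> 4 powr (-1)" using s by (intro powr_mono) auto
      then show ?thesis unfolding weq u_def by (simp add: powr_minus)
    qed
    ultimately show ?thesis using complex_Re_le_cmod[of "F1.DS (\<lambda>n. n > 0) s"] by linarith
  qed
  define \<phi>0 \<phi>1 \<phi>2 where "\<phi>0 p = Re (F0.f6 p)" and "\<phi>1 p = Re (F1.f6 p)" and "\<phi>2 p = Re (F2.f6 p)" for p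
  note pb = mult_dirichlet.prime_bounded_f[OF M0, folded \<phi>0_def] mult_dirichlet.prime_bounded_f[OF M1, folded \<phi>1_def]
    mult_dirichlet.prime_bounded_f[OF M2, folded \<phi>2_def]
  let ?\<iota> = "\<lambda>p. of_bool ([int p = -1] (mod 5)) :: real"
  have pbi: "prime_bounded ?\<iota>" by (rule prime_boundedI[of _ 1]) simp
  have pbl: "prime_bounded (\<lambda>p. 1 * \<phi>0 p + 1 * \<phi>2 p)" by (intro prime_bounded_lin pb)
  \<comment> \<open>The summand with coefficient 0 and the factors 1 fit both sides to
    \<open>psum_lin\<close>. The primes 2 and 3, deleted from the series on the right, are not in
    the class of -1 modulo 5.\<close>
  have ineq: "4 * ?\<iota> p + 0 * ?\<iota> p \<le> 1 * (1 * \<phi>0 p + 1 * \<phi>2 p) + (-2) * \<phi>1 p" if p: "prime p" for p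
  proof (cases "p > 0 \<and> \<not> 2 dvd p \<and> \<not> 3 dvd p")
    case False
    then have "p = 2 \<or> p = 3" using p primes_dvd_imp_eq[of 2 p] primes_dvd_imp_eq[of 3 p] prime_gt_0_nat[of p] by auto
    then have "?\<iota> p = 0" by (auto simp: cong_def)
    then show ?thesis
      unfolding \<phi>0_def \<phi>1_def \<phi>2_def F0.f6_def F1.f6_def F2.f6_def if_not_P[OF False] by simp
  next
    case True
    have m: "\<psi> (int p) = \<psi> (int p mod 5)" by (rule psi(2)) (simp add: cong_def)
    have i: "?\<iota> p = of_bool (int p mod 5 = 4)" by (simp add: cong_def)
    have vv: "v\<^sup>2 = -1" using v2 by (simp add: power2_eq_square)
    have "int p mod 5 \<in> {0, 1, 2, 3, 4}" using pos_mod_bound[of 5 "int p"] pos_mod_sign[of 5 "int p"] by auto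
    then show ?thesis
      using True unfolding i \<phi>0_def \<phi>1_def \<phi>2_def F0.f6_def F1.f6_def F2.f6_def m
      using psi(3)[of 0] psi1 psi3 psi4 vv Rev by (auto simp: v_def[symmetric])
  qed
  show ?thesis
  proof (rule that)
    fix s :: real assume s: "1 < s" "s \<le> 2"
    have "psum (\<lambda>p. 4 * ?\<iota> p + 0 * ?\<iota> p) s \<le> psum (\<lambda>p. 1 * (1 * \<phi>0 p + 1 * \<phi>2 p) + (-2) * \<phi>1 p) s"
      using ineq s(1) by (intro psum_mono prime_bounded_lin pb pbi) auto
    then have main: "4 * psum ?\<iota> s \<le> psum \<phi>0 s + psum \<phi>2 s - 2 * psum \<phi>1 s"
      unfolding psum_lin[OF pbi pbi s(1)] psum_lin[OF pbl pb(2) s(1)] psum_lin[OF pb(1,3) s(1)] by simp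
    have L0: "norm (mult_dirichlet.L F0.f6 s) \<le> 8 * (1 / (s - 1))"
      using F0.L_f6_bounds(1)[OF s(1)] b0[OF s] by simp
    have L2: "norm (mult_dirichlet.L F2.f6 s) \<le> 4" using F2.L_f6_bounds(1)[OF s(1)] b2[OF s] by simp
    have L1: "3 / 16 \<le> norm (mult_dirichlet.L F1.f6 s)" using F1.L_f6_bounds(2)[OF s(1)] b1[OF s] by simp
    have P0: "psum \<phi>0 s \<le> ln (8 * (1 / (s - 1))) + mult_dirichlet.K"
      unfolding \<phi>0_def by (rule mult_dirichlet.psum_upper[OF M0 L0 s])
    have P2: "psum \<phi>2 s \<le> ln 4 + mult_dirichlet.K"
      unfolding \<phi>2_def by (rule mult_dirichlet.psum_upper[OF M2 L2 s])
    have P1: "ln (3 / 16) - mult_dirichlet.K \<le> psum \<phi>1 s"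
      unfolding \<phi>1_def by (rule mult_dirichlet.psum_lower[OF M1 L1 _ s]) simp
    have lin: "i \<le> x / 4 + (e + f - 2 * g + 4 * k) / 4"
      if "4 * i \<le> p0 + p2 - 2 * p1" "p0 \<le> e + x + k" "p2 \<le> f + k" "g - k \<le> p1" for i p0 p1 p2 e f g k x :: real
      using that by (simp add: field_simps)
    have "ln (8 * (1 / (s - 1))) = ln 8 + ln (1 / (s - 1))" using s by (subst ln_mult) auto
    then have P0': "psum \<phi>0 s \<le> ln 8 + ln (1 / (s - 1)) + mult_dirichlet.K" using P0 by simp
    show "psum ?\<iota> s \<le> ln (1 / (s - 1)) / 4 + (ln 8 + ln 4 - 2 * ln (3 / 16) + 4 * mult_dirichlet.K) / 4"
      by (rule lin[OF main P0' P2 P1])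
  qed
qed

section \<open>Forms representing good numbers\<close>

text \<open>Multiplication by \<open>r\<close> permutes the residues and multiplies the sum by
  \<open>(F r)^2\<close>.\<close>

lemma (in disc_chars) mean_zero:
  assumes "coprime r D" "(F r)\<^sup>2 \<noteq> 1"
  shows "mean = 0"
proof -
  have "(\<Sum>t\<in>{0..<D}. (F t)\<^sup>2) = (\<Sum>x\<in>{0..<D}. (F ((r * x + 0) mod D))\<^sup>2)"
    by (rule sum.reindex_bij_betw[OF affine_residue_bij[OF assms(1)], symmetric])
  also have "\<dots> = (F r)\<^sup>2 * (\<Sum>x\<in>{0..<D}. (F x)\<^sup>2)"
    by (simp add: F_mod F_mult power_mult_distrib sum_distrib_left)
  finally have "(1 - (F r)\<^sup>2) * (\<Sum>t\<in>{0..<D}. (F t)\<^sup>2) = 0" by (simp add: left_diff_distrib)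
  then show ?thesis using assms(2) by (simp add: mean_def)
qed

text \<open>A simple pole gives \<open>ln (1 / (s - 1))\<close> with coefficient 1 on the left,
  against 1/2 on the right.\<close>

lemma log_growth_contradiction:
  fixes c M K1 K2 :: real
  assumes "c > 0" and le: "\<And>s. 1 < s \<Longrightarrow> s \<le> 2 \<Longrightarrow> 0 < c / (s - 1) - M \<Longrightarrow> ln (c / (s - 1) - M) - K1 \<le> ln (1 / (s - 1)) / 2 + K2"
  shows False
proof -
  \<comment> \<open>\<open>t\<close> stands for \<open>1 / (s - 1)\<close>: at least 1 so that
    \<open>s \<le> 2\<close>, large enough for \<open>c t - M \<ge> c t / 2\<close>, and so large
    that \<open>ln t / 2\<close> exceeds all constants.\<close>
  define t where "t = max (max 1 (2 * \<bar>M\<bar> / c + 1)) (exp (2 * (K1 + K2 - ln (c / 2)) + 1))"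
  have t1: "t \<ge> 1" "t \<ge> 2 * \<bar>M\<bar> / c + 1" "t \<ge> exp (2 * (K1 + K2 - ln (c / 2)) + 1)" by (auto simp: t_def)
  define s where "s = 1 + 1 / t"
  have s: "1 < s" "s \<le> 2" "1 / (s - 1) = t" using t1(1) by (auto simp: s_def)
  have ct: "c / (s - 1) = c * t" using t1(1) by (simp add: s_def)
  have "c * t \<ge> c * (2 * \<bar>M\<bar> / c + 1)" using t1(2) assms(1) by (intro mult_left_mono) auto
  then have "c * t \<ge> 2 * \<bar>M\<bar> + c" using assms(1) by (simp add: distrib_left)
  then have big: "c / 2 * t \<le> c * t - M" using assms(1) by (simp add: field_simps)
  have pos: "c / 2 * t > 0" using assms(1) t1(1) by simp
  have "ln (c / 2 * t) \<le> ln (c * t - M)" using big pos by (subst ln_le_cancel_iff) auto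
  also have "\<dots> \<le> ln t / 2 + K2 + K1" using le[OF s(1,2)] big pos unfolding ct s(3) by linarith
  finally have "ln (c / 2) + ln t \<le> ln t / 2 + K2 + K1"
    using assms(1) t1(1) by (subst (asm) ln_mult) auto
  then have "ln t \<le> 2 * (K1 + K2 - ln (c / 2))" by simp
  moreover have "2 * (K1 + K2 - ln (c / 2)) + 1 \<le> ln t" using t1(1,3) by (simp add: ln_ge_iff)
  ultimately show False by simp
qed

definition good :: "int \<Rightarrow> int \<Rightarrow> bool" where
  "good l m \<longleftrightarrow> m > 0 \<and> (\<forall>p. prime p \<and> p dvd m \<longrightarrow> \<not> [p = 0] (mod l) \<and> \<not> [p = -1] (mod l))"

lemma good_1: "good l 1"
  by (auto simp: good_def)

lemma good_mult: "good l m \<Longrightarrow> good l m' \<Longrightarrow> good l (m * m')"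
  by (auto simp: good_def prime_dvd_mult_iff)

context disc
begin

definition represents_good :: "int \<Rightarrow> complex set set" where
  "represents_good l = {L \<in> invertible. \<exists>z\<in>L. z \<noteq> 0 \<and> (\<exists>m. good l m \<and> (cmod z)\<^sup>2 / lnorm L = of_int m)}"

lemma lnorm_Ord: "lnorm Ord = 1"
  using lnorm_Mlat[OF valid_1] by (simp add: Ord_eq_Mlat)

lemma smul_Ord_represents_good:
  assumes "\<alpha> \<noteq> 0" shows "smul \<alpha> Ord \<in> represents_good l"
proof -
  have "\<alpha> \<in> smul \<alpha> Ord" using one_mem_Ord by (force simp: smul_def)
  moreover have "(cmod \<alpha>)\<^sup>2 / lnorm (smul \<alpha> Ord) = of_int 1"
    using assms by (simp add: lnorm_smul[OF Ord_invertible assms] lnorm_Ord)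
  ultimately show ?thesis
    using smul_invertible[OF Ord_invertible assms] assms good_1 unfolding represents_good_def by blast
qed

text \<open>Norms of lattices and of points are multiplicative, which settles products. The inverse
  of \<open>A\<close> is its conjugate divided by \<open>N\<close>, and there the point
  \<open>cnj z / N\<close> takes the same value \<open>m\<close>.\<close>

lemma represents_good_subgroup: "subgroup (represents_good l) idG"
proof (rule idG.subgroupI, unfold idG_def partial_object.simps monoid.simps)
  show "represents_good l \<subseteq> invertible" by (auto simp: represents_good_def)
  show "represents_good l \<noteq> {}" using smul_Ord_represents_good[OF one_neq_zero, of l] by auto
next
  fix A assume A: "A \<in> represents_good l"
  then obtain z m where z: "A \<in> invertible" "z \<in> A" "z \<noteq> 0" "good l m" "(cmod z)\<^sup>2 / lnorm A = of_int m"
    by (auto simp: represents_good_def)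
  define N where "N = lnorm A"
  have N: "N > 0" "lprod A (cnj ` A) = smul (of_real N) Ord" using lnorm_G[OF z(1)] by (auto simp: N_def)
  define B where "B = smul (1 / of_real N) (cnj ` A)"
  obtain \<alpha> n h where L: "\<alpha> \<noteq> 0" "valid n h" "A = smul \<alpha> (Mlat n h)" using z(1) unfolding invertible_def by blast
  have "cnj ` A = smul (cnj \<alpha>) (Mlat n (-h))"
    unfolding L(3) smul_cnj using L(2) by (simp add: cnj_Mlat valid_def)
  then have cG: "cnj ` A \<in> invertible" using L by (simp add: invertible_I valid_uminus)
  then have BG: "B \<in> invertible" unfolding B_def using N(1) by (intro smul_invertible) auto
  have "lprod B A = Ord"
    unfolding B_def lprod_smul using N by (simp add: lprod_commute[of "cnj ` A"])
  then have inv: "inv\<^bsub>idG\<^esub> A = B" using idG.inv_equality z(1) BG by simp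
  have "lnorm B * N = 1" using lnorm_lprod[OF BG z(1)] \<open>lprod B A = Ord\<close> by (simp add: lnorm_Ord N_def)
  then have nB: "lnorm B = 1 / N" using N(1) by (simp add: field_simps)
  have "1 / of_real N * cnj z \<in> B"
    unfolding B_def smul_def using z(2) by (intro imageI)
  then have "cnj z / of_real N \<in> B" by simp
  moreover have "(cmod (cnj z / of_real N))\<^sup>2 / lnorm B = of_int m"
    using z(5) N(1) unfolding nB N_def[symmetric] by (simp add: norm_divide power_divide power2_eq_square)
  ultimately have "B \<in> represents_good l"
    using BG z(3,4) N(1) unfolding represents_good_def by (auto intro!: bexI[of _ "cnj z / of_real N"] exI[of _ m])
  then show "inv\<^bsub>\<lparr>carrier = invertible, mult = lprod, one = Ord\<rparr>\<^esub> A \<in> represents_good l" using inv unfolding idG_def by simp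
next
  fix A B assume "A \<in> represents_good l" "B \<in> represents_good l"
  then obtain z m z' m' where z: "A \<in> invertible" "z \<in> A" "z \<noteq> 0" "good l m" "(cmod z)\<^sup>2 / lnorm A = of_int m"
    "B \<in> invertible" "z' \<in> B" "z' \<noteq> 0" "good l m'" "(cmod z')\<^sup>2 / lnorm B = of_int m'"
    by (auto simp: represents_good_def)
  have "z * z' \<in> lprod A B" unfolding lprod_def using z by (intro zmod.span_base) blast
  moreover have "(cmod (z * z'))\<^sup>2 / lnorm (lprod A B) = of_int (m * m')"
    unfolding of_int_mult z(5,10)[symmetric] lnorm_lprod[OF z(1,6)] by (simp add: norm_mult power_mult_distrib)
  ultimately show "lprod A B \<in> represents_good l"
    using z lprod_invertible good_mult[OF z(4,9)] unfolding represents_good_def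
    by (auto intro!: bexI[of _ "z * z'"] exI[of _ "m * m'"])
qed

text \<open>The residue 2 is the test element showing that \<open>\<psi>^2\<close> and
  \<open>\<psi>^4\<close> are nontrivial: otherwise \<open>l\<close> would divide 3 or 15. Since
  \<open>D\<close> is even, 2 has to be lifted to a number prime to \<open>D\<close>; the lift is 1
  modulo the part of \<open>D\<close> prime to \<open>l\<close>.\<close>

lemma two_lift:
  assumes "prime (l :: int)" "l > 2"
  obtains r where "[r = 2] (mod l)" "coprime r D"
proof -
  have "D \<noteq> 0" "\<not> is_unit l" using D_pos assms by (auto simp: not_prime_unit)
  then obtain D' where D': "D = l ^ multiplicity l D * D'" "\<not> l dvd D'"
    using multiplicity_decompose' by metis
  have "coprime l D'" using assms(1) D'(2) by (simp add: prime_imp_coprime)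
  then obtain r where r: "[r = 2] (mod l)" "[r = 1] (mod D')"
    using binary_chinese_remainder_int by blast
  have "coprime 2 l"
  proof (rule ccontr)
    assume "\<not> coprime 2 l"
    then have "l dvd 2" using assms(1) prime_imp_coprime[of l 2] by (auto simp: coprime_commute)
    then show False using assms(2) zdvd_imp_le[of l 2] by simp
  qed
  then have "coprime r l" using r(1) cong_imp_coprime cong_sym by blast
  moreover have "coprime r D'" using r(2) cong_imp_coprime[of 1 r D'] cong_sym by auto
  ultimately have "coprime r (l ^ multiplicity l D * D')" by simp
  then have "coprime r D" using D'(1) by simp
  then show ?thesis using that r(1) by blast
qed

\<comment> \<open>The weight \<open>1 + Re \<psi>\<close> vanishes exactly at the residue \<open>-1\<close>, the only one at which \<open>ch\<close> is unknown. Hence the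
  boundedness of the series of \<open>ch\<close> and \<open>ch \<psi>\<close> makes the split primes outside this residue class sparse. For \<open>l > 5\<close> this
  contradicts the boundedness of the series of \<open>\<psi>\<^sup>2\<close>; for \<open>l = 5\<close> that character can be trivial on all norms, and one compares
  with the density \<open>1/4\<close> of the primes congruent to \<open>-1\<close>.\<close>
lemma no_separating_character:
  fixes l :: int and ch :: "complex set \<Rightarrow> complex"
  assumes l: "prime l" "l \<ge> 5" and D6: "6 dvd D" and lD: "l dvd D"
    and ch_mult: "\<And>A B. A \<in> invertible \<Longrightarrow> B \<in> invertible \<Longrightarrow> ch (lprod A B) = ch A * ch B"
    and ch_norm: "\<And>A. A \<in> invertible \<Longrightarrow> norm (ch A) = 1"
    and ch_good: "\<And>A. A \<in> represents_good l \<Longrightarrow> ch A = 1"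
    and nontrivial: "g \<in> invertible" "ch g \<noteq> 1"
  shows False
proof -
  have "prime (nat l)" "nat l > 2" using l by (auto simp: prime_nat_iff_prime)
  moreover have "int (nat l) = l" using l by simp
  ultimately obtain \<psi> :: "int \<Rightarrow> complex" where psi: "\<And>a b. \<psi> (a * b) = \<psi> a * \<psi> b" "\<And>a b. [a = b] (mod l) \<Longrightarrow> \<psi> a = \<psi> b"
    "\<And>a. l dvd a \<Longrightarrow> \<psi> a = 0" "\<And>a. \<not> l dvd a \<Longrightarrow> norm (\<psi> a) = 1"
    "\<And>a b. \<not> l dvd a \<Longrightarrow> \<not> l dvd b \<Longrightarrow> \<psi> a = \<psi> b \<Longrightarrow> [a = b] (mod l)"
    using faithful_character_exists[of "nat l"] by (simp only:) blast
  have small: "\<not> l dvd a" if "\<bar>a\<bar> < l" "a \<noteq> 0" for a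
    using that dvd_imp_le_int[of a l] by auto
  have psi1: "\<psi> 1 = 1"
  proof -
    have "\<psi> 1 * \<psi> 1 = \<psi> 1" using psi(1)[of 1 1] by simp
    moreover have "\<psi> 1 \<noteq> 0" using psi(4)[of 1] small[of 1] l by auto
    ultimately show ?thesis by simp
  qed
  have psi_m1: "\<psi> (-1) = -1"
  proof -
    have "\<psi> (-1) * \<psi> (-1) = 1" using psi(1)[of "-1" "-1"] psi1 by simp
    then have "\<psi> (-1) = 1 \<or> \<psi> (-1) = -1" by (simp add: square_eq_1_iff)
    moreover have "\<psi> (-1) \<noteq> 1"
    proof
      assume "\<psi> (-1) = 1"
      then have "[-1 = 1] (mod l)" using psi(5)[of "-1" 1] psi1 small[of 1] small[of "-1"] l by simp
      then have "l dvd 2" by (simp add: cong_iff_dvd_diff)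
      then show False using small[of 2] l by simp
    qed
    ultimately show ?thesis by blast
  qed
  have psi_eq_m1: "[a = -1] (mod l)" if "\<psi> a = -1" for a
  proof -
    have "\<not> l dvd a" using psi(3)[of a] that by auto
    then show ?thesis using psi(5)[of a "-1"] that psi_m1 small[of "-1"] l by simp
  qed
  have psi_le: "norm (\<psi> a) \<le> 1" for a using psi(3,4)[of a] by (cases "l dvd a") auto
  have ch_smul: "ch (smul \<alpha> A) = ch A" if "A \<in> invertible" "\<alpha> \<noteq> 0" for A \<alpha>
  proof -
    have "smul \<alpha> A = lprod (smul \<alpha> Ord) A" by (simp add: lprod_smul Ord_lprod[OF that(1)])
    then show ?thesis
      using ch_mult[OF smul_invertible[OF Ord_invertible that(2)] that(1)] ch_good[OF smul_Ord_represents_good[OF that(2)]] by simp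
  qed
  \<comment> \<open>Powers of \<open>\<psi>\<close> as characters modulo \<open>D\<close>; for
    \<open>j = 0\<close> this is the principal character, still 0 off the units.\<close>
  define Fj where "Fj j a = (if coprime a D then \<psi> a ^ j else 0)" for j :: nat and a
  have nl: "\<not> l dvd a" if "coprime a D" for a
  proof
    assume "l dvd a"
    then have "is_unit l" using that lD coprime_common_divisor by blast
    then show False using l(1) by (simp add: not_prime_unit)
  qed
  have dcs: "disc_chars D (Fj j) c" if "\<And>A B. A \<in> invertible \<Longrightarrow> B \<in> invertible \<Longrightarrow> c (lprod A B) = c A * c B"
      "\<And>A. A \<in> invertible \<Longrightarrow> norm (c A) = 1" "\<And>A \<alpha>. A \<in> invertible \<Longrightarrow> \<alpha> \<noteq> 0 \<Longrightarrow> c (smul \<alpha> A) = c A" for j and c :: "complex set \<Rightarrow> complex"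
  proof (unfold_locales)
    fix a b
    show "Fj j (a * b) = Fj j a * Fj j b" by (simp add: Fj_def psi(1) power_mult_distrib)
    have "[a mod D = a] (mod l)" using lD by (simp add: cong_def mod_mod_cancel)
    then have "\<psi> (a mod D) = \<psi> a" by (rule psi(2))
    moreover have "coprime (a mod D) D \<longleftrightarrow> coprime a D" using D_pos by (simp add: coprime_iff_gcd_eq_1 gcd.commute[of _ D] flip: gcd_red_int)
    ultimately show "Fj j (a mod D) = Fj j a" by (simp add: Fj_def)
    show "Fj j a = 0" if "\<not> coprime a D" using that by (simp add: Fj_def)
    show "norm (Fj j a) = 1" if "coprime a D" using that psi(4)[OF nl[OF that]] by (simp add: Fj_def norm_power)
  qed (use D6 that in auto)
  \<comment> \<open>\<open>X0\<close> and \<open>X1\<close> belong to \<open>ch\<close> and its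
    twist by \<open>\<psi>\<close>, \<open>Y0\<close> and \<open>Y2\<close> to the trivial class
    character and its twist by \<open>\<psi>^2\<close>.\<close>
  interpret X0: disc_chars D "Fj 0" ch by (rule dcs[OF ch_mult ch_norm ch_smul])
  interpret X1: disc_chars D "Fj 1" ch by (rule dcs[OF ch_mult ch_norm ch_smul])
  interpret Y0: disc_chars D "Fj 0" "\<lambda>_. 1" by (rule dcs) auto
  interpret Y2: disc_chars D "Fj 2" "\<lambda>_. 1" by (rule dcs) auto
  note MX0 = X0.coeff_mult_dirichlet and MX1 = X1.coeff_mult_dirichlet and MY0 = Y0.coeff_mult_dirichlet and MY2 = Y2.coeff_mult_dirichlet
  \<comment> \<open>2 at the primes that split and 0 at the others; \<open>A\<close> is the same
    weight with the class of -1 removed.\<close>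
  define R where "R p = real (card (X0.rts p))" for p
  define A where "A p = (if [int p = -1] (mod l) then 0 else R p)" for p
  define \<phi> where "\<phi> p = Re (X0.coeff p)" for p
  define \<theta> where "\<theta> p = Re (X1.coeff p)" for p
  define \<eta> where "\<eta> p = Re (Y0.coeff p)" for p
  define \<xi> where "\<xi> p = Re (Y2.coeff p)" for p
  note pb = mult_dirichlet.prime_bounded_f[OF MX0, folded \<phi>_def] mult_dirichlet.prime_bounded_f[OF MX1, folded \<theta>_def]
    mult_dirichlet.prime_bounded_f[OF MY0, folded \<eta>_def] mult_dirichlet.prime_bounded_f[OF MY2, folded \<xi>_def]
  have R2: "R p \<le> 2" if "prime p" for p using X0.card_rts_prime_power[OF that, of 1] by (simp add: R_def)
  have pbA: "prime_bounded A"
    by (rule prime_boundedI[of _ 2]) (use R2 in \<open>auto simp: A_def R_def\<close>)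
  have R0: "R p = 0" if "\<not> coprime (int p) D" for p
  proof -
    have "X0.rts p = {}" using that by (auto simp: X0.rts_def valid_def)
    then show ?thesis by (simp add: R_def)
  qed
  have eta: "\<eta> p = R p" for p
    using R0[of p] by (auto simp: \<eta>_def Y0.coeff_def R_def Fj_def)
  have xi: "\<xi> p = R p * Re ((\<psi> (int p))\<^sup>2)" for p
    using R0[of p] by (auto simp: \<xi>_def Y2.coeff_def R_def Fj_def)
  \<comment> \<open>1 lies in every \<open>Mlat p h\<close> and takes the value \<open>p\<close>
    there. Outside the class of -1 this value is good, so \<open>ch\<close> is 1 on these
    lattices.\<close>
  have good_prime: "(\<Sum>h\<in>X0.rts p. ch (Mlat (int p) h)) = of_real (R p)"
    if p: "prime p" "coprime (int p) D" "\<not> [int p = -1] (mod l)" for p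
  proof -
    have gp: "good l (int p)"
    proof -
      have "q = int p" if "prime q" "q dvd int p" for q :: int
        using that p(1) primes_dvd_imp_eq[of q "int p"] by simp
      then show ?thesis using p nl[OF p(2)] prime_gt_0_nat[OF p(1)] by (auto simp: good_def cong_0_iff)
    qed
    have "ch (Mlat (int p) h) = 1" if "h \<in> X0.rts p" for h
    proof -
      have v: "valid (int p) h" using that by (rule X0.rtsD)
      have "(cmod 1)\<^sup>2 / lnorm (Mlat (int p) h) = of_int (int p)" by (simp add: lnorm_Mlat[OF v])
      then have "Mlat (int p) h \<in> represents_good l"
        using Mlat_invertible[OF v] one_mem_Mlat gp unfolding represents_good_def by (auto intro!: bexI[of _ 1])
      then show ?thesis by (rule ch_good)
    qed
    then show ?thesis by (simp add: R_def)
  qed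
  \<comment> \<open>There are finitely many residues, and a point of the closed unit disc with real
    part -1 is -1 itself; so the weight has a positive minimum \<open>d\<close> away from the class
    of -1.\<close>
  define V where "V = (\<lambda>t. 1 + Re (\<psi> t)) ` {t \<in> {0..<l}. \<psi> t \<noteq> -1}"
  have "finite {t \<in> {0..<l}. \<psi> t \<noteq> -1}" by (rule finite_subset[of _ "{0..<l}"]) auto
  then have finV: "finite V" unfolding V_def by (rule finite_imageI)
  have "\<psi> 0 = 0" using psi(3)[of 0] by simp
  then have "0 \<in> {t \<in> {0..<l}. \<psi> t \<noteq> -1}" using l by auto
  then have neV: "V \<noteq> {}" unfolding V_def by blast
  define d where "d = Min V"
  have d_pos: "d > 0"
  proof -
    have "d \<in> V" unfolding d_def using finV neV by (rule Min_in)
    then obtain t where t: "d = 1 + Re (\<psi> t)" "\<psi> t \<noteq> -1" by (auto simp: V_def)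
    have "Re (\<psi> t) \<noteq> -1"
    proof
      assume r: "Re (\<psi> t) = -1"
      have "(Re (\<psi> t))\<^sup>2 + (Im (\<psi> t))\<^sup>2 \<le> 1"
        using psi_le[of t] by (simp add: cmod_def)
      then have "Im (\<psi> t) = 0" using r by simp
      then show False using r t(2) by (simp add: complex_eq_iff)
    qed
    moreover have "Re (\<psi> t) \<ge> -1" using psi_le[of t] abs_Re_le_cmod[of "\<psi> t"] by linarith
    ultimately show ?thesis using t(1) by simp
  qed
  have d_le: "d \<le> 1 + Re (\<psi> t)" if "\<not> [t = -1] (mod l)" for t
  proof -
    have m: "\<psi> (t mod l) = \<psi> t" by (rule psi(2)) (simp add: cong_def)
    have "\<psi> t \<noteq> -1" using psi_eq_m1 that by blast
    then have "1 + Re (\<psi> (t mod l)) \<in> V" unfolding V_def using l m by (intro imageI) auto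
    then show ?thesis unfolding d_def using finV m by (metis Min_le)
  qed
  \<comment> \<open>Both sides are written as combinations of two terms to match \<open>psum_lin\<close>.\<close>
  have ineq1: "d * A p + 0 * A p \<le> 1 * \<phi> p + 1 * \<theta> p" if p: "prime p" for p
  proof (cases "coprime (int p) D")
    case False
    then show ?thesis unfolding \<phi>_def \<theta>_def X0.coeff_def X1.coeff_def using R0[OF False] by (simp add: A_def Fj_def)
  next
    case True
    show ?thesis
    proof (cases "[int p = -1] (mod l)")
      case m1: True
      then have "\<psi> (int p) = -1" using psi(2)[OF m1] psi_m1 by simp
      then show ?thesis unfolding \<phi>_def \<theta>_def X0.coeff_def X1.coeff_def using m1 True by (simp add: A_def Fj_def)
    next
      case m1: False
      have "d * R p \<le> (1 + Re (\<psi> (int p))) * R p" using d_le[OF m1] by (intro mult_right_mono) (auto simp: R_def)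
      then show ?thesis unfolding \<phi>_def \<theta>_def X0.coeff_def X1.coeff_def good_prime[OF p True m1] using m1 True
        by (simp add: A_def Fj_def algebra_simps)
    qed
  qed
  obtain r where r: "[r = 2] (mod l)" "coprime r D" using two_lift[OF l(1)] l(2) by auto
  have psir: "\<psi> r = \<psi> 2" by (rule psi(2)[OF r(1)])
  have X1mean: "X1.mean = 0"
  proof (rule X1.mean_zero[OF r(2)])
    show "(Fj 1 r)\<^sup>2 \<noteq> 1"
    proof
      assume "(Fj 1 r)\<^sup>2 = 1"
      then have "\<psi> 4 = \<psi> 1" using r(2) psi(1)[of 2 2] psi1 by (simp add: Fj_def psir power2_eq_square)
      then have "[4 = 1] (mod l)" using psi(5)[of 4 1] small[of 4] small[of 1] l by simp
      then have "l dvd 3" by (simp add: cong_iff_dvd_diff)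
      then show False using small[of 3] l by simp
    qed
  qed
  obtain M0 where M0: "\<And>s. 1 < s \<Longrightarrow> s \<le> 2 \<Longrightarrow> norm (X0.class_dseries s) \<le> M0"
    using X0.class_dseries_bounded_nontrivial[OF _ nontrivial] by (auto simp: Fj_def)
  obtain M1 where M1: "\<And>s. 1 < s \<Longrightarrow> s \<le> 2 \<Longrightarrow> norm (X1.class_dseries s) \<le> M1"
    using X1.class_dseries_bounded_mean_zero[OF X1mean] by blast
  define K where "K = mult_dirichlet.K"
  have pA: "d * psum A s \<le> ln M0 + ln M1 + 2 * K" if s: "1 < s" "s \<le> 2" for s
  proof -
    have "psum (\<lambda>p. d * A p + 0 * A p) s \<le> psum (\<lambda>p. 1 * \<phi> p + 1 * \<theta> p) s"
      using ineq1 s(1) by (intro psum_mono prime_bounded_lin pb pbA) auto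
    then have "d * psum A s \<le> psum \<phi> s + psum \<theta> s"
      unfolding psum_lin[OF pbA pbA s(1)] psum_lin[OF pb(1,2) s(1)] by simp
    moreover have "psum \<phi> s \<le> ln M0 + K" unfolding \<phi>_def K_def
      using M0[OF s] by (intro mult_dirichlet.psum_upper[OF MX0 _ s]) (simp add: X0.class_dseries_eq)
    moreover have "psum \<theta> s \<le> ln M1 + K" unfolding \<theta>_def K_def
      using M1[OF s] by (intro mult_dirichlet.psum_upper[OF MX1 _ s]) (simp only: X1.class_dseries_eq)
    ultimately show ?thesis by simp
  qed
  define KA where "KA = (ln M0 + ln M1 + 2 * K) / d"
  have pA': "psum A s \<le> KA" if s: "1 < s" "s \<le> 2" for s
    using pA[OF s] d_pos by (simp add: KA_def field_simps)
  have "\<exists>K2. \<forall>s. 1 < s \<longrightarrow> s \<le> 2 \<longrightarrow> psum \<eta> s \<le> ln (1 / (s - 1)) / 2 + K2"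
  proof (cases "l = 5")
    case True
    let ?\<iota> = "\<lambda>p. of_bool ([int p = -1] (mod 5)) :: real"
    obtain K5 where K5: "\<And>s. 1 < s \<Longrightarrow> s \<le> 2 \<Longrightarrow> psum ?\<iota> s \<le> ln (1 / (s - 1)) / 4 + K5"
      using prime_minus_one_mod_5_bound by blast
    have pbi: "prime_bounded ?\<iota>" by (rule prime_boundedI[of _ 1]) simp
    \<comment> \<open>At most two roots for each prime in the class of -1; with density 1/4 this
      gives the coefficient 1/2 of the logarithm.\<close>
    have "\<eta> p \<le> 2 * ?\<iota> p + 1 * A p" if "prime p" for p
      using R2[OF that] by (simp add: eta A_def True)
    then have "psum \<eta> s \<le> psum (\<lambda>p. 2 * ?\<iota> p + 1 * A p) s" if "1 < s" for s
      using that by (intro psum_mono prime_bounded_lin pb pbA pbi) auto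
    then have "psum \<eta> s \<le> ln (1 / (s - 1)) / 2 + (2 * K5 + KA)" if s: "1 < s" "s \<le> 2" for s
      using psum_lin[OF pbi pbA s(1), of 2 1] K5[OF s] pA'[OF s] s(1) by fastforce
    then show ?thesis by blast
  next
    case False
    then have l7: "l > 5" using l(2) by simp
    have Y2mean: "Y2.mean = 0"
    proof (rule Y2.mean_zero[OF r(2)])
      show "(Fj 2 r)\<^sup>2 \<noteq> 1"
      proof
        assume "(Fj 2 r)\<^sup>2 = 1"
        then have e: "\<psi> 16 = \<psi> 1" using r(2) psi(1)[of 2 2] psi(1)[of 4 4] psi1 by (simp add: Fj_def psir power2_eq_square)
        have "\<not> l dvd 2" using small[of 2] l by simp
        then have "\<not> l dvd 2 ^ 4" using l(1) prime_dvd_power by blast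
        then have "[16 = 1] (mod l)" using psi(5)[of 16 1] small[of 1] l e by simp
        then have "l dvd 3 * 5" by (simp add: cong_iff_dvd_diff)
        then have "l dvd 3 \<or> l dvd 5" using l(1) by (simp only: prime_dvd_mult_iff)
        then show False using small[of 3] small[of 5] l7 by simp
      qed
    qed
    obtain M2 where M2: "\<And>s. 1 < s \<Longrightarrow> s \<le> 2 \<Longrightarrow> norm (Y2.class_dseries s) \<le> M2"
      using Y2.class_dseries_bounded_mean_zero[OF Y2mean] by blast
    \<comment> \<open>In the class of -1 the two sides agree, as \<open>\<psi>^2\<close> is 1 there;
      elsewhere \<open>1 - Re (\<psi>^2) \<le> 2\<close> is paid for by the sparse weight
      \<open>A\<close>.\<close>
    have "\<eta> p \<le> 1 * \<xi> p + 2 * A p" if "prime p" for p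
    proof (cases "[int p = -1] (mod l)")
      case True
      then show ?thesis using psi(2)[OF True] psi_m1 by (simp add: eta xi A_def)
    next
      case False
      have "norm ((\<psi> (int p))\<^sup>2) \<le> 1" using psi_le[of "int p"] by (simp add: norm_power power_le_one)
      then have "Re ((\<psi> (int p))\<^sup>2) \<ge> -1" using abs_Re_le_cmod[of "(\<psi> (int p))\<^sup>2"] by linarith
      then have "R p * (-1) \<le> R p * Re ((\<psi> (int p))\<^sup>2)" by (intro mult_left_mono) (auto simp: R_def)
      then show ?thesis using False by (simp add: eta xi A_def)
    qed
    then have e: "psum \<eta> s \<le> psum (\<lambda>p. 1 * \<xi> p + 2 * A p) s" if "1 < s" for s
      using that by (intro psum_mono prime_bounded_lin pb pbA) auto
    \<comment> \<open>Here the prime sum is even bounded; the nonnegative logarithm is added to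
      match the case \<open>l = 5\<close>.\<close>
    have "psum \<eta> s \<le> ln (1 / (s - 1)) / 2 + (ln M2 + K + 2 * KA)" if s: "1 < s" "s \<le> 2" for s
    proof -
      have "psum \<xi> s \<le> ln M2 + K" unfolding \<xi>_def K_def
        using M2[OF s] by (intro mult_dirichlet.psum_upper[OF MY2 _ s]) (simp add: Y2.class_dseries_eq)
      moreover have "ln (1 / (s - 1)) \<ge> 0" using s by (intro ln_ge_zero) simp
      ultimately show ?thesis using e[OF s(1)] psum_lin[OF pb(4) pbA s(1), of 1 2] pA'[OF s] by linarith
    qed
    then show ?thesis by blast
  qed
  then obtain K2 where K2: "\<And>s. 1 < s \<Longrightarrow> s \<le> 2 \<Longrightarrow> psum \<eta> s \<le> ln (1 / (s - 1)) / 2 + K2" by blast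
  obtain c M where c: "c > 0" "\<And>s. 1 < s \<Longrightarrow> s \<le> 2 \<Longrightarrow> c / (s - 1) - M \<le> norm (Y0.class_dseries s)"
    using Y0.class_dseries_lower_trivial by (auto simp: Fj_def)
  show False
  proof (rule log_growth_contradiction[OF c(1)])
    fix s :: real assume s: "1 < s" "s \<le> 2" "0 < c / (s - 1) - M"
    have "c / (s - 1) - M \<le> norm (mult_dirichlet.L Y0.coeff s)" using c(2)[OF s(1,2)] by (simp add: Y0.class_dseries_eq)
    then have "ln (c / (s - 1) - M) - K \<le> psum \<eta> s" unfolding \<eta>_def K_def
      by (rule mult_dirichlet.psum_lower[OF MY0 _ s(3,1,2)])
    then show "ln (c / (s - 1) - M) - K \<le> ln (1 / (s - 1)) / 2 + K2" using K2[OF s(1,2)] by linarith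
  qed
qed

theorem all_represent_good:
  assumes l: "prime l" "l \<ge> 5" and D: "6 dvd D" "l dvd D"
  shows "represents_good l = invertible"
proof (rule ccontr)
  assume ne: "represents_good l \<noteq> invertible"
  \<comment> \<open>All homotheties \<open>smul \<alpha> Ord\<close> lie in the subgroup, so the
    finitely many class representatives meet every coset.\<close>
  have S: "\<exists>s\<in>repL ` Cl. \<exists>y\<in>represents_good l. x = lprod y s" if x: "x \<in> invertible" for x
  proof -
    have C: "cls x \<in> Cl" using x by (rule cls_in_Cl)
    have "cls x = cls (repL (cls x))" using rep(2)[OF C] by simp
    then obtain \<alpha> where \<alpha>: "\<alpha> \<noteq> 0" "x = smul \<alpha> (repL (cls x))" by (rule cls_eqE)
    have "x = lprod (smul \<alpha> Ord) (repL (cls x))"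
      unfolding lprod_smul Ord_lprod[OF rep(3)[OF C]] by (rule \<alpha>(2))
    then show ?thesis using smul_Ord_represents_good[OF \<alpha>(1)] C by blast
  qed
  obtain ch g where "\<And>A B. A \<in> invertible \<Longrightarrow> B \<in> invertible \<Longrightarrow> ch (lprod A B) = ch A * ch B"
    "\<And>A. A \<in> invertible \<Longrightarrow> norm (ch A :: complex) = 1" "\<And>A. A \<in> represents_good l \<Longrightarrow> ch A = 1" "g \<in> invertible" "ch g \<noteq> 1"
    using idG.exists_nontrivial_character[OF represents_good_subgroup ne _ _ S] finite_Cl rep(3) by blast
  then show False by (rule no_separating_character[OF l D])
qed

end

theorem coprime_form_represents_good:
  fixes n h k l :: int
  assumes "n > 0" "n * k - h\<^sup>2 = D" "D > 0" "coprime n D" "6 dvd D" "prime l" "l \<ge> 5" "l dvd D"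
  shows "\<exists>x y. good l (n * x\<^sup>2 + 2 * h * x * y + k * y\<^sup>2)"
proof -
  have "even D" using dvd_trans[of 2 6 D] assms(5) by simp
  then interpret disc D using assms(3) by unfold_locales
  have k: "n * k = h\<^sup>2 + D" using assms(2) by simp
  have v: "valid n h" using assms(1,4) k by (simp add: valid_def) (metis dvd_triv_left)
  have "Mlat n h \<in> represents_good l" using all_represent_good[OF assms(6,7,5,8)] Mlat_invertible[OF v] by simp
  then obtain z m where z: "z \<in> Mlat n h" "good l m" "(cmod z)\<^sup>2 / lnorm (Mlat n h) = of_int m"
    by (auto simp: represents_good_def)
  obtain x y :: int where xy: "z = of_int x * 1 + of_int y * tau n h" using z(1) unfolding Mlat_def by (rule latE)
  have "real_of_int m = (cmod (of_int x + of_int y * tau n h))\<^sup>2 * of_int n"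
    using z(3) assms(1) by (simp add: lnorm_Mlat[OF v] xy)
  also have "\<dots> = of_int (n * x\<^sup>2 + 2 * h * x * y + k * y\<^sup>2)" by (rule cmod_lattice_point[OF assms(1) k])
  finally have "m = n * x\<^sup>2 + 2 * h * x * y + k * y\<^sup>2" by (simp only: of_int_eq_iff)
  then show ?thesis using z(2) by blast
qed

lemma positive_definite_qfD:
  assumes "positive_definite_qf a b c" "(x, y) \<noteq> (0, 0)"
  shows "binary_qf a b c x y > (0 :: int)"
proof -
  have "(real_of_int x, real_of_int y) \<noteq> (0, 0)" using assms(2) by simp
  then have "binary_qf (real_of_int a) (of_int b) (of_int c) (of_int x) (of_int y) > 0"
    using assms(1) unfolding positive_definite_qf_def by blast
  then have "real_of_int (binary_qf a b c x y) > 0" by (simp add: binary_qf_def)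
  then show ?thesis by simp
qed

lemma primitive_form_represents_good:
  fixes a b c l :: int
  assumes "gcd a (gcd b c) = 1" "positive_definite_qf a b c" "prime l" "l \<ge> 5"
  shows "\<exists>x y. good l (binary_qf a b c x y)"
proof -
  define D0 where "D0 = 4 * a * c - b\<^sup>2"
  have a: "a > 0" using positive_definite_qfD[OF assms(2), of 1 0] by (simp add: binary_qf_def)
  \<comment> \<open>The vector \<open>(- b, 2 * a)\<close> is orthogonal to \<open>(1, 0)\<close>
    with respect to the form, and the value there is \<open>a * D0\<close>.\<close>
  have "binary_qf a b c (- b) (2 * a) > 0" using a by (intro positive_definite_qfD[OF assms(2)]) auto
  moreover have "binary_qf a b c (- b) (2 * a) = a * D0"
    by (simp add: binary_qf_def D0_def power2_eq_square algebra_simps)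
  ultimately have D0: "D0 > 0" using a by (simp add: zero_less_mult_iff)
  obtain x0 y0 where xy: "coprime x0 y0" "coprime (a * x0\<^sup>2 + b * x0 * y0 + c * y0\<^sup>2) (6 * l * D0)"
    using primitive_form_represents_coprime[OF assms(1), of "6 * l * D0"] assms(4) D0 by auto
  obtain u v where uv: "x0 * v - y0 * u = 1" using xy(1) by (rule coprime_complement)
  \<comment> \<open>The second vector of the new basis will be multiplied by \<open>2 * N\<close>:
    the 2 makes the middle coefficient even, and \<open>N\<close> gives \<open>D = N^2 D0\<close>
    the divisors 6 and \<open>l\<close>. The coefficient \<open>n\<close> is unaffected and, being
    prime to \<open>6 * l * D0\<close>, is prime to \<open>D\<close>.\<close>
  define N where "N = 6 * l"
  define n where "n = a * x0\<^sup>2 + b * x0 * y0 + c * y0\<^sup>2"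
  define b' where "b' = 2 * a * x0 * u + b * (x0 * v + y0 * u) + 2 * c * y0 * v"
  define c' where "c' = a * u\<^sup>2 + b * u * v + c * v\<^sup>2"
  have n: "n > 0"
  proof -
    have "binary_qf a b c x0 y0 > 0" using uv by (intro positive_definite_qfD[OF assms(2)]) auto
    then show ?thesis by (simp add: n_def binary_qf_def)
  qed
  have "4 * n * c' - b'\<^sup>2 = D0 * (x0 * v - y0 * u)\<^sup>2"
    unfolding n_def b'_def c'_def D0_def by (simp add: power2_eq_square algebra_simps)
  then have d: "4 * n * c' - b'\<^sup>2 = D0" using uv by simp
  define D where "D = N\<^sup>2 * D0"
  have "n * (4 * N\<^sup>2 * c') - (N * b')\<^sup>2 = N\<^sup>2 * (4 * n * c' - b'\<^sup>2)"
    by (simp add: power2_eq_square algebra_simps)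
  then have disc: "n * (4 * N\<^sup>2 * c') - (N * b')\<^sup>2 = D" unfolding d D_def .
  have Dpos: "D > 0" using D0 assms(4) by (simp add: D_def N_def)
  have cop: "coprime n D"
    using xy(2) unfolding n_def[symmetric] D_def N_def by (simp only: power2_eq_square coprime_mult_right_iff simp_thms)
  have dv: "6 dvd D" "l dvd D" unfolding D_def N_def by (simp_all add: power2_eq_square)
  obtain x y where g: "good l (n * x\<^sup>2 + 2 * (N * b') * x * y + (4 * N\<^sup>2 * c') * y\<^sup>2)"
    using coprime_form_represents_good[OF n disc Dpos cop dv(1) assms(3,4) dv(2)] by blast
  have "n * x\<^sup>2 + 2 * (N * b') * x * y + (4 * N\<^sup>2 * c') * y\<^sup>2 
      = binary_qf a b c (x0 * x + u * (2 * N * y)) (y0 * x + v * (2 * N * y))"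
    unfolding n_def b'_def c'_def binary_qf_def by (simp add: power2_eq_square algebra_simps)
  then show ?thesis using g by metis
qed

theorem theorem5:
  fixes a b c l :: int
  assumes "gcd a (gcd b c) = 1"
    and "positive_definite_qf a b c"
    and "prime l" and "l \<ge> 5"
  shows "\<exists>x y :: int. \<forall>p :: int. prime p \<and> p dvd binary_qf a b c x y \<longrightarrow>
           \<not> [p = 0] (mod l) \<and> \<not> [p = - 1] (mod l)"
  using primitive_form_represents_good[OF assms] unfolding good_def by blast

end
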